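(* Let $n\ge1$, let $\theta$ be a real skew-symmetric $n\times n$ matrix, let $k\in\mathbb{N}$ satisfy $k>n/2$, let $q\in\mathbb{N}$, and let $$\mathcal{P}(u)=\sum_{\nu=0}^q\sum_{\mu=1}^{N_\nu}b_{\nu,\mu,0}\,u\,b_{\nu,\mu,1}\,u\cdots u\,b_{\nu,\mu,\nu}$$ be a noncommutative polynomial with all coefficients $b_{\nu,\mu,j}\in H^k_\theta$ (the term with $\nu=0$ being $b_{0,\mu,0}$). Then, for every $u_0\in H^k_\theta$, the polynomial semilinear heat equation $$\partial_tu+Lu=\mathcal{P}(u),\qquad u(0)=u_0,$$ has a unique local (in time) mild solution: there exist $T>0$ and a unique mild solution $u\in C([0,T];H^k_\theta)$. Moreover: (a) (blow-up alternative) the solution has a maximal existence time $T_{\max}\in(0,\infty]$, and if $T_{\max}<\infty$ then $\lim_{t\to T_{\max}}\|u(t)\|_{H^k_\theta}=\infty$; (b) (continuous dependence) if two solutions $u,v$ are defined on $[0,T]$ and stay in a fixed ball of $H^k_\theta$, then $\sup_{0\le t\le T}\|u(t)-v(t)\|_{H^k_\theta}\le C_T\|u(0)-v(0)\|_{H^k_\theta}$, with $C_T$ depending only on $T$, the ball and $\mathcal{P}$; (c) (smoothing) for every $0<T<T_{\max}$ one has $u\in C((0,T];H^{k+1}_\theta)$ and, for every $0<t\le T$, $$\|u(t)\|_{H^{k+1}_\theta}\le C_{k,n}(1+t^{-1/2})\|u_0\|_{H^k_\theta}+C_{k,n}M_T(t+t^{1/2}),\qquad M_T=\sup_{0\le s\le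 T}\|\mathcal{P}(u(s))\|_{H^k_\theta},$$ where $C_{k,n}$ depends only on $k$ and $n$.
   Context: $\mathbb{N}=\{1,2,\dots\}$; the $N_\nu$ are finite nonnegative integers. Let $\theta=(\theta_{jk})$ be a real skew-symmetric $n\times n$ matrix. Let $U_1,\dots,U_n$ be unitaries with $U_kU_j=e^{2\pi i\theta_{kj}}U_jU_k$, realized in the standard representation on $\ell^2(\mathbb{Z}^n)$ (with canonical basis $(e_m)$): $U_je_m=e^{2\pi i\sum_{l<j}\theta_{jl}m_l}e_{m+\epsilon_j}$, where $\epsilon_j$ is the $j$-th unit vector. The noncommutative torus $\mathbb{T}_\theta^n=L^\infty(\mathbb{T}_\theta^n)$ is the von Neumann algebra they generate. For $m\in\mathbb{Z}^n$ put $U^m=U_1^{m_1}\cdots U_n^{m_n}$. The smooth algebra $\mathcal{A}_\theta^\infty$ is the set of all series $\sum_mc_mU^m$ with rapidly decreasing coefficients. The canonical trace $\tau$ is the faithful normal tracial state with $\tau(\sum c_mU^m)=c_0$ on $\mathcal{A}_\theta^\infty$. $L^2(\mathbb{T}_\theta^n)$ is the completion of $\mathcal{A}_\theta^\infty$ for $\|a\|_{L^2}=\tau(|a|^2)^{1/2}$; $\{U^m\}$ is an orthonormal basis of it, and $\widehat a(m)=\tau((U^m)^*a)$ are the Fourier coefficients. For $s\ge0$, $H^s_\theta$ is the set of $a\in L^2(\mathbb{T}_\theta^n)$ with $\|a\|_{H^s_\theta}^2=\sum_{m\in\mathbb{Z}^n}(1+4\pi^2|m|^2)^s|\widehat a(m)|^2<\infty$,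 where $|m|^2=m_1^2+\cdots+m_n^2$. For $k>n/2$ one has $H^k_\theta\subset L^\infty(\mathbb{T}_\theta^n)$ (inside $L^2(\mathbb{T}_\theta^n)$), and products are taken in $L^\infty(\mathbb{T}_\theta^n)$ (the product of two elements of $H^k_\theta$ is again in $H^k_\theta$). The Laplacian $L$ acts by $L(U^m)=4\pi^2|m|^2U^m$, and the heat semigroup $P_t=e^{-tL}$ by $\widehat{P_ta}(m)=e^{-4\pi^2|m|^2t}\widehat a(m)$. A mild solution on $[0,T]$ is a function $u\in C([0,T];H^k_\theta)$ with $u(t)=P_tu_0+\int_0^tP_{t-s}\mathcal{P}(u(s))\,ds$ for $0\le t\le T$ (Bochner integral in $H^k_\theta$). $T_{\max}$ is the supremum of all $T>0$ for which a mild solution in $C([0,T];H^k_\theta)$ with initial datum $u_0$ exists; $u$ also denotes the mild solution on $[0,T_{\max})$. *)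

theory Defs
  imports "HOL-Analysis.Analysis"
begin

section \<open>The Hilbert space of square-summable families\<close>

typedef 'a ell2 = "{f :: 'a \<Rightarrow> complex. (\<lambda>x. (cmod (f x))\<^sup>2) summable_on UNIV}"
  morphisms ell2_nth Abs_ell2
  by (rule exI[of _ "\<lambda>_. 0"]) simp

definition in_ell2 :: "('a \<Rightarrow> complex) \<Rightarrow> bool" where
  "in_ell2 f \<longleftrightarrow> (\<lambda>x. (cmod (f x))\<^sup>2) summable_on UNIV"

lemma in_ell2_nth [simp]: "in_ell2 (ell2_nth a)"
  using ell2_nth[of a] by (simp add: in_ell2_def)

lemma ell2_nth_Abs: "in_ell2 f \<Longrightarrow> ell2_nth (Abs_ell2 f) = f"
  by (simp add: Abs_ell2_inverse in_ell2_def)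

lemma ell2_eqI: "(\<And>x. ell2_nth a x = ell2_nth b x) \<Longrightarrow> a = b"
  by (meson ell2_nth_inject ext)

lemma in_ell2_comparison:
  assumes "in_ell2 f" "\<And>x. cmod (g x) \<le> C * cmod (f x)"
  shows "in_ell2 g"
  unfolding in_ell2_def
proof (rule summable_on_comparison_test)
  show "(\<lambda>x. C\<^sup>2 * (cmod (f x))\<^sup>2) summable_on UNIV"
    using assms(1) unfolding in_ell2_def by (rule summable_on_cmult_right)
  show "(cmod (g x))\<^sup>2 \<le> C\<^sup>2 * (cmod (f x))\<^sup>2" for x
    using power_mono[OF assms(2)[of x] norm_ge_zero, of 2] by (simp add: power_mult_distrib)
qed simp

lemma in_ell2_zero [simp]: "in_ell2 (\<lambda>_. 0)"
  by (simp add: in_ell2_def)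

lemma in_ell2_add:
  assumes "in_ell2 f" "in_ell2 g"
  shows "in_ell2 (\<lambda>x. f x + g x)"
  unfolding in_ell2_def
proof (rule summable_on_comparison_test)
  show "(\<lambda>x. 2 * (cmod (f x))\<^sup>2 + 2 * (cmod (g x))\<^sup>2) summable_on UNIV"
    using assms unfolding in_ell2_def by (intro summable_on_add summable_on_cmult_right)
  show "(cmod (f x + g x))\<^sup>2 \<le> 2 * (cmod (f x))\<^sup>2 + 2 * (cmod (g x))\<^sup>2" for x
  proof -
    have "(cmod (f x + g x))\<^sup>2 \<le> (cmod (f x) + cmod (g x))\<^sup>2"
      by (intro power_mono norm_triangle_ineq) simp
    also have "\<dots> \<le> 2 * (cmod (f x))\<^sup>2 + 2 * (cmod (g x))\<^sup>2"
      using zero_le_power2[of "cmod (f x) - cmod (g x)"]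
      by (simp add: power2_eq_square algebra_simps)
    finally show ?thesis .
  qed
qed simp

lemma in_ell2_cmult: "in_ell2 f \<Longrightarrow> in_ell2 (\<lambda>x. c * f x)"
  by (erule in_ell2_comparison[where C = "cmod c"]) (simp add: norm_mult)

lemma in_ell2_scaleR: "in_ell2 f \<Longrightarrow> in_ell2 (\<lambda>x. r *\<^sub>R f x)"
  by (erule in_ell2_comparison[where C = "\<bar>r\<bar>"]) simp

lemma in_ell2_uminus: "in_ell2 f \<Longrightarrow> in_ell2 (\<lambda>x. - f x)"
  by (erule in_ell2_comparison[where C = 1]) simp

lemma in_ell2_diff: "in_ell2 f \<Longrightarrow> in_ell2 g \<Longrightarrow> in_ell2 (\<lambda>x. f x - g x)"
  using in_ell2_add[of f "\<lambda>x. - g x"] by (simp add: in_ell2_uminus)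

lemma in_ell2_mult_summable:
  assumes "in_ell2 f" "in_ell2 g"
  shows "(\<lambda>x. norm (cnj (f x) * g x)) summable_on UNIV"
proof (rule summable_on_comparison_test)
  show "(\<lambda>x. (cmod (f x))\<^sup>2 + (cmod (g x))\<^sup>2) summable_on UNIV"
    using assms unfolding in_ell2_def by (intro summable_on_add)
  show "norm (cnj (f x) * g x) \<le> (cmod (f x))\<^sup>2 + (cmod (g x))\<^sup>2" for x
  proof -
    have "2 * (cmod (f x) * cmod (g x)) \<le> (cmod (f x))\<^sup>2 + (cmod (g x))\<^sup>2"
      using sum_squares_bound[of "cmod (f x)" "cmod (g x)"] by (simp only: mult.assoc)
    moreover have "0 \<le> cmod (f x) * cmod (g x)" by simp
    ultimately show ?thesis unfolding norm_mult complex_mod_cnj by linarith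
  qed
qed simp

lemma ell2_mult_summable [simp, intro]:
  "(\<lambda>x. cnj (ell2_nth a x) * ell2_nth b x) summable_on UNIV"
  by (rule abs_summable_summable, rule in_ell2_mult_summable) simp_all

instantiation ell2 :: (type) ab_group_add
begin

definition "0 = Abs_ell2 (\<lambda>_. 0)"
definition "a + b = Abs_ell2 (\<lambda>x. ell2_nth a x + ell2_nth b x)"
definition "a - b = Abs_ell2 (\<lambda>x. ell2_nth a x - ell2_nth b x)"
definition "- a = Abs_ell2 (\<lambda>x. - ell2_nth a x)"

lemma ell2_nth_zero [simp]: "ell2_nth 0 x = 0"
  by (simp add: zero_ell2_def ell2_nth_Abs)

lemma ell2_nth_add [simp]: "ell2_nth (a + b) x = ell2_nth a x + ell2_nth b x"
  by (simp add: plus_ell2_def ell2_nth_Abs in_ell2_add)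

lemma ell2_nth_diff [simp]: "ell2_nth (a - b) x = ell2_nth a x - ell2_nth b x"
  by (simp add: minus_ell2_def ell2_nth_Abs in_ell2_diff)

lemma ell2_nth_uminus [simp]: "ell2_nth (- a) x = - ell2_nth a x"
  by (simp add: uminus_ell2_def ell2_nth_Abs in_ell2_uminus)

instance
  by standard (auto intro!: ell2_eqI)

end

definition ell2_scaleC :: "complex \<Rightarrow> 'a ell2 \<Rightarrow> 'a ell2" where
  "ell2_scaleC c a = Abs_ell2 (\<lambda>x. c * ell2_nth a x)"

lemma ell2_nth_scaleC [simp]: "ell2_nth (ell2_scaleC c a) x = c * ell2_nth a x"
  by (simp add: ell2_scaleC_def ell2_nth_Abs in_ell2_cmult)

definition ell2_cinner :: "'a ell2 \<Rightarrow> 'a ell2 \<Rightarrow> complex" where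
  "ell2_cinner a b = (\<Sum>\<^sub>\<infinity>x. cnj (ell2_nth a x) * ell2_nth b x)"

instantiation ell2 :: (type) real_inner
begin

definition "r *\<^sub>R a = ell2_scaleC (of_real r) a" for a :: "'a ell2"
definition "inner a b = Re (ell2_cinner a b)" for a :: "'a ell2"
definition "norm a = sqrt (inner a a)" for a :: "'a ell2"
definition "sgn a = inverse (norm a) *\<^sub>R a" for a :: "'a ell2"
definition "dist a b = norm (a - b)" for a :: "'a ell2"
definition uniformity_ell2 :: "('a ell2 \<times> 'a ell2) filter" where
  "uniformity_ell2 = (INF e\<in>{0 <..}. principal {(x, y). dist x y < e})"
definition open_ell2 :: "'a ell2 set \<Rightarrow> bool" where
  "open_ell2 U \<longleftrightarrow> (\<forall>x\<in>U. \<forall>\<^sub>F (x', y) in uniformity. x' = x \<longrightarrow> y \<in> U)"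

lemma ell2_nth_scaleR [simp]: "ell2_nth (r *\<^sub>R a) x = of_real r * ell2_nth a x"
  by (simp add: scaleR_ell2_def)

lemma ell2_inner_infsum: "inner a b = (\<Sum>\<^sub>\<infinity>x. Re (cnj (ell2_nth a x) * ell2_nth b x))"
  unfolding inner_ell2_def ell2_cinner_def by (rule infsum_Re[symmetric]) simp

lemma ell2_inner_summable: "(\<lambda>x. Re (cnj (ell2_nth a x) * ell2_nth b x)) summable_on UNIV"
  by (rule summable_on_Re) simp

lemma ell2_inner_self: "inner a a = (\<Sum>\<^sub>\<infinity>x. (cmod (ell2_nth a x))\<^sup>2)"
proof -
  have "Re (cnj z * z) = (cmod z)\<^sup>2" for z
    unfolding cmod_power2 by (simp add: power2_eq_square)
  then show ?thesis by (simp only: ell2_inner_infsum)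
qed

lemma ell2_square_summable: "(\<lambda>x. (cmod (ell2_nth a x))\<^sup>2) summable_on UNIV"
  using in_ell2_nth[of a] unfolding in_ell2_def .

instance
proof
  fix a b c :: "'a ell2" and r s :: real
  show "dist a b = norm (a - b)" by (rule dist_ell2_def)
  show "r *\<^sub>R (a + b) = r *\<^sub>R a + r *\<^sub>R b" by (rule ell2_eqI) (simp add: algebra_simps)
  show "(r + s) *\<^sub>R a = r *\<^sub>R a + s *\<^sub>R a" by (rule ell2_eqI) (simp add: algebra_simps)
  show "r *\<^sub>R s *\<^sub>R a = (r * s) *\<^sub>R a" by (rule ell2_eqI) simp
  show "1 *\<^sub>R a = a" by (rule ell2_eqI) simp
  show "sgn a = inverse (norm a) *\<^sub>R a" by (rule sgn_ell2_def)
  show "uniformity = (INF e\<in>{0 <..}. principal {(x :: 'a ell2, y). dist x y < e})"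
    by (rule uniformity_ell2_def)
  show "open U \<longleftrightarrow> (\<forall>x\<in>U. \<forall>\<^sub>F (x', y) in uniformity. x' = x \<longrightarrow> y \<in> U)" for U :: "'a ell2 set"
    by (rule open_ell2_def)
  show "inner a b = inner b a"
    unfolding ell2_inner_infsum by (rule infsum_cong) (simp add: algebra_simps)
  show "inner (a + b) c = inner a c + inner b c"
    unfolding ell2_inner_infsum
      infsum_add[OF ell2_inner_summable[of a c] ell2_inner_summable[of b c], symmetric]
    by (rule infsum_cong) (simp add: algebra_simps)
  show "inner (r *\<^sub>R a) b = r * inner a b"
    unfolding ell2_inner_infsum infsum_cmult_right'[symmetric]
    by (rule infsum_cong) (simp add: algebra_simps)
  show "0 \<le> inner a a" unfolding ell2_inner_self by (rule infsum_nonneg) simp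
  show "inner a a = 0 \<longleftrightarrow> a = 0"
  proof
    assume "inner a a = 0"
    then have "(cmod (ell2_nth a x))\<^sup>2 = 0" for x
      unfolding ell2_inner_self
      by (intro nonneg_infsum_le_0D[where A = UNIV]) (auto intro: ell2_square_summable)
    then show "a = 0" by (intro ell2_eqI) simp
  next
    assume "a = 0"
    then show "inner a a = 0" by (simp add: ell2_inner_self)
  qed
  show "norm a = sqrt (inner a a)" by (rule norm_ell2_def)
qed

end

lemma ell2_norm_square: "(norm a)\<^sup>2 = (\<Sum>\<^sub>\<infinity>x. (cmod (ell2_nth a x))\<^sup>2)" for a :: "'a ell2"
  by (simp only: power2_norm_eq_inner[of a] ell2_inner_self)

lemma ell2_sum_le_norm:
  assumes "finite F"
  shows "(\<Sum>x\<in>F. (cmod (ell2_nth a x))\<^sup>2) \<le> (norm a)\<^sup>2"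
  unfolding ell2_norm_square
  by (rule finite_sum_le_infsum[OF ell2_square_summable assms]) simp_all

lemma ell2_nth_le_norm: "cmod (ell2_nth a x) \<le> norm a"
proof (rule power2_le_imp_le)
  have "(\<Sum>y\<in>{x}. (cmod (ell2_nth a y))\<^sup>2) \<le> (norm a)\<^sup>2"
    by (rule ell2_sum_le_norm) simp
  then show "(cmod (ell2_nth a x))\<^sup>2 \<le> (norm a)\<^sup>2" by simp
qed simp

lemma ell2_nth_sum [simp]: "ell2_nth (sum f A) x = (\<Sum>i\<in>A. ell2_nth (f i) x)"
  by (induction A rule: infinite_finite_induct) simp_all

lemma ell2_sum_le_normI:
  assumes "\<And>F. finite F \<Longrightarrow> (\<Sum>x\<in>F. (cmod (f x))\<^sup>2) \<le> C\<^sup>2" "0 \<le> C"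
  shows "in_ell2 f" "norm (Abs_ell2 f) \<le> C"
proof -
  show *: "in_ell2 f"
    unfolding in_ell2_def
    by (rule nonneg_bdd_above_summable_on, simp, rule bdd_aboveI2, rule assms(1)) simp
  have "(norm (Abs_ell2 f))\<^sup>2 \<le> C\<^sup>2"
    unfolding ell2_norm_square ell2_nth_Abs[OF *]
    by (rule infsum_le_finite_sums[OF *[unfolded in_ell2_def] assms(1)])
  then show "norm (Abs_ell2 f) \<le> C" using assms(2) by (rule power2_le_imp_le)
qed

instance ell2 :: (type) banach
proof
  fix X :: "nat \<Rightarrow> 'a ell2"
  assume X: "Cauchy X"
  have "Cauchy (\<lambda>n. ell2_nth (X n) x)" for x
  proof (rule metric_CauchyI)
    fix e :: real assume "e > 0"
    then obtain M where M: "\<forall>m\<ge>M. \<forall>n\<ge>M. dist (X m) (X n) < e"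
      using X metric_CauchyD by blast
    show "\<exists>M. \<forall>m\<ge>M. \<forall>n\<ge>M. dist (ell2_nth (X m) x) (ell2_nth (X n) x) < e"
    proof (intro exI allI impI)
      fix m n assume "M \<le> m" "M \<le> n"
      have "dist (ell2_nth (X m) x) (ell2_nth (X n) x) \<le> dist (X m) (X n)"
        using ell2_nth_le_norm[of "X m - X n" x] by (simp add: dist_norm)
      also have "\<dots> < e" using M \<open>M \<le> m\<close> \<open>M \<le> n\<close> by blast
      finally show "dist (ell2_nth (X m) x) (ell2_nth (X n) x) < e" .
    qed
  qed
  then have f: "(\<lambda>n. ell2_nth (X n) x) \<longlonglongrightarrow> lim (\<lambda>n. ell2_nth (X n) x)" for x
    using Cauchy_convergent convergent_LIMSEQ_iff by blast
  define f where "f x = lim (\<lambda>n. ell2_nth (X n) x)" for x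
  note f = f[folded f_def]
  have tail: "in_ell2 (\<lambda>x. f x - ell2_nth (X m) x)
      \<and> norm (Abs_ell2 (\<lambda>x. f x - ell2_nth (X m) x)) \<le> e"
    if "0 \<le> e" and e: "\<forall>n\<ge>M. dist (X m) (X n) < e" for e m M
  proof -
    have "(\<Sum>x\<in>F. (cmod (f x - ell2_nth (X m) x))\<^sup>2) \<le> e\<^sup>2" if "finite F" for F
    proof (rule tendsto_upperbound)
      show "(\<lambda>n. \<Sum>x\<in>F. (cmod (ell2_nth (X n) x - ell2_nth (X m) x))\<^sup>2)
          \<longlonglongrightarrow> (\<Sum>x\<in>F. (cmod (f x - ell2_nth (X m) x))\<^sup>2)"
        by (intro tendsto_intros f)
      show "\<forall>\<^sub>F n in sequentially.
          (\<Sum>x\<in>F. (cmod (ell2_nth (X n) x - ell2_nth (X m) x))\<^sup>2) \<le> e\<^sup>2"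
      proof (rule eventually_sequentiallyI)
        fix n assume "M \<le> n"
        have "(\<Sum>x\<in>F. (cmod (ell2_nth (X n) x - ell2_nth (X m) x))\<^sup>2) \<le> (norm (X n - X m))\<^sup>2"
          using ell2_sum_le_norm[OF that, of "X n - X m"] by simp
        also have "\<dots> \<le> e\<^sup>2"
        proof (rule power_mono)
          have "dist (X m) (X n) < e" using e \<open>M \<le> n\<close> by blast
          then show "norm (X n - X m) \<le> e" by (simp add: dist_norm norm_minus_commute[of "X n"])
        qed simp
        finally show "(\<Sum>x\<in>F. (cmod (ell2_nth (X n) x - ell2_nth (X m) x))\<^sup>2) \<le> e\<^sup>2" .
      qed
    qed simp
    note bound = this
    show ?thesis
      by (rule conjI; rule ell2_sum_le_normI) (fact bound \<open>0 \<le> e\<close>)+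
  qed
  obtain M1 where "\<forall>m\<ge>M1. \<forall>n\<ge>M1. dist (X m) (X n) < 1"
    using X metric_CauchyD[of X 1] by auto
  then have "in_ell2 (\<lambda>x. f x - ell2_nth (X M1) x)" using tail[of 1 M1 M1] by simp
  then have "in_ell2 (\<lambda>x. (f x - ell2_nth (X M1) x) + ell2_nth (X M1) x)"
    by (intro in_ell2_add) simp_all
  then have f2: "in_ell2 f" by simp
  have eq: "Abs_ell2 (\<lambda>x. f x - ell2_nth (X m) x) = Abs_ell2 f - X m" for m
    by (simp add: minus_ell2_def ell2_nth_Abs f2)
  have "X \<longlonglongrightarrow> Abs_ell2 f"
  proof (rule metric_LIMSEQ_I)
    fix e :: real assume "e > 0"
    then obtain M where M: "\<forall>m\<ge>M. \<forall>n\<ge>M. dist (X m) (X n) < e / 2"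
      using X metric_CauchyD[of X "e / 2"] by auto
    have "dist (X m) (Abs_ell2 f) < e" if "m \<ge> M" for m
    proof -
      have "norm (Abs_ell2 f - X m) \<le> e / 2"
        using tail[of "e / 2" M m] M that \<open>e > 0\<close> unfolding eq by auto
      then show ?thesis using \<open>e > 0\<close> by (simp add: dist_norm norm_minus_commute[of "X m"])
    qed
    then show "\<exists>M. \<forall>m\<ge>M. dist (X m) (Abs_ell2 f) < e" by blast
  qed
  then show "convergent X" by (auto simp: convergent_def)
qed

definition ell2_basis :: "'a \<Rightarrow> 'a ell2" where
  "ell2_basis m = Abs_ell2 (\<lambda>x. if x = m then 1 else 0)"

lemma ell2_nth_basis: "ell2_nth (ell2_basis m) x = (if x = m then 1 else 0)"
proof -
  have "in_ell2 (\<lambda>x. if x = m then 1 else (0 :: complex))"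
    unfolding in_ell2_def
    by (rule finite_nonzero_values_imp_summable_on) (rule finite_subset[of _ "{m}"], auto)
  then show ?thesis by (simp add: ell2_basis_def ell2_nth_Abs)
qed

lemma ell2_cinner_basis [simp]: "ell2_cinner (ell2_basis m) a = ell2_nth a m"
proof -
  have "ell2_cinner (ell2_basis m) a
      = (\<Sum>\<^sub>\<infinity>x\<in>{m}. cnj (ell2_nth (ell2_basis m) x) * ell2_nth a x)"
    unfolding ell2_cinner_def by (rule infsum_cong_neutral) (auto simp: ell2_nth_basis)
  then show ?thesis by (simp add: ell2_nth_basis)
qed

lemma ell2_cinner_self: "ell2_cinner a a = of_real ((norm a)\<^sup>2)"
proof -
  have "ell2_cinner a a = (\<Sum>\<^sub>\<infinity>x. of_real ((cmod (ell2_nth a x))\<^sup>2))"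
    unfolding ell2_cinner_def by (rule infsum_cong) (subst mult.commute, simp only: complex_norm_square[symmetric])
  also have "\<dots> = of_real (\<Sum>\<^sub>\<infinity>x. (cmod (ell2_nth a x))\<^sup>2)"
    by (rule infsumI, rule has_sum_of_real, rule has_sum_infsum, rule ell2_square_summable)
  finally show ?thesis by (simp add: ell2_norm_square)
qed

lemma norm_ell2_basis [simp]: "norm (ell2_basis m) = 1"
proof -
  have "complex_of_real ((norm (ell2_basis m))\<^sup>2) = 1"
    by (simp only: ell2_cinner_self[symmetric] ell2_cinner_basis ell2_nth_basis simp_thms if_True)
  then have "(norm (ell2_basis m))\<^sup>2 = 1" by (simp only: of_real_eq_1_iff)
  then show ?thesis by (simp add: power2_eq_1_iff) (smt (verit) norm_ge_zero)
qed

lemma norm_ell2_scaleC: "norm (ell2_scaleC c a) = cmod c * norm a"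
proof -
  have "(norm (ell2_scaleC c a))\<^sup>2 = (cmod c * norm a)\<^sup>2"
    by (simp add: power_mult_distrib ell2_norm_square norm_mult infsum_cmult_right')
  then show ?thesis by simp
qed

lemma ell2_finite_support_approx:
  fixes a :: "'a ell2"
  assumes "e > 0"
  obtains F where "finite F" "dist (\<Sum>m\<in>F. ell2_scaleC (ell2_nth a m) (ell2_basis m)) a < e"
proof -
  obtain F where F: "finite F"
    and d: "dist (\<Sum>x\<in>F. (cmod (ell2_nth a x))\<^sup>2) (\<Sum>\<^sub>\<infinity>x. (cmod (ell2_nth a x))\<^sup>2) \<le> (e / 2)\<^sup>2"
    using infsum_finite_approximation[OF ell2_square_summable[of a], of "(e / 2)\<^sup>2"] assms by auto
  let ?s = "\<Sum>m\<in>F. ell2_scaleC (ell2_nth a m) (ell2_basis m)"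
  have nth: "ell2_nth ?s x = (if x \<in> F then ell2_nth a x else 0)" for x
    using F by (simp add: ell2_nth_basis if_distrib[of "\<lambda>z. _ * z"] cong: if_cong)
  have "(norm (a - ?s))\<^sup>2 = (\<Sum>\<^sub>\<infinity>x\<in>-F. (cmod (ell2_nth a x))\<^sup>2)"
    unfolding ell2_norm_square
    by (rule infsum_cong_neutral) (auto simp: nth simp del: ell2_nth_sum)
  also have "\<dots> = (\<Sum>\<^sub>\<infinity>x. (cmod (ell2_nth a x))\<^sup>2) - (\<Sum>x\<in>F. (cmod (ell2_nth a x))\<^sup>2)"
  proof -
    have "(\<Sum>\<^sub>\<infinity>x\<in>F \<union> -F. (cmod (ell2_nth a x))\<^sup>2)
        = (\<Sum>\<^sub>\<infinity>x\<in>F. (cmod (ell2_nth a x))\<^sup>2) + (\<Sum>\<^sub>\<infinity>x\<in>-F. (cmod (ell2_nth a x))\<^sup>2)"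
      by (rule infsum_Un_disjoint)
        (auto intro: summable_on_subset[OF ell2_square_summable] summable_on_finite[OF F])
    then show ?thesis using F by simp
  qed
  also have "\<dots> \<le> (e / 2)\<^sup>2" using d by (simp add: dist_real_def)
  finally have "norm (a - ?s) \<le> e / 2" by (rule power2_le_imp_le) (use assms in simp)
  then show thesis using F assms by (intro that) (auto simp: dist_norm norm_minus_commute)
qed

lemma ell2_countable_dense:
  "\<exists>D :: 'a :: countable ell2 set. countable D \<and> (\<forall>a e. e > 0 \<longrightarrow> (\<exists>d\<in>D. dist d a < e))"
proof -
  define g :: "'a \<times> rat \<times> rat \<Rightarrow> 'a ell2" where
    "g = (\<lambda>(m, p, q). ell2_scaleC (Complex (of_rat p) (of_rat q)) (ell2_basis m))"
  define D where "D = range (\<lambda>xs. sum_list (map g xs))"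
  have fin: "\<exists>d\<in>D. dist d (\<Sum>m\<in>F. ell2_scaleC (c m) (ell2_basis m)) < e"
    if "finite F" "e > 0" for F c e
    using that
  proof (induction F arbitrary: e rule: finite_induct)
    case empty
    have "0 \<in> D" unfolding D_def by (rule image_eqI[of _ _ "[]"]) simp_all
    then show ?case using empty by (intro bexI[of _ 0]) auto
  next
    case (insert m F)
    obtain d where d: "d \<in> D" "dist d (\<Sum>m\<in>F. ell2_scaleC (c m) (ell2_basis m)) < e / 2"
      using insert.IH[of "e / 2"] insert.prems by auto
    then obtain xs where xs: "d = sum_list (map g xs)" by (auto simp: D_def)
    obtain p where "Re (c m) - e / 4 < real_of_rat p" "real_of_rat p < Re (c m) + e / 4"
      using of_rat_dense[of "Re (c m) - e / 4" "Re (c m) + e / 4"] insert.prems by auto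
    then have p: "\<bar>real_of_rat p - Re (c m)\<bar> < e / 4" by (simp only: abs_diff_less_iff)
    obtain q where "Im (c m) - e / 4 < real_of_rat q" "real_of_rat q < Im (c m) + e / 4"
      using of_rat_dense[of "Im (c m) - e / 4" "Im (c m) + e / 4"] insert.prems by auto
    then have q: "\<bar>real_of_rat q - Im (c m)\<bar> < e / 4" by (simp only: abs_diff_less_iff)
    have "g (m, p, q) - ell2_scaleC (c m) (ell2_basis m)
        = ell2_scaleC (Complex (of_rat p) (of_rat q) - c m) (ell2_basis m)"
      by (rule ell2_eqI) (simp add: g_def algebra_simps)
    then have "norm (g (m, p, q) - ell2_scaleC (c m) (ell2_basis m))
        = cmod (Complex (of_rat p) (of_rat q) - c m)"
      by (simp add: norm_ell2_scaleC)
    also have "\<dots> < e / 2"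
      using cmod_le[of "Complex (of_rat p) (of_rat q) - c m"] p q by simp
    finally have "dist (g (m, p, q)) (ell2_scaleC (c m) (ell2_basis m)) < e / 2"
      by (simp add: dist_norm)
    then have "dist (g (m, p, q) + d)
        (\<Sum>m\<in>insert m F. ell2_scaleC (c m) (ell2_basis m)) < e"
      using dist_triangle_add[of "g (m, p, q)" d "ell2_scaleC (c m) (ell2_basis m)"
          "\<Sum>m\<in>F. ell2_scaleC (c m) (ell2_basis m)"] d insert.hyps by simp
    moreover have "g (m, p, q) + d \<in> D"
      unfolding D_def xs by (rule image_eqI[of _ _ "(m, p, q) # xs"]) simp_all
    ultimately show ?case by blast
  qed
  have "\<exists>d\<in>D. dist d a < e" if "e > 0" for a e
  proof -
    obtain F where F: "finite F"
      "dist (\<Sum>m\<in>F. ell2_scaleC (ell2_nth a m) (ell2_basis m)) a < e / 2"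
      using ell2_finite_support_approx[of "e / 2" a] \<open>e > 0\<close> by auto
    obtain d where "d \<in> D" "dist d (\<Sum>m\<in>F. ell2_scaleC (ell2_nth a m) (ell2_basis m)) < e / 2"
      using fin[OF F(1), of "e / 2"] \<open>e > 0\<close> by auto
    then show ?thesis
      using F(2) dist_triangle[of d a "\<Sum>m\<in>F. ell2_scaleC (ell2_nth a m) (ell2_basis m)"]
      by (intro bexI[of _ d]) auto
  qed
  moreover have "countable D" unfolding D_def by (rule countable_image) simp
  ultimately show ?thesis by blast
qed

instance ell2 :: (countable) second_countable_topology
proof
  obtain D :: "'a ell2 set" where D: "countable D" "\<And>a e. e > 0 \<Longrightarrow> \<exists>d\<in>D. dist d a < e"
    using ell2_countable_dense by blast
  define B where "B = (\<lambda>(d, r). ball d (real_of_rat r)) ` (D \<times> UNIV)"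
  have "topological_basis B"
  proof (rule topological_basisI)
    fix U :: "'a ell2 set" assume "U \<in> B"
    then show "open U" by (auto simp: B_def)
  next
    fix U :: "'a ell2 set" and a assume "open U" "a \<in> U"
    then obtain e where e: "e > 0" "ball a e \<subseteq> U" by (meson openE)
    obtain d where d: "d \<in> D" "dist d a < e / 4" using D(2)[of "e / 4" a] e by auto
    obtain r where r: "e / 4 < real_of_rat r" "real_of_rat r < e / 2"
      using of_rat_dense[of "e / 4" "e / 2"] e by auto
    have "a \<in> ball d (real_of_rat r)" using d r by simp
    moreover have "ball d (real_of_rat r) \<subseteq> U"
    proof
      fix y assume "y \<in> ball d (real_of_rat r)"
      then have "dist a y < e" using d r dist_triangle[of a y d] by (simp add: dist_commute)
      then show "y \<in> U" using e by auto
    qed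
    moreover have "ball d (real_of_rat r) \<in> B" using d by (auto simp: B_def)
    ultimately show "\<exists>B'\<in>B. a \<in> B' \<and> B' \<subseteq> U" by blast
  qed
  moreover have "countable B" unfolding B_def using D(1) by (intro countable_image) simp
  ultimately show "\<exists>B :: 'a ell2 set set. countable B \<and> open = generate_topology B"
    using topological_basis_imp_subbasis by blast
qed


section \<open>Operators on the Hilbert space\<close>

text \<open>The type of bounded linear functions only guarantees real linearity, so complex linearity
  is imposed separately.\<close>

definition complex_linear_op :: "('a ell2 \<Rightarrow>\<^sub>L 'a ell2) \<Rightarrow> bool" where
  "complex_linear_op A \<longleftrightarrow>
    (\<forall>c a. blinfun_apply A (ell2_scaleC c a) = ell2_scaleC c (blinfun_apply A a))"

definition is_adjoint :: "('a ell2 \<Rightarrow>\<^sub>L 'a ell2) \<Rightarrow> ('a ell2 \<Rightarrow>\<^sub>L 'a ell2) \<Rightarrow> bool" where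
  "is_adjoint A B \<longleftrightarrow>
    (\<forall>a b. ell2_cinner (blinfun_apply A a) b = ell2_cinner a (blinfun_apply B b))"

definition commutant :: "('a ell2 \<Rightarrow>\<^sub>L 'a ell2) set \<Rightarrow> ('a ell2 \<Rightarrow>\<^sub>L 'a ell2) set" where
  "commutant S = {T. complex_linear_op T \<and> (\<forall>A\<in>S. T o\<^sub>L A = A o\<^sub>L T)}"

text \<open>The generated von Neumann algebra, as a double commutant.\<close>

definition von_neumann_algebra :: "('a ell2 \<Rightarrow>\<^sub>L 'a ell2) set \<Rightarrow> ('a ell2 \<Rightarrow>\<^sub>L 'a ell2) set" where
  "von_neumann_algebra S = commutant (commutant (S \<union> {B. \<exists>A\<in>S. is_adjoint A B}))"

text \<open>\<open>weighted_shift \<phi> d\<close> maps \<open>e\<^sub>m\<close> to \<open>\<phi> m \<cdot> e\<^bsub>m + d\<^esub>\<close>; the weight \<open>\<phi>\<close> is always unimodular below.\<close>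

definition weighted_shift :: "('a :: ab_group_add \<Rightarrow> complex) \<Rightarrow> 'a \<Rightarrow> 'a ell2 \<Rightarrow>\<^sub>L 'a ell2" where
  "weighted_shift \<phi> d = Blinfun (\<lambda>a. Abs_ell2 (\<lambda>m. \<phi> (m - d) * ell2_nth a (m - d)))"

lemma bij_diff: "bij (\<lambda>m. m - d)" for d :: "'a :: ab_group_add"
  by (rule bij_betw_byWitness[where f' = "\<lambda>m. m + d"]) auto

lemma weighted_shift_in_ell2:
  fixes a :: "'a :: ab_group_add ell2"
  assumes "\<And>m. cmod (\<phi> m) = 1"
  shows "in_ell2 (\<lambda>m. \<phi> (m - d) * ell2_nth a (m - d))"
    and "(\<Sum>\<^sub>\<infinity>m. (cmod (\<phi> (m - d) * ell2_nth a (m - d)))\<^sup>2) = (norm a)\<^sup>2"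
  using summable_on_reindex_bij_betw[OF bij_diff, of "\<lambda>m. (cmod (ell2_nth a m))\<^sup>2" d]
    infsum_reindex_bij_betw[OF bij_diff, of "\<lambda>m. (cmod (ell2_nth a m))\<^sup>2" d]
  by (simp_all add: in_ell2_def norm_mult assms ell2_square_summable ell2_norm_square)

lemma weighted_shift_apply:
  assumes "\<And>m. cmod (\<phi> m) = 1"
  shows "blinfun_apply (weighted_shift \<phi> d) a = Abs_ell2 (\<lambda>m. \<phi> (m - d) * ell2_nth a (m - d))"
proof -
  define f where "f a = Abs_ell2 (\<lambda>m. \<phi> (m - d) * ell2_nth a (m - d))" for a
  have nth: "ell2_nth (f a) = (\<lambda>m. \<phi> (m - d) * ell2_nth a (m - d))" for a
    unfolding f_def by (rule ell2_nth_Abs) (rule weighted_shift_in_ell2(1)[OF assms])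
  have "bounded_linear f"
  proof (rule bounded_linear_intro[where K = 1])
    fix a b :: "'a ell2" and r :: real
    show "f (a + b) = f a + f b" by (rule ell2_eqI) (simp add: nth distrib_left)
    show "f (r *\<^sub>R a) = r *\<^sub>R f a" by (rule ell2_eqI) (simp add: nth)
    have "(norm (f a))\<^sup>2 = (norm a)\<^sup>2"
      unfolding ell2_norm_square[of "f a"] nth by (rule weighted_shift_in_ell2(2)[OF assms])
    then show "norm (f a) \<le> norm a * 1" by simp
  qed
  then have "blinfun_apply (Blinfun f) a = f a" by (simp add: bounded_linear_Blinfun_apply)
  then show ?thesis unfolding weighted_shift_def f_def[abs_def] .
qed

lemma weighted_shift_nth:
  assumes "\<And>m. cmod (\<phi> m) = 1"
  shows "ell2_nth (blinfun_apply (weighted_shift \<phi> d) a) m = \<phi> (m - d) * ell2_nth a (m - d)"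
  using weighted_shift_in_ell2(1)[of \<phi>, OF assms]
  by (simp add: weighted_shift_apply[of \<phi>, OF assms] ell2_nth_Abs)

lemma weighted_shift_basis:
  assumes "\<And>m. cmod (\<phi> m) = 1"
  shows "blinfun_apply (weighted_shift \<phi> d) (ell2_basis p) = ell2_scaleC (\<phi> p) (ell2_basis (p + d))"
  by (rule ell2_eqI) (auto simp: weighted_shift_nth[of \<phi>, OF assms] ell2_nth_basis algebra_simps)

lemma complex_linear_weighted_shift:
  assumes "\<And>m. cmod (\<phi> m) = 1"
  shows "complex_linear_op (weighted_shift \<phi> d)"
  unfolding complex_linear_op_def
  by (intro allI ell2_eqI) (simp add: weighted_shift_nth[of \<phi>, OF assms])

lemma is_adjoint_weighted_shift:
  assumes "\<And>m. cmod (\<phi> m) = 1"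
  shows "is_adjoint (weighted_shift \<phi> d) (weighted_shift (\<lambda>m. cnj (\<phi> (m - d))) (- d))"
proof -
  have 1: "cmod (cnj (\<phi> (m - d))) = 1" for m by (simp add: assms)
  show ?thesis
    unfolding is_adjoint_def
  proof (intro allI)
    fix a b :: "'a ell2"
    have "ell2_cinner (blinfun_apply (weighted_shift \<phi> d) a) b
        = (\<Sum>\<^sub>\<infinity>m. cnj (\<phi> (m - d)) * cnj (ell2_nth a (m - d)) * ell2_nth b (m - d + d))"
      by (simp add: ell2_cinner_def weighted_shift_nth[of \<phi>, OF assms])
    also have "\<dots> = (\<Sum>\<^sub>\<infinity>m. cnj (\<phi> m) * cnj (ell2_nth a m) * ell2_nth b (m + d))"
      by (rule infsum_reindex_bij_betw[OF bij_diff,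
            of "\<lambda>m. cnj (\<phi> m) * cnj (ell2_nth a m) * ell2_nth b (m + d)"])
    also have "\<dots> = ell2_cinner a (blinfun_apply (weighted_shift (\<lambda>m. cnj (\<phi> (m - d))) (- d)) b)"
      by (simp add: ell2_cinner_def weighted_shift_nth[OF 1] mult.assoc mult.left_commute)
    finally show "ell2_cinner (blinfun_apply (weighted_shift \<phi> d) a) b
        = ell2_cinner a (blinfun_apply (weighted_shift (\<lambda>m. cnj (\<phi> (m - d))) (- d)) b)" .
  qed
qed

lemma weighted_shift_unitary:
  assumes "\<And>m. cmod (\<phi> m) = 1"
  shows "weighted_shift \<phi> d o\<^sub>L weighted_shift (\<lambda>m. cnj (\<phi> (m - d))) (- d) = id_blinfun"
    and "weighted_shift (\<lambda>m. cnj (\<phi> (m - d))) (- d) o\<^sub>L weighted_shift \<phi> d = id_blinfun"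
proof -
  have 1: "cmod (cnj (\<phi> (m - d))) = 1" for m by (simp add: assms)
  have 2: "\<phi> m * cnj (\<phi> m) = 1" for m
    by (simp add: complex_norm_square[symmetric] assms)
  show "weighted_shift \<phi> d o\<^sub>L weighted_shift (\<lambda>m. cnj (\<phi> (m - d))) (- d) = id_blinfun"
    by (intro blinfun_eqI ell2_eqI)
      (simp add: weighted_shift_nth[of \<phi>, OF assms] weighted_shift_nth[OF 1] 2 flip: mult.assoc)
  show "weighted_shift (\<lambda>m. cnj (\<phi> (m - d))) (- d) o\<^sub>L weighted_shift \<phi> d = id_blinfun"
    by (intro blinfun_eqI ell2_eqI)
      (simp add: weighted_shift_nth[of \<phi>, OF assms] weighted_shift_nth[OF 1] 2 mult.commute[of "cnj _"]
        flip: mult.assoc)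
qed

section \<open>The noncommutative torus\<close>

text \<open>The indices \<open>1, \<dots>, n\<close> are the elements of a finite linearly ordered type \<open>'n\<close>; the order enters
  through the cocycle of the standard representation.\<close>

type_synonym 'n int_lattice = "(int, 'n) vec"
type_synonym 'n real_matrix = "((real, 'n) vec, 'n) vec"
type_synonym 'n nct_L2 = "'n int_lattice ell2"
type_synonym 'n nct_op = "'n nct_L2 \<Rightarrow>\<^sub>L 'n nct_L2"

definition nct_phase :: "('n :: {finite, linorder}) real_matrix \<Rightarrow> 'n \<Rightarrow> 'n int_lattice \<Rightarrow> complex" where
  "nct_phase \<theta> j m = cis (2 * pi * (\<Sum>l\<in>{l. l < j}. \<theta> $ j $ l * of_int (m $ l)))"

definition nct_U ::
    "('n :: {finite, linorder}) real_matrix \<Rightarrow> 'n \<Rightarrow> 'n nct_op" where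
  "nct_U \<theta> j = weighted_shift (nct_phase \<theta> j) (axis j 1)"

definition nct_U_adj ::
    "('n :: {finite, linorder}) real_matrix \<Rightarrow> 'n \<Rightarrow> 'n nct_op" where
  "nct_U_adj \<theta> j = weighted_shift (\<lambda>m. cnj (nct_phase \<theta> j (m - axis j 1))) (- axis j 1)"

definition nct_Linf ::
    "('n :: {finite, linorder}) real_matrix \<Rightarrow> ('n nct_op) set" where
  "nct_Linf \<theta> = von_neumann_algebra (range (nct_U \<theta>))"

definition nct_trace :: "(('n :: finite) nct_op) \<Rightarrow> complex" where
  "nct_trace A = ell2_cinner (ell2_basis 0) (blinfun_apply A (ell2_basis 0))"

definition nct_U_power ::
    "('n :: {finite, linorder}) real_matrix \<Rightarrow> 'n \<Rightarrow> int \<Rightarrow> 'n nct_op" where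
  "nct_U_power \<theta> j z =
    (if 0 \<le> z then ((o\<^sub>L) (nct_U \<theta> j) ^^ nat z) id_blinfun
     else ((o\<^sub>L) (nct_U_adj \<theta> j) ^^ nat (- z)) id_blinfun)"

text \<open>\<open>U\<^sup>m = U\<^sub>1\<^bsup>m\<^sub>1\<^esup> \<cdots> U\<^sub>n\<^bsup>m\<^sub>n\<^esup>\<close>, the factors in increasing order of the index.\<close>

definition nct_monomial ::
    "('n :: {finite, linorder}) real_matrix \<Rightarrow> 'n int_lattice \<Rightarrow> 'n nct_op" where
  "nct_monomial \<theta> m =
    foldr (\<lambda>j A. nct_U_power \<theta> j (m $ j) o\<^sub>L A) (sorted_list_of_set UNIV) id_blinfun"

lemma norm_nct_phase [simp]: "cmod (nct_phase \<theta> j m) = 1"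
  by (simp add: nct_phase_def)

lemma nct_U_basis:
  "blinfun_apply (nct_U \<theta> j) (ell2_basis m)
    = ell2_scaleC (cis (2 * pi * (\<Sum>l\<in>{l. l < j}. \<theta> $ j $ l * of_int (m $ l))))
        (ell2_basis (m + axis j 1))"
  unfolding nct_U_def by (simp add: weighted_shift_basis nct_phase_def)

lemma nct_phase_shift:
  "nct_phase \<theta> j (m + axis i 1) = (if i < j then cis (2 * pi * \<theta> $ j $ i) else 1) * nct_phase \<theta> j m"
proof -
  have "(\<Sum>l\<in>{l. l < j}. \<theta> $ j $ l * of_int ((m + axis i 1) $ l))
      = (\<Sum>l\<in>{l. l < j}. \<theta> $ j $ l * of_int (m $ l)) + (\<Sum>l\<in>{l. l < j}. if i = l then \<theta> $ j $ i else 0)"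
    unfolding sum.distrib[symmetric]
    by (rule sum.cong) (auto simp: axis_def algebra_simps)
  also have "(\<Sum>l\<in>{l. l < j}. if i = l then \<theta> $ j $ i else 0) = (if i < j then \<theta> $ j $ i else 0)"
    by (simp add: sum.delta')
  finally show ?thesis
    by (simp add: nct_phase_def cis_mult algebra_simps)
qed

lemma nct_U_commutation:
  fixes \<theta> :: "('n :: {finite, linorder}) real_matrix"
  assumes "transpose \<theta> = - \<theta>"
  shows "blinfun_apply (nct_U \<theta> k o\<^sub>L nct_U \<theta> j) a
    = ell2_scaleC (cis (2 * pi * \<theta> $ k $ j)) (blinfun_apply (nct_U \<theta> j o\<^sub>L nct_U \<theta> k) a)"
proof (rule ell2_eqI)
  fix m :: "'n int_lattice"
  have "transpose \<theta> $ k $ j = (- \<theta>) $ k $ j" by (simp only: assms)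
  then have skew: "\<theta> $ j $ k = - \<theta> $ k $ j" by (simp add: transpose_def)
  define p where "p = m - axis j 1 - axis k 1"
  have p: "m - axis k 1 - axis j 1 = p" "m - axis k 1 = p + axis j 1" "m - axis j 1 = p + axis k 1"
    by (simp_all add: p_def algebra_simps)
  have "nct_phase \<theta> k (p + axis j 1) * nct_phase \<theta> j p
      = cis (2 * pi * \<theta> $ k $ j) * (nct_phase \<theta> j (p + axis k 1) * nct_phase \<theta> k p)"
    using skew by (cases j k rule: linorder_cases) (auto simp: nct_phase_shift cis_mult)
  then show "ell2_nth (blinfun_apply (nct_U \<theta> k o\<^sub>L nct_U \<theta> j) a) m
      = ell2_nth (ell2_scaleC (cis (2 * pi * \<theta> $ k $ j)) (blinfun_apply (nct_U \<theta> j o\<^sub>L nct_U \<theta> k) a)) m"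
    by (simp add: nct_U_def weighted_shift_nth p p_def[symmetric] mult.assoc[symmetric])
qed

lemma nct_U_adj: "is_adjoint (nct_U \<theta> j) (nct_U_adj \<theta> j)"
  unfolding nct_U_def nct_U_adj_def by (rule is_adjoint_weighted_shift) simp

lemma nct_U_unitary:
  "nct_U \<theta> j o\<^sub>L nct_U_adj \<theta> j = id_blinfun" "nct_U_adj \<theta> j o\<^sub>L nct_U \<theta> j = id_blinfun"
  unfolding nct_U_def nct_U_adj_def by (rule weighted_shift_unitary; simp)+

lemma nct_U_in_Linf: "nct_U \<theta> j \<in> nct_Linf \<theta>"
proof -
  have "complex_linear_op (nct_U \<theta> j)"
    unfolding nct_U_def by (rule complex_linear_weighted_shift) simp
  then show ?thesis
    unfolding nct_Linf_def von_neumann_algebra_def commutant_def by auto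
qed

lemma nct_phase_trivial: "(\<And>l. l < j \<Longrightarrow> p $ l = 0) \<Longrightarrow> nct_phase \<theta> j p = 1"
  by (simp add: nct_phase_def)

lemma ell2_scaleC_one [simp]: "ell2_scaleC 1 a = a"
  by (rule ell2_eqI) simp

lemma nct_U_power_basis:
  assumes "\<And>l. l < j \<Longrightarrow> p $ l = 0"
  shows "blinfun_apply (nct_U_power \<theta> j z) (ell2_basis p) = ell2_basis (p + axis j z)"
proof -
  have pos: "blinfun_apply (((o\<^sub>L) (nct_U \<theta> j) ^^ i) id_blinfun) (ell2_basis p)
      = ell2_basis (p + axis j (int i))" for i
  proof (induction i)
    case 0
    have "p + axis j (int 0) = p" "p + axis j (- int 0) = p" by (simp_all add: vec_eq_iff axis_def)
    then show ?case by (simp only: funpow_0 id_blinfun.rep_eq)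
  next
    case (Suc i)
    have "nct_phase \<theta> j (p + axis j (int i)) = 1"
      by (rule nct_phase_trivial) (use assms in \<open>auto simp: axis_def\<close>)
    moreover have "p + axis j (int i) + axis j 1 = p + axis j (int (Suc i))"
      by (simp add: vec_eq_iff axis_def)
    ultimately have "blinfun_apply (nct_U \<theta> j) (ell2_basis (p + axis j (int i)))
        = ell2_basis (p + axis j (int (Suc i)))"
      by (simp only: nct_U_def weighted_shift_basis norm_nct_phase ell2_scaleC_one)
    then show ?case by (simp del: of_nat_Suc add: Suc.IH)
  qed
  have neg: "blinfun_apply (((o\<^sub>L) (nct_U_adj \<theta> j) ^^ i) id_blinfun) (ell2_basis p)
      = ell2_basis (p + axis j (- int i))" for i
  proof (induction i)
    case 0
    have "p + axis j (int 0) = p" "p + axis j (- int 0) = p" by (simp_all add: vec_eq_iff axis_def)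
    then show ?case by (simp only: funpow_0 id_blinfun.rep_eq)
  next
    case (Suc i)
    have "nct_phase \<theta> j (p + axis j (- int (Suc i))) = 1"
      by (rule nct_phase_trivial) (use assms in \<open>auto simp: axis_def\<close>)
    moreover have "p + axis j (- int i) + - axis j 1 = p + axis j (- int (Suc i))"
      "p + axis j (- int i) - axis j 1 = p + axis j (- int (Suc i))"
      by (simp_all add: vec_eq_iff axis_def)
    ultimately have "blinfun_apply (nct_U_adj \<theta> j) (ell2_basis (p + axis j (- int i)))
        = ell2_basis (p + axis j (- int (Suc i)))"
      by (simp only: nct_U_adj_def weighted_shift_basis norm_nct_phase complex_mod_cnj
          complex_cnj_one ell2_scaleC_one)
    then show ?case by (simp del: of_nat_Suc add: Suc.IH)
  qed
  show ?thesis
    using pos[of "nat z"] neg[of "nat (- z)"] by (simp add: nct_U_power_def)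
qed

text \<open>The vector \<open>e\<^sub>0\<close> identifies \<open>L\<^sup>2\<close> with the square-summable families on \<open>\<int>\<^sup>n\<close>: the element \<open>A\<close> of the
  algebra corresponds to \<open>A e\<^sub>0\<close>, isometrically for the norm given by the trace, \<open>U\<^sup>m\<close> corresponds to
  \<open>e\<^sub>m\<close>, and the \<open>m\<close>-th Fourier coefficient is the \<open>m\<close>-th coordinate. The next lemmas establish this.
  Accordingly, elements of \<open>L\<^sup>2\<close> are represented by their Fourier coefficients.\<close>

lemma nct_monomial_vacuum: "blinfun_apply (nct_monomial \<theta> m) (ell2_basis 0) = ell2_basis m"
proof -
  have *: "blinfun_apply (foldr (\<lambda>j A. nct_U_power \<theta> j (m $ j) o\<^sub>L A) xs id_blinfun) (ell2_basis 0)
      = ell2_basis (\<chi> l. if l \<in> set xs then m $ l else 0)"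
    if "sorted xs" "distinct xs" for xs
    using that
  proof (induction xs)
    case Nil
    then show ?case by (simp add: zero_vec_def)
  next
    case (Cons j xs)
    let ?p = "\<chi> l. if l \<in> set xs then m $ l else 0"
    have "?p $ l = 0" if "l < j" for l using that Cons.prems by auto
    then have "blinfun_apply (nct_U_power \<theta> j (m $ j)) (ell2_basis ?p) = ell2_basis (?p + axis j (m $ j))"
      by (rule nct_U_power_basis)
    also have "?p + axis j (m $ j) = (\<chi> l. if l \<in> set (j # xs) then m $ l else 0)"
      using Cons.prems by (auto simp: vec_eq_iff axis_def)
    finally show ?case using Cons by simp
  qed
  show ?thesis unfolding nct_monomial_def by (subst *) simp_all
qed

lemma nct_trace_monomial: "nct_trace (nct_monomial \<theta> m) = (if m = 0 then 1 else 0)"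
  by (simp add: nct_trace_def nct_monomial_vacuum ell2_nth_basis)

lemma nct_L2_norm:
  "is_adjoint A B \<Longrightarrow> nct_trace (B o\<^sub>L A) = of_real ((norm (blinfun_apply A (ell2_basis 0)))\<^sup>2)"
  unfolding nct_trace_def is_adjoint_def by (metis blinfun_apply_blinfun_compose ell2_cinner_self)

lemma nct_fourier_coefficient:
  "is_adjoint (nct_monomial \<theta> m) V \<Longrightarrow>
    nct_trace (V o\<^sub>L A) = ell2_nth (blinfun_apply A (ell2_basis 0)) m"
  unfolding nct_trace_def is_adjoint_def
  by (metis blinfun_apply_blinfun_compose ell2_cinner_basis nct_monomial_vacuum)

text \<open>Products are taken in the von Neumann algebra. If \<open>a = A e\<^sub>0\<close> for some \<open>A\<close> in the algebra, then \<open>A\<close> is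
  unique because \<open>e\<^sub>0\<close> is separating; every \<open>a\<close> in \<open>H\<^sup>k\<close> with \<open>k > n / 2\<close> has this form.
  Otherwise \<open>nct_elem\<close> and \<open>nct_mult\<close> are unspecified.\<close>

definition nct_elem ::
    "('n :: {finite, linorder}) real_matrix \<Rightarrow> 'n nct_L2 \<Rightarrow> 'n nct_op" where
  "nct_elem \<theta> a = (THE A. A \<in> nct_Linf \<theta> \<and> blinfun_apply A (ell2_basis 0) = a)"

definition nct_mult ::
    "('n :: {finite, linorder}) real_matrix \<Rightarrow> 'n nct_L2 \<Rightarrow> 'n nct_L2 \<Rightarrow> 'n nct_L2" where
  "nct_mult \<theta> a b = blinfun_apply (nct_elem \<theta> a o\<^sub>L nct_elem \<theta> b) (ell2_basis 0)"

primrec nct_word ::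
    "('n :: {finite, linorder}) real_matrix \<Rightarrow> (nat \<Rightarrow> 'n nct_L2) \<Rightarrow> 'n nct_L2 \<Rightarrow> nat
      \<Rightarrow> 'n nct_L2" where
  "nct_word \<theta> b u 0 = b 0"
| "nct_word \<theta> b u (Suc \<nu>) = nct_mult \<theta> (nct_mult \<theta> (nct_word \<theta> b u \<nu>) u) (b (Suc \<nu>))"

definition nct_poly ::
    "('n :: {finite, linorder}) real_matrix \<Rightarrow> nat \<Rightarrow> (nat \<Rightarrow> nat) \<Rightarrow> (nat \<Rightarrow> nat \<Rightarrow> nat \<Rightarrow> 'n nct_L2)
      \<Rightarrow> 'n nct_L2 \<Rightarrow> 'n nct_L2" where
  "nct_poly \<theta> q N b u = (\<Sum>\<nu>=0..q. \<Sum>\<mu>=1..N \<nu>. nct_word \<theta> (b \<nu> \<mu>) u \<nu>)"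

section \<open>Sobolev spaces and the heat semigroup\<close>

definition laplace_symbol :: "('n :: finite) int_lattice \<Rightarrow> real" where
  "laplace_symbol m = 4 * pi\<^sup>2 * (\<Sum>i\<in>UNIV. (of_int (m $ i))\<^sup>2)"

definition sobolev_space :: "real \<Rightarrow> ('n :: finite) nct_L2 set" where
  "sobolev_space s =
    {a. (\<lambda>m. (1 + laplace_symbol m) powr s * (cmod (ell2_nth a m))\<^sup>2) summable_on UNIV}"

definition sobolev_norm :: "real \<Rightarrow> ('n :: finite) nct_L2 \<Rightarrow> real" where
  "sobolev_norm s a =
    sqrt (\<Sum>\<^sub>\<infinity>m. (1 + laplace_symbol m) powr s * (cmod (ell2_nth a m))\<^sup>2)"

definition heat :: "real \<Rightarrow> ('n :: finite) nct_L2 \<Rightarrow> 'n nct_L2" where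
  "heat t a = Abs_ell2 (\<lambda>m. of_real (exp (- laplace_symbol m * t)) * ell2_nth a m)"

text \<open>\<open>bessel s\<close> is the isometric isomorphism \<open>(1 + L)\<^bsup>s/2\<^esup>\<close> of \<open>H\<^sup>s\<close> onto \<open>L\<^sup>2\<close>; outside \<open>H\<^sup>s\<close> its values
  are meaningless.\<close>

definition bessel :: "real \<Rightarrow> ('n :: finite) nct_L2 \<Rightarrow> 'n nct_L2" where
  "bessel s a = Abs_ell2 (\<lambda>m. of_real ((1 + laplace_symbol m) powr (s / 2)) * ell2_nth a m)"

lemma laplace_symbol_nonneg [simp]: "0 \<le> laplace_symbol m"
  by (simp add: laplace_symbol_def sum_nonneg)

lemma bessel_weight_square:
  "(cmod (of_real ((1 + laplace_symbol m) powr (s / 2)) * z))\<^sup>2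
    = (1 + laplace_symbol m) powr s * (cmod z)\<^sup>2"
proof -
  have "((1 + laplace_symbol m) powr (s / 2))\<^sup>2 = (1 + laplace_symbol m) powr s"
    by (simp add: power2_eq_square flip: powr_add)
  then show ?thesis by (simp add: norm_mult power_mult_distrib)
qed

lemma bessel_nth:
  assumes "a \<in> sobolev_space s"
  shows "ell2_nth (bessel s a) m = of_real ((1 + laplace_symbol m) powr (s / 2)) * ell2_nth a m"
proof -
  have "in_ell2 (\<lambda>m. of_real ((1 + laplace_symbol m) powr (s / 2)) * ell2_nth a m)"
    using assms unfolding in_ell2_def bessel_weight_square sobolev_space_def by simp
  then show ?thesis by (simp add: bessel_def ell2_nth_Abs)
qed

lemma norm_bessel: "a \<in> sobolev_space s \<Longrightarrow> norm (bessel s a) = sobolev_norm s a"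
  by (rule power2_eq_imp_eq)
    (simp_all add: sobolev_norm_def infsum_nonneg ell2_norm_square bessel_nth bessel_weight_square)

lemma bij_betw_bessel:
  assumes "0 \<le> s"
  shows "bij_betw (bessel s) (sobolev_space s) (UNIV :: ('n :: finite) nct_L2 set)"
proof (rule bij_betwI')
  fix a b :: "'n nct_L2"
  assume ab: "a \<in> sobolev_space s" "b \<in> sobolev_space s"
  have w: "1 + laplace_symbol m \<noteq> 0" for m :: "'n int_lattice"
    using laplace_symbol_nonneg[of m] by linarith
  show "bessel s a = bessel s b \<longleftrightarrow> a = b"
  proof
    assume eq: "bessel s a = bessel s b"
    show "a = b"
    proof (rule ell2_eqI)
      fix m
      have "ell2_nth (bessel s a) m = ell2_nth (bessel s b) m" using eq by simp
      then show "ell2_nth a m = ell2_nth b m" unfolding bessel_nth[OF ab(1)] bessel_nth[OF ab(2)]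
        using w[of m] by simp
    qed
  qed simp
next
  fix c :: "'n nct_L2"
  define f where "f m = of_real ((1 + laplace_symbol m) powr (- s / 2)) * ell2_nth c m" for m
  have w: "0 < 1 + laplace_symbol m" for m :: "'n int_lattice"
    using laplace_symbol_nonneg[of m] by linarith
  have "in_ell2 f"
  proof (rule in_ell2_comparison[where C = 1])
    show "in_ell2 (ell2_nth c)" by simp
    fix m :: "'n int_lattice"
    have "(1 + laplace_symbol m) powr (- s / 2) \<le> (1 + laplace_symbol m) powr 0"
      by (rule powr_mono) (use assms in auto)
    then have "(1 + laplace_symbol m) powr (- s / 2) \<le> 1" using w[of m] by simp
    then show "cmod (f m) \<le> 1 * cmod (ell2_nth c m)"
      by (simp add: f_def norm_mult mult_left_le_one_le)
  qed
  then have nth: "ell2_nth (Abs_ell2 f) = f" by (rule ell2_nth_Abs)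
  have inv: "of_real ((1 + laplace_symbol m) powr (s / 2)) * f m = ell2_nth c m" for m
  proof -
    have "(1 + laplace_symbol m) powr (s / 2) * (1 + laplace_symbol m) powr (- s / 2) = 1"
      using w[of m] by (simp flip: powr_add)
    then show ?thesis
      unfolding f_def mult.assoc[symmetric] of_real_mult[symmetric] by simp
  qed
  have "Abs_ell2 f \<in> sobolev_space s"
    unfolding sobolev_space_def nth bessel_weight_square[symmetric] mem_Collect_eq inv
    by (rule ell2_square_summable)
  moreover from this have "c = bessel s (Abs_ell2 f)"
    by (intro ell2_eqI) (simp only: bessel_nth nth inv)
  ultimately show "\<exists>a\<in>sobolev_space s. c = bessel s a" by blast
qed simp

definition sobolev_continuous_on :: "real \<Rightarrow> real set \<Rightarrow> (real \<Rightarrow> ('n :: finite) nct_L2) \<Rightarrow> bool" where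
  "sobolev_continuous_on s I u \<longleftrightarrow>
    (\<forall>t\<in>I. u t \<in> sobolev_space s) \<and>
    (\<forall>t\<in>I. ((\<lambda>r. sobolev_norm s (u r - u t)) \<longlongrightarrow> 0) (at t within I))"

text \<open>\<open>has_sobolev_integral s t f v\<close>: the Bochner integral of \<open>f\<close> over \<open>[0, t]\<close> in \<open>H\<^sup>s\<close> exists and equals \<open>v\<close>.
  Since \<open>H\<^sup>s\<close> is not a type, the integral is transported along \<open>bessel s\<close>.\<close>

definition has_sobolev_integral ::
    "real \<Rightarrow> real \<Rightarrow> (real \<Rightarrow> ('n :: finite) nct_L2) \<Rightarrow> 'n nct_L2 \<Rightarrow> bool" where
  "has_sobolev_integral s t f v \<longleftrightarrow>
    (\<forall>r\<in>{0..t}. f r \<in> sobolev_space s) \<and> v \<in> sobolev_space s \<and>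
    has_bochner_integral lborel (\<lambda>r. indicator {0..t} r *\<^sub>R bessel s (f r)) (bessel s v)"

section \<open>Mild solutions\<close>

definition mild_solution ::
    "real \<Rightarrow> (('n :: finite) nct_L2 \<Rightarrow> 'n nct_L2) \<Rightarrow> 'n nct_L2 \<Rightarrow> real
      \<Rightarrow> (real \<Rightarrow> 'n nct_L2) \<Rightarrow> bool" where
  "mild_solution k P u0 T u \<longleftrightarrow>
    sobolev_continuous_on k {0..T} u \<and>
    (\<forall>t\<in>{0..T}. has_sobolev_integral k t (\<lambda>s. heat (t - s) (P (u s))) (u t - heat t u0))"

definition max_time ::
    "real \<Rightarrow> (('n :: finite) nct_L2 \<Rightarrow> 'n nct_L2) \<Rightarrow> 'n nct_L2 \<Rightarrow> ereal" where
  "max_time k P u0 = Sup {ereal T | T. 0 < T \<and> (\<exists>u. mild_solution k P u0 T u)}"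

definition maximal_mild_solution ::
    "real \<Rightarrow> (('n :: finite) nct_L2 \<Rightarrow> 'n nct_L2) \<Rightarrow> 'n nct_L2
      \<Rightarrow> (real \<Rightarrow> 'n nct_L2) \<Rightarrow> bool" where
  "maximal_mild_solution k P u0 u \<longleftrightarrow>
    (\<forall>T. 0 < T \<and> ereal T < max_time k P u0 \<longrightarrow> mild_solution k P u0 T u)"

end

theory Submission
  imports Defs
begin

text \<open>On \<open>H\<^sup>k\<close> with \<open>k > n / 2\<close> the Fourier coefficients are absolutely summable, so that left
  multiplication by \<open>a\<close> is the norm convergent series of the \<open>a\<^sub>p U\<^sup>p\<close>; the product is a twisted
  convolution, whose coefficients are dominated by those of the untwisted convolution of the
  absolute values. Young's inequality makes \<open>H\<^sup>k\<close> a Banach algebra up to a constant, and \<open>\<P>\<close> is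
  Lipschitz on bounded sets. The heat semigroup is contractive on \<open>H\<^sup>k\<close>, hence the Banach
  fixed point theorem, on a time interval depending only on the norm of the datum, and Gronwall's
  inequality give the solution theory. Smoothing follows from Duhamel's formula with
  \<open>(1 + L)\<^bsup>1/2\<^esup> P\<^sub>t\<close>, whose norm is at most \<open>1 + t\<^bsup>-1/2\<^esup>\<close>, in place of \<open>P\<^sub>t\<close>.\<close>

section \<open>Semilinear equations with a contraction semigroup\<close>

text \<open>H^k is not a type, and its norm is only a function on L^2. The isometry (1 + L)^{k/2}
  onto L^2 removes this obstacle: it commutes with the heat semigroup, so only the nonlinearity
  changes under conjugation, and the abstract theory can run on a Banach space type. That theory
  treats P_t and (1 + L)^{1/2} P_t by one notion of operator kernel, whose norm may blow up at time
  0 at an integrable rate. The unbounded (1 + L)^{1/2} is never applied to a solution: Duhamel's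
  formula with the second kernel defines a function, and the bounded inverse (1 + L)^{-1/2} maps it
  back to the solution. The product is defined by a description operator in a double commutant, so
  no estimate is available before the described operator is known to exist and to be unique.
  Uniqueness needs e_0 to be separating, which is read off from the right regular representation, a
  supply of operators in the commutant. The constant 2 of the smoothing estimate comes from the
  integral t + 2 t^{1/2} of 1 + r^{-1/2}.\<close>

lemma bounded_continuous_interval:
  fixes h :: "real \<Rightarrow> 'b :: real_normed_vector"
  assumes "continuous_on {a..b} h"
  obtains M where "0 \<le> M" "\<And>s. s \<in> {a..b} \<Longrightarrow> norm (h s) \<le> M"
proof -
  have "bounded (h ` {a..b})"
    by (rule compact_imp_bounded, rule compact_continuous_image[OF assms], simp)
  then obtain M where "\<forall>x\<in>h ` {a..b}. norm x \<le> M" by (auto simp: bounded_iff)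
  then show thesis by (intro that[of "max M 0"]) (auto simp: le_max_iff_disj)
qed

text \<open>Everything is required for positive times only, because the norm bound \<open>g\<close>
  may be singular at 0; integrability of \<open>g\<close> replaces boundedness. The two instances
  are the heat semigroup with \<open>g = 1\<close> and (1 + L)^{1/2} P_t with
  \<open>g t = 1 + t powr (- 1 / 2)\<close>.\<close>

locale operator_kernel =
  fixes K :: "real \<Rightarrow> 'a :: {banach, second_countable_topology} \<Rightarrow> 'a" and g :: "real \<Rightarrow> real"
  assumes linear_K: "0 < t \<Longrightarrow> linear (K t)"
    and norm_K: "0 < t \<Longrightarrow> norm (K t x) \<le> g t * norm x"
    and continuous_K: "continuous_on {0<..} (\<lambda>t. K t x)"
    and continuous_g: "continuous_on {0<..} g"
    and g_nonneg: "0 < t \<Longrightarrow> 0 \<le> g t"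
    and g_integrable: "set_integrable lborel {0<..t} g"
begin

text \<open>Duhamel's integral after the substitution r = t - s. In this form the singularity of the
  kernel stays at the fixed endpoint 0, so that one dominating function serves all
  \<open>t\<close>.\<close>

definition conv :: "(real \<Rightarrow> 'a) \<Rightarrow> real \<Rightarrow> 'a" where
  "conv h t = (LINT r:{0<..t}|lborel. K r (h (t - r)))"

text \<open>Strong continuity and a locally bounded norm give joint continuity: K_y h(y) is split
  into K_y (h(y) - h(x)), which the norm bound sends to 0, and K_y h(x), which converges by strong
  continuity.\<close>

lemma continuous_on_K:
  assumes f: "continuous_on A f" and h: "continuous_on A h" and pos: "\<And>x. x \<in> A \<Longrightarrow> 0 < f x"
  shows "continuous_on A (\<lambda>x. K (f x) (h x))"
  unfolding continuous_on_def
proof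
  fix x assume x: "x \<in> A"
  have ev: "\<forall>\<^sub>F y in at x within A. y \<in> A" by (simp add: eventually_at_filter)
  have "continuous_on A (\<lambda>y. g (f y))"
    by (rule continuous_on_compose2[OF continuous_g f]) (use pos in auto)
  then have "((\<lambda>y. g (f y) * norm (h y - h x)) \<longlongrightarrow> g (f x) * norm (h x - h x)) (at x within A)"
    using h x by (intro tendsto_intros) (auto simp: continuous_on_def)
  then have "((\<lambda>y. g (f y) * norm (h y - h x)) \<longlongrightarrow> 0) (at x within A)" by simp
  moreover have "\<forall>\<^sub>F y in at x within A. norm (K (f y) (h y - h x)) \<le> g (f y) * norm (h y - h x)"
    using ev by eventually_elim (simp add: norm_K pos)
  ultimately have 1: "((\<lambda>y. K (f y) (h y - h x)) \<longlongrightarrow> 0) (at x within A)"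
    by (rule Lim_null_comparison[rotated])
  have "continuous_on A (\<lambda>y. K (f y) (h x))"
    by (rule continuous_on_compose2[OF continuous_K f]) (use pos in auto)
  then have "((\<lambda>y. K (f y) (h x)) \<longlongrightarrow> K (f x) (h x)) (at x within A)"
    using x by (auto simp: continuous_on_def)
  from tendsto_add[OF 1 this]
  have "((\<lambda>y. K (f y) (h y - h x) + K (f y) (h x)) \<longlongrightarrow> K (f x) (h x)) (at x within A)" by simp
  moreover have "\<forall>\<^sub>F y in at x within A. K (f y) (h y - h x) + K (f y) (h x) = K (f y) (h y)"
    using ev by eventually_elim (simp add: linear_diff[OF linear_K] pos)
  ultimately show "((\<lambda>y. K (f y) (h y)) \<longlongrightarrow> K (f x) (h x)) (at x within A)"
    by (rule Lim_transform_eventually)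
qed

lemma integrand_measurable:
  assumes "continuous_on {0..t} h"
  shows "(\<lambda>r. indicator {0<..t} r *\<^sub>R K r (h (t - r))) \<in> borel_measurable borel"
proof (rule borel_measurable_continuous_on_indicator)
  show "continuous_on {0<..t} (\<lambda>r. K r (h (t - r)))"
  proof (rule continuous_on_K)
    show "continuous_on {0<..t} (\<lambda>r. h (t - r))"
      by (rule continuous_on_compose2[OF assms]) (auto intro!: continuous_intros)
  qed (auto intro: continuous_intros)
qed simp

lemma conv_integrable:
  assumes "continuous_on {0..t} h"
  shows "set_integrable lborel {0<..t} (\<lambda>r. K r (h (t - r)))"
proof -
  obtain M where M: "0 \<le> M" "\<And>s. s \<in> {0..t} \<Longrightarrow> norm (h s) \<le> M"
    using bounded_continuous_interval[OF assms] by blast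
  have "set_integrable lborel {0<..t} (\<lambda>r. g r * M)"
    using g_integrable by (rule set_integrable_mult_left)
  then show ?thesis
  proof (rule set_integrable_bound)
    show "set_borel_measurable lborel {0<..t} (\<lambda>r. K r (h (t - r)))"
      using integrand_measurable[OF assms] by (simp add: set_borel_measurable_def)
    show "AE r in lborel. r \<in> {0<..t} \<longrightarrow> norm (K r (h (t - r))) \<le> norm (g r * M)"
    proof (rule AE_I2, rule impI)
      fix r assume r: "r \<in> {0<..t}"
      have "norm (K r (h (t - r))) \<le> g r * norm (h (t - r))" using r by (simp add: norm_K)
      also have "\<dots> \<le> g r * M" using r M by (intro mult_left_mono g_nonneg) auto
      finally show "norm (K r (h (t - r))) \<le> norm (g r * M)" by simp
    qed
  qed
qed

lemma norm_conv:
  assumes "continuous_on {0..t} h" and "\<And>s. s \<in> {0..t} \<Longrightarrow> norm (h s) \<le> M"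
  shows "norm (conv h t) \<le> M * (LINT r:{0<..t}|lborel. g r)"
proof -
  have "norm (conv h t) \<le> (LINT r:{0<..t}|lborel. norm (K r (h (t - r))))"
    unfolding conv_def by (rule set_integral_norm_bound[OF conv_integrable[OF assms(1)]])
  also have "\<dots> \<le> (LINT r:{0<..t}|lborel. g r * M)"
  proof (rule set_integral_mono)
    show "set_integrable lborel {0<..t} (\<lambda>r. norm (K r (h (t - r))))"
      by (rule set_integrable_norm[OF conv_integrable[OF assms(1)]])
    show "set_integrable lborel {0<..t} (\<lambda>r. g r * M)"
      using g_integrable by (rule set_integrable_mult_left)
    fix r assume r: "r \<in> {0<..t}"
    have "norm (K r (h (t - r))) \<le> g r * norm (h (t - r))" using r by (simp add: norm_K)
    also have "\<dots> \<le> g r * M" using r assms(2) by (intro mult_left_mono g_nonneg) auto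
    finally show "norm (K r (h (t - r))) \<le> g r * M" .
  qed
  finally show ?thesis by (simp add: mult.commute)
qed

lemma continuous_on_conv:
  assumes h: "continuous_on {0..T} h"
  shows "continuous_on {0..T} (conv h)"
  unfolding continuous_on_sequentially
proof (intro allI ballI impI)
  fix x :: "nat \<Rightarrow> real" and a assume a: "a \<in> {0..T}" and x: "(\<forall>n. x n \<in> {0..T}) \<and> x \<longlonglongrightarrow> a"
  obtain M where M: "0 \<le> M" "\<And>s. s \<in> {0..T} \<Longrightarrow> norm (h s) \<le> M"
    using bounded_continuous_interval[OF h] by blast
  have sub: "continuous_on {0..t} h" if "t \<in> {0..T}" for t
    by (rule continuous_on_subset[OF h]) (use that in auto)
  let ?f = "\<lambda>t r. indicator {0<..t} r *\<^sub>R K r (h (t - r))"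
  have "(\<lambda>n. integral\<^sup>L lborel (?f (x n))) \<longlonglongrightarrow> integral\<^sup>L lborel (?f a)"
  \<comment> \<open>\<open>M\<close> bounds the forcing on all of \<open>{0..T}\<close>, so the
    majorant does not depend on the upper limit \<open>x n\<close> of the integral.\<close>
  proof (rule integral_dominated_convergence[where w = "\<lambda>r. indicator {0<..T} r *\<^sub>R (g r * M)"])
    show "?f a \<in> borel_measurable lborel" using integrand_measurable[OF sub[OF a]] by simp
    show "?f (x n) \<in> borel_measurable lborel" for n
      using integrand_measurable[OF sub, of "x n"] x by simp
    show "integrable lborel (\<lambda>r. indicator {0<..T} r *\<^sub>R (g r * M))"
      using set_integrable_mult_left[OF g_integrable, of T M] by (simp add: set_integrable_def)
    show "AE r in lborel. (\<lambda>n. ?f (x n) r) \<longlonglongrightarrow> ?f a r"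
      \<comment> \<open>At \<open>r = a\<close> the indicators of \<open>{0<..x n}\<close> may
        oscillate with \<open>n\<close>; this single point is discarded.\<close>
      using AE_lborel_singleton[of a]
    proof eventually_elim
      fix r :: real assume "r \<noteq> a"
      consider "r \<le> 0" | "0 < r" "r < a" | "a < r" using \<open>r \<noteq> a\<close> by linarith
      then show "(\<lambda>n. ?f (x n) r) \<longlonglongrightarrow> ?f a r"
      proof cases
        case 1
        then show ?thesis by simp
      next
        case 2
        have ev: "\<forall>\<^sub>F n in sequentially. r < x n" using x 2 by (auto simp: order_tendsto_iff)
        have "continuous_on {r..T} (\<lambda>t. K r (h (t - r)))"
          by (rule continuous_on_K) (use 2 in \<open>auto intro!: continuous_intros continuous_on_compose2[OF h]\<close>)
        moreover have "a \<in> {r..T}" using a 2 by auto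
        moreover have "\<forall>\<^sub>F n in sequentially. x n \<in> {r..T}"
          using ev by eventually_elim (use x in auto)
        ultimately have "(\<lambda>n. K r (h (x n - r))) \<longlonglongrightarrow> K r (h (a - r))"
          using x by (intro continuous_on_tendsto_compose[where f = "\<lambda>t. K r (h (t - r))"]) auto
        moreover have "\<forall>\<^sub>F n in sequentially. K r (h (x n - r)) = ?f (x n) r"
          using ev by eventually_elim (use 2 in simp)
        ultimately show ?thesis using 2 by (auto intro: Lim_transform_eventually)
      next
        case 3
        have "\<forall>\<^sub>F n in sequentially. x n < r" using x 3 by (auto simp: order_tendsto_iff)
        then have "\<forall>\<^sub>F n in sequentially. ?f (x n) r = ?f a r"
          by eventually_elim (use 3 in simp)
        then show ?thesis by (rule tendsto_eventually)
      qed
    qed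
    show "AE r in lborel. norm (?f (x n) r) \<le> indicator {0<..T} r *\<^sub>R (g r * M)" for n
    proof (rule AE_I2)
      fix r
      have xn: "0 \<le> x n" "x n \<le> T" using x by auto
      show "norm (?f (x n) r) \<le> indicator {0<..T} r *\<^sub>R (g r * M)"
      proof (cases "r \<in> {0<..x n}")
        case True
        have "norm (K r (h (x n - r))) \<le> g r * norm (h (x n - r))" using True by (simp add: norm_K)
        also have "\<dots> \<le> g r * M"
          using True M(2)[of "x n - r"] xn by (intro mult_left_mono g_nonneg) auto
        finally show ?thesis using True xn by simp
      next
        case False
        then show ?thesis using M g_nonneg[of r] by (auto simp: indicator_def)
      qed
    qed
  qed
  then show "(conv h \<circ> x) \<longlonglongrightarrow> conv h a" by (simp add: conv_def[abs_def] set_lebesgue_integral_def o_def)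
qed

lemma conv_diff:
  assumes "continuous_on {0..t} h" "continuous_on {0..t} h'"
  shows "conv h t - conv h' t = conv (\<lambda>s. h s - h' s) t"
proof -
  have "conv h t - conv h' t = (LINT r:{0<..t}|lborel. K r (h (t - r)) - K r (h' (t - r)))"
    unfolding conv_def by (rule set_integral_diff(2)[symmetric]) (rule conv_integrable assms)+
  also have "\<dots> = conv (\<lambda>s. h s - h' s) t"
    unfolding conv_def set_lebesgue_integral_def
    by (rule Bochner_Integration.integral_cong) (auto simp: indicator_def linear_diff[OF linear_K])
  finally show ?thesis .
qed

text \<open>Gronwall's inequality needs the forcing under an integral, not its supremum. For
  \<open>g = 1\<close> the pointwise bound at \<open>t - r\<close> survives, and a reflection of the
  interval brings it to the variable \<open>s\<close>.\<close>

lemma norm_conv_le_integral: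
  fixes d :: "real \<Rightarrow> real"
  assumes "continuous_on {0..t} h" "continuous_on {0..t} d" "\<And>s. s \<in> {0..t} \<Longrightarrow> norm (h s) \<le> d s"
    and g: "\<And>r. 0 < r \<Longrightarrow> g r = 1"
  shows "norm (conv h t) \<le> (LINT s:{0..t}|lborel. d s)"
proof -
  have d: "set_integrable lborel {0..t} (\<lambda>s. d (t - s))"
    by (rule borel_integrable_atLeastAtMost')
      (auto intro!: continuous_intros continuous_on_compose2[OF assms(2)])
  have "norm (conv h t) \<le> (LINT r:{0<..t}|lborel. norm (K r (h (t - r))))"
    unfolding conv_def by (rule set_integral_norm_bound[OF conv_integrable[OF assms(1)]])
  also have "\<dots> \<le> (LINT r:{0<..t}|lborel. d (t - r))"
  proof (rule set_integral_mono)
    show "set_integrable lborel {0<..t} (\<lambda>r. norm (K r (h (t - r))))"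
      by (rule set_integrable_norm[OF conv_integrable[OF assms(1)]])
    show "set_integrable lborel {0<..t} (\<lambda>r. d (t - r))"
      by (rule set_integrable_subset[OF d]) auto
    fix r assume r: "r \<in> {0<..t}"
    have "norm (K r (h (t - r))) \<le> g r * norm (h (t - r))" using r by (simp add: norm_K)
    also have "\<dots> \<le> d (t - r)" using r assms(3) by (simp add: g)
    finally show "norm (K r (h (t - r))) \<le> d (t - r)" .
  qed
  also have "\<dots> = (LINT r:{0..t}|lborel. d (t - r))"
    unfolding set_lebesgue_integral_def
    by (rule integral_discrete_difference[where X = "{0}"]) (auto simp: indicator_def)
  also have "\<dots> = (LINT s:{0..t}|lborel. d s)"
    unfolding set_lebesgue_integral_def
    by (subst lborel_integral_real_affine[where c = "-1" and t = t])
      (auto simp: indicator_def intro!: Bochner_Integration.integral_cong)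
  finally show ?thesis .
qed

text \<open>The convolution in the form in which it appears in Duhamel's formula; the value of \<open>k\<close> at
  the single point \<open>0\<close> is irrelevant.\<close>

lemma has_bochner_integral_conv:
  assumes "continuous_on {0..t} h" and k: "\<And>r x. 0 < r \<Longrightarrow> k r x = K r x"
  shows "has_bochner_integral lborel (\<lambda>s. indicator {0..t} s *\<^sub>R k (t - s) (h s)) (conv h t)"
proof -
  have "has_bochner_integral lborel (\<lambda>r. indicator {0<..t} r *\<^sub>R K r (h (t - r))) (conv h t)"
    using conv_integrable[OF assms(1)]
    by (simp add: has_bochner_integral_iff set_integrable_def conv_def set_lebesgue_integral_def)
  then have "has_bochner_integral lborel (\<lambda>r. indicator {0..t} r *\<^sub>R k r (h (t - r))) (conv h t)"
    by (rule has_bochner_integral_discrete_difference[where X = "{0}", THEN iffD1, rotated 4])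
      (auto simp: indicator_def k)
  then show ?thesis
    by (subst lborel_has_bochner_integral_real_affine_iff[where c = "-1" and t = t])
      (auto simp: indicator_def elim!: has_bochner_integral_cong[THEN iffD1, rotated 3])
qed

text \<open>A bounded operator passes through the Bochner integral. It is used with
  \<open>E = S t\<close>, where \<open>k r\<close> is \<open>S (t + r)\<close>, and with E = (1 +
  L)^{-1/2}, where \<open>k r\<close> is the heat operator.\<close>

lemma conv_commute:
  assumes "continuous_on {0..t} h" and E: "bounded_linear E" and E': "\<And>r x. 0 < r \<Longrightarrow> E (K r x) = k r x"
  shows "E (conv h t) = (LINT r:{0<..t}|lborel. k r (h (t - r)))"
proof -
  have "E (conv h t) = (LINT r|lborel. E (indicator {0<..t} r *\<^sub>R K r (h (t - r))))"
    unfolding conv_def set_lebesgue_integral_def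
    by (rule integral_bounded_linear[OF E, symmetric])
      (use conv_integrable[OF assms(1)] in \<open>simp add: set_integrable_def\<close>)
  also have "\<dots> = (LINT r|lborel. indicator {0<..t} r *\<^sub>R k r (h (t - r)))"
    by (rule Bochner_Integration.integral_cong)
      (auto simp: indicator_def E' linear_0[OF bounded_linear.linear[OF E]])
  finally show ?thesis by (simp add: set_lebesgue_integral_def)
qed

end

section \<open>Gronwall's inequality\<close>

lemma integral_exp_le:
  fixes L t :: real assumes "0 < L" "0 \<le> t"
  shows "(LINT s:{0..t}|lborel. exp (2 * L * s)) \<le> exp (2 * L * t) / (2 * L)"
proof -
  have "(LINT s:{0..t}|lborel. exp (2 * L * s)) = exp (2 * L * t) / (2 * L) - exp (2 * L * 0) / (2 * L)"
    unfolding set_lebesgue_integral_def real_scaleR_def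
    by (subst mult.commute, rule integral_FTC_Icc_real)
      (use assms in \<open>auto intro!: derivative_eq_intros continuous_intros\<close>)
  then show ?thesis using assms by simp
qed

text \<open>Gronwall's inequality with the constant \<open>2 exp (2 L t)\<close>: at a maximum point of
  \<open>exp (- 2 L t) d t\<close> the integral absorbs at most half of the left-hand side.\<close>

lemma gronwall:
  fixes d :: "real \<Rightarrow> real"
  assumes "0 < L" and d: "continuous_on {0..T} d"
    and le: "\<And>t. t \<in> {0..T} \<Longrightarrow> d t \<le> d0 + L * (LINT s:{0..t}|lborel. d s)"
    and "0 \<le> d0" "t \<in> {0..T}"
  shows "d t \<le> 2 * exp (2 * L * t) * d0"
proof -
  let ?e = "\<lambda>t. exp (- (2 * L * t)) * d t"
  have "\<exists>x\<in>{0..T}. \<forall>y\<in>{0..T}. ?e y \<le> ?e x"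
    by (rule continuous_attains_sup) (use assms in \<open>auto intro!: continuous_intros\<close>)
  then obtain x where x: "x \<in> {0..T}" "\<And>y. y \<in> {0..T} \<Longrightarrow> ?e y \<le> ?e x" by blast
  have bound: "d y \<le> ?e x * exp (2 * L * y)" if "y \<in> {0..T}" for y
  proof -
    have "?e y * exp (2 * L * y) \<le> ?e x * exp (2 * L * y)"
      using x(2)[OF that] by (rule mult_right_mono) simp
    then show ?thesis by (simp add: exp_minus field_simps)
  qed
  have "?e x \<le> 2 * d0"
  proof (cases "?e x \<le> 0")
    case True
    then show ?thesis using assms by linarith
  next
    case False
    have "d x \<le> d0 + L * (LINT s:{0..x}|lborel. d s)" by (rule le[OF x(1)])
    also have "(LINT s:{0..x}|lborel. d s) \<le> (LINT s:{0..x}|lborel. ?e x * exp (2 * L * s))"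
      by (rule set_integral_mono)
        (use x(1) in \<open>auto intro!: borel_integrable_atLeastAtMost' continuous_intros continuous_on_subset[OF d] bound\<close>)
    also have "\<dots> = ?e x * (LINT s:{0..x}|lborel. exp (2 * L * s))" by simp
    also have "\<dots> \<le> ?e x * (exp (2 * L * x) / (2 * L))"
      using integral_exp_le[of L x] False x(1) \<open>0 < L\<close> by (intro mult_left_mono) auto
    also have "L * (?e x * (exp (2 * L * x) / (2 * L))) = d x / 2"
      using \<open>0 < L\<close> by (simp add: exp_minus field_simps)
    finally have "d x \<le> 2 * d0" using \<open>0 < L\<close> by simp
    moreover have "?e x \<le> 1 * d x"
      using False x(1) \<open>0 < L\<close> by (intro mult_right_mono) (auto simp: not_le zero_less_mult_iff)
    ultimately show ?thesis by simp
  qed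
  then have "?e x * exp (2 * L * t) \<le> 2 * d0 * exp (2 * L * t)" by (rule mult_right_mono) simp
  then have "d t \<le> 2 * d0 * exp (2 * L * t)" using bound[OF \<open>t \<in> {0..T}\<close>] by (rule order_trans[rotated])
  then show ?thesis by (simp only: mult_ac)
qed

section \<open>Contraction semigroups and Duhamel's formula after a restart\<close>

locale semigroup_kernel = operator_kernel S "\<lambda>_. 1" for S :: "real \<Rightarrow> 'a :: {banach, second_countable_topology} \<Rightarrow> 'a" +
  assumes S_zero: "S 0 x = x"
    and S_add: "0 \<le> s \<Longrightarrow> 0 \<le> t \<Longrightarrow> S (s + t) x = S s (S t x)"
    and continuous_S: "continuous_on {0..} (\<lambda>t. S t x)"
begin

lemma norm_S: "0 \<le> t \<Longrightarrow> norm (S t x) \<le> norm x"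
  using norm_K[of t x] by (cases "t = 0") (auto simp: S_zero)

lemma linear_S: "0 \<le> t \<Longrightarrow> linear (S t)"
  using linear_K[of t] by (cases "t = 0") (auto simp: S_zero[abs_def] linear_id[unfolded id_def])

lemma bounded_linear_S: "0 \<le> t \<Longrightarrow> bounded_linear (S t)"
  by (rule bounded_linear_intro[where K = 1]) (auto simp: linear_add linear_S linear_scale norm_S)

text \<open>The variable \<open>r\<close> is the time elapsed since the forcing acted. The part with
  \<open>r\<close> at most \<open>t\<close> sees only the forcing after \<open>T\<close> and is a
  convolution of the shifted forcing; in the older part the semigroup law lets \<open>S t\<close> be
  factored out.\<close>

lemma conv_add:
  assumes h: "continuous_on {0..T + t} h" and "0 \<le> T" "0 \<le> t"
  shows "conv h (T + t) = S t (conv h T) + conv (\<lambda>s. h (T + s)) t"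
proof -
  let ?f = "\<lambda>r. S r (h (T + t - r))"
  have int: "set_integrable lborel {0<..T + t} ?f" by (rule conv_integrable[OF h])
  have "conv h (T + t) = (LINT r:{0<..t} \<union> {t<..T + t}|lborel. ?f r)"
    unfolding conv_def using assms by (simp add: ivl_disj_un_two)
  also have "\<dots> = (LINT r:{0<..t}|lborel. ?f r) + (LINT r:{t<..T + t}|lborel. ?f r)"
    by (rule set_integral_Un) (use assms in \<open>auto intro!: set_integrable_subset[OF int]\<close>)
  also have "(LINT r:{0<..t}|lborel. ?f r) = conv (\<lambda>s. h (T + s)) t"
    by (simp add: conv_def algebra_simps)
  also have "(LINT r:{t<..T + t}|lborel. ?f r) = (LINT r:{0<..T}|lborel. S (t + r) (h (T - r)))"
    unfolding set_lebesgue_integral_def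
    by (subst lborel_integral_real_affine[where c = 1 and t = t])
      (auto simp: indicator_def intro!: Bochner_Integration.integral_cong)
  also have "\<dots> = S t (conv h T)"
    by (rule conv_commute[symmetric])
      (use assms in \<open>auto simp: S_add bounded_linear_S intro: continuous_on_subset[OF h]\<close>)
  finally show ?thesis by simp
qed

end

section \<open>Existence, uniqueness and continuation for a locally Lipschitz nonlinearity\<close>

locale semilinear = semigroup_kernel S for S :: "real \<Rightarrow> 'a :: {banach, second_countable_topology} \<Rightarrow> 'a" +
  fixes F :: "'a \<Rightarrow> 'a"
  assumes local_lipschitz_F: "\<exists>L. \<forall>x y. norm x \<le> R \<longrightarrow> norm y \<le> R \<longrightarrow> norm (F x - F y) \<le> L * norm (x - y)"
begin

definition mild :: "'a \<Rightarrow> real \<Rightarrow> (real \<Rightarrow> 'a) \<Rightarrow> bool" where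
  "mild x T v \<longleftrightarrow> continuous_on {0..T} v \<and> (\<forall>t\<in>{0..T}. v t = S t x + conv (\<lambda>s. F (v s)) t)"

lemma lipschitz_ballE:
  obtains L where "0 < L" "\<And>x y. norm x \<le> R \<Longrightarrow> norm y \<le> R \<Longrightarrow> norm (F x - F y) \<le> L * norm (x - y)"
proof -
  obtain L where L: "norm x \<le> R \<Longrightarrow> norm y \<le> R \<Longrightarrow> norm (F x - F y) \<le> L * norm (x - y)" for x y
    using local_lipschitz_F[of R] by auto
  have "norm (F x - F y) \<le> max L 1 * norm (x - y)" if "norm x \<le> R" "norm y \<le> R" for x y
    using L[OF that] mult_right_mono[of L "max L 1" "norm (x - y)"] by simp
  then show thesis by (intro that[of "max L 1"]) auto
qed

lemma continuous_F: "continuous_on A F"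
proof (rule continuous_on_subset[OF _ subset_UNIV], unfold continuous_on_def, rule ballI)
  fix x :: 'a
  obtain L where L: "0 < L"
    "\<And>y z. norm y \<le> norm x + 1 \<Longrightarrow> norm z \<le> norm x + 1 \<Longrightarrow> norm (F y - F z) \<le> L * norm (y - z)"
    using lipschitz_ballE by blast
  have "((\<lambda>y. F y - F x) \<longlongrightarrow> 0) (at x within UNIV)"
  proof (rule Lim_null_comparison)
    have "((\<lambda>y. L * norm (y - x)) \<longlongrightarrow> L * norm (x - x)) (at x)" by (intro tendsto_intros)
    then show "((\<lambda>y. L * norm (y - x)) \<longlongrightarrow> 0) (at x)" by simp
    have "\<forall>\<^sub>F y in at x. dist y x < 1" by (auto simp: eventually_at intro: exI[of _ 1])
    then show "\<forall>\<^sub>F y in at x. norm (F y - F x) \<le> L * norm (y - x)"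
    proof eventually_elim
      fix y assume "dist y x < 1"
      then have "norm y \<le> norm x + 1" using norm_triangle_ineq2[of y x] by (simp add: dist_norm)
      then show "norm (F y - F x) \<le> L * norm (y - x)" by (intro L) auto
    qed
  qed
  then show "(F \<longlongrightarrow> F x) (at x within UNIV)" by (simp add: LIM_zero_iff)
qed

lemma continuous_on_F: "continuous_on A v \<Longrightarrow> continuous_on A (\<lambda>s. F (v s))"
  by (rule continuous_on_compose2[OF continuous_F[of UNIV]]) auto

lemma mild_continuous: "mild x T v \<Longrightarrow> continuous_on {0..T} v"
  by (simp add: mild_def)

lemma mild_eq: "mild x T v \<Longrightarrow> 0 \<le> t \<Longrightarrow> t \<le> T \<Longrightarrow> v t = S t x + conv (\<lambda>s. F (v s)) t"
  by (simp add: mild_def)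

lemma mild_0: "mild x T v \<Longrightarrow> 0 \<le> T \<Longrightarrow> v 0 = x"
  by (simp add: mild_def S_zero conv_def set_lebesgue_integral_def)

lemma mild_cong:
  assumes "mild x T v" "\<And>t. 0 \<le> t \<Longrightarrow> t \<le> T \<Longrightarrow> v t = w t"
  shows "mild x T w"
proof -
  have "conv (\<lambda>s. F (v s)) t = conv (\<lambda>s. F (w s)) t" if "t \<in> {0..T}" for t
    unfolding conv_def set_lebesgue_integral_def
    by (rule Bochner_Integration.integral_cong) (use assms(2) that in \<open>auto simp: indicator_def\<close>)
  then show ?thesis using assms continuous_on_cong[of "{0..T}" "{0..T}" v w] by (auto simp: mild_def)
qed

lemma mild_mono: "mild x T v \<Longrightarrow> T' \<le> T \<Longrightarrow> mild x T' v"
  by (auto simp: mild_def intro: continuous_on_subset)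

lemma mild_append:
  assumes v: "mild x T v" and w: "mild (v T) \<tau> w" and "0 \<le> T" "0 \<le> \<tau>"
  shows "mild x (T + \<tau>) (\<lambda>t. if t \<le> T then v t else w (t - T))"
proof -
  define u where "u t = (if t \<le> T then v t else w (t - T))" for t
  have w0: "w 0 = v T" using w assms(4) by (rule mild_0)
  have cont: "continuous_on ({0..T} \<union> {T..T + \<tau>}) u"
    unfolding u_def[abs_def]
  proof (rule continuous_on_cases)
    show "continuous_on {0..T} v" using v by (rule mild_continuous)
    show "continuous_on {T..T + \<tau>} (\<lambda>t. w (t - T))"
      by (rule continuous_on_compose2[OF mild_continuous[OF w]]) (auto intro!: continuous_intros)
  qed (auto simp: w0)
  then have cont: "continuous_on {0..T + \<tau>} u"
    using assms by (simp add: ivl_disj_un_two_touch)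
  \<comment> \<open>Both pieces are rewritten in terms of the glued function, so that a single
    forcing \<open>F (u s)\<close> enters \<open>conv_add\<close>.\<close>
  have uv: "mild x T u" by (rule mild_cong[OF v]) (simp add: u_def)
  have uw: "mild (u T) \<tau> (\<lambda>t. u (T + t))"
    using mild_cong[OF w, of "\<lambda>t. u (T + t)"] by (simp add: u_def w0)
  have "u t = S t x + conv (\<lambda>s. F (u s)) t" if "t \<in> {0..T + \<tau>}" for t
  proof (cases "t \<le> T")
    case True
    then show ?thesis using mild_eq[OF uv] that by auto
  next
    case False
    then have t: "0 \<le> t - T" "t - T \<le> \<tau>" using that by auto
    have "u t = S (t - T) (u T) + conv (\<lambda>s. F (u (T + s))) (t - T)"
      using mild_eq[OF uw t] by simp
    also have "u T = S T x + conv (\<lambda>s. F (u s)) T"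
      using mild_eq[OF uv, of T] assms by auto
    also have "S (t - T) (S T x + conv (\<lambda>s. F (u s)) T) + conv (\<lambda>s. F (u (T + s))) (t - T)
        = S t x + conv (\<lambda>s. F (u s)) (T + (t - T))"
    proof (subst conv_add)
      show "continuous_on {0..T + (t - T)} (\<lambda>s. F (u s))"
        by (rule continuous_on_F, rule continuous_on_subset[OF cont]) (use that in auto)
    qed (use t assms in \<open>auto simp: linear_add linear_S simp flip: S_add\<close>)
    finally show ?thesis by simp
  qed
  then show ?thesis using cont by (simp add: mild_def u_def[abs_def])
qed

text \<open>Gronwall's inequality for the difference of the two Duhamel formulas. The constant 2
  exp(2 L T) involves only \<open>T\<close> and the Lipschitz constant \<open>L\<close> of
  \<open>F\<close> on the ball of radius \<open>R\<close>, hence it can be chosen before data and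
  solutions.\<close>

lemma lipschitz_dependence:
  "\<exists>C. \<forall>x y u v. mild x T u \<longrightarrow> mild y T v \<longrightarrow> (\<forall>t\<in>{0..T}. norm (u t) \<le> R \<and> norm (v t) \<le> R)
    \<longrightarrow> (\<forall>t\<in>{0..T}. norm (u t - v t) \<le> C * norm (x - y))"
proof -
  obtain L where L: "0 < L"
    "\<And>x y. norm x \<le> R \<Longrightarrow> norm y \<le> R \<Longrightarrow> norm (F x - F y) \<le> L * norm (x - y)"
    using lipschitz_ballE by blast
  show ?thesis
  proof (intro exI allI impI ballI)
    fix x y u v t
    assume u: "mild x T u" and v: "mild y T v"
      and R: "\<forall>t\<in>{0..T}. norm (u t) \<le> R \<and> norm (v t) \<le> R" and t: "t \<in> {0..T}"
    have cont: "continuous_on {0..r} u" "continuous_on {0..r} v" if "r \<in> {0..T}" for r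
      using that by (auto intro: continuous_on_subset[OF mild_continuous[OF u]] continuous_on_subset[OF mild_continuous[OF v]])
    have "norm (u t - v t) \<le> 2 * exp (2 * L * t) * norm (x - y)"
    proof (rule gronwall[OF L(1) _ _ _ t])
      show "continuous_on {0..T} (\<lambda>t. norm (u t - v t))"
        using mild_continuous[OF u] mild_continuous[OF v] by (intro continuous_intros)
      fix r assume r: "r \<in> {0..T}"
      have "u r - v r = S r (x - y) + conv (\<lambda>s. F (u s) - F (v s)) r"
        using mild_eq[OF u, of r] mild_eq[OF v, of r] r cont[OF r]
        by (simp add: conv_diff[symmetric] continuous_on_F linear_diff linear_S)
      then have "norm (u r - v r) \<le> norm (S r (x - y)) + norm (conv (\<lambda>s. F (u s) - F (v s)) r)"
        by (simp add: norm_triangle_ineq)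
      moreover have "norm (S r (x - y)) \<le> norm (x - y)" using r by (simp add: norm_S)
      moreover have "norm (conv (\<lambda>s. F (u s) - F (v s)) r) \<le> (LINT s:{0..r}|lborel. L * norm (u s - v s))"
        using cont[OF r] R r
        by (intro norm_conv_le_integral) (auto intro!: continuous_intros continuous_on_F L(2))
      ultimately show "norm (u r - v r) \<le> norm (x - y) + L * (LINT s:{0..r}|lborel. norm (u s - v s))"
        by simp
    qed simp
    also have "\<dots> \<le> 2 * exp (2 * L * T) * norm (x - y)"
      using t L(1) by (intro mult_right_mono) auto
    finally show "norm (u t - v t) \<le> 2 * exp (2 * L * T) * norm (x - y)" .
  qed
qed

text \<open>Continuous dependence with equal data; continuity on a compact interval puts both
  solutions into a common ball.\<close>

lemma mild_unique:
  assumes u: "mild x T u" and v: "mild x T v" and t: "0 \<le> t" "t \<le> T"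
  shows "u t = v t"
proof -
  obtain M where M: "\<And>s. s \<in> {0..T} \<Longrightarrow> norm (u s) \<le> M"
    using bounded_continuous_interval[OF mild_continuous[OF u]] by blast
  obtain M' where M': "\<And>s. s \<in> {0..T} \<Longrightarrow> norm (v s) \<le> M'"
    using bounded_continuous_interval[OF mild_continuous[OF v]] by blast
  obtain C where "norm (u s - v s) \<le> C * norm (x - x)"
    if "\<forall>t\<in>{0..T}. norm (u t) \<le> max M M' \<and> norm (v t) \<le> max M M'" "s \<in> {0..T}" for s
    using lipschitz_dependence[of T "max M M'"] u v by blast
  then show ?thesis using M M' t by (auto simp: le_max_iff_disj)
qed

text \<open>The existence time is uniform over all data in a ball. This uniformity, and not
  existence alone, is what the blow-up alternative rests on.\<close>

lemma local_existence:
  "\<exists>\<tau>>0. \<forall>x. norm x \<le> R \<longrightarrow> (\<exists>v. mild x \<tau> v)"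
proof -
  obtain L where L: "0 < L"
    "\<And>x y. norm x \<le> R + 1 \<Longrightarrow> norm y \<le> R + 1 \<Longrightarrow> norm (F x - F y) \<le> L * norm (x - y)"
    using lipschitz_ballE by blast
  \<comment> \<open>A bound for \<open>F\<close> on the ball of radius \<open>R + 1\<close>, by
    comparison with \<open>F 0\<close>. The absolute value keeps \<open>M\<close> nonnegative when
    \<open>R + 1\<close> is negative.\<close>
  define M where "M = norm (F 0) + L * \<bar>R + 1\<bar>"
  have M: "0 \<le> M" using L by (simp add: M_def)
  have F_le: "norm (F x) \<le> M" if "norm x \<le> R + 1" for x
  proof -
    have "norm (F x) - norm (F 0) \<le> norm (F x - F 0)" by (rule norm_triangle_ineq2)
    also have "\<dots> \<le> L * norm (x - 0)" using that order_trans[OF norm_ge_zero that] by (intro L) simp_all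
    also have "\<dots> \<le> L * \<bar>R + 1\<bar>" using that L(1) by (intro mult_left_mono) auto
    finally show ?thesis by (simp add: M_def)
  qed
  \<comment> \<open>Chosen for two inequalities: \<open>M * \<tau>\<close> at most 1 keeps the
    iteration in the ball of radius \<open>R + 1\<close>, and \<open>L * \<tau>\<close> at most 1/2
    makes it a contraction.\<close>
  define \<tau> where "\<tau> = 1 / (M + 2 * L)"
  have \<tau>: "0 < \<tau>" "M * \<tau> \<le> 1" "L * \<tau> \<le> 1 / 2"
    using M L by (auto simp: \<tau>_def field_simps)
  \<comment> \<open>Clamping time to \<open>{0..\<tau>}\<close> extends every function involved to
    the whole line, so that the complete space can be taken inside the type of bounded continuous
    functions on the reals. On \<open>{0..\<tau>}\<close> itself nothing changes.\<close>
  define c where "c t = max 0 (min t \<tau>)" for t :: real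
  have c: "c t \<in> {0..\<tau>}" for t using \<tau> by (auto simp: c_def)
  have c_id: "c t = t" if "t \<in> {0..\<tau>}" for t using that by (auto simp: c_def)
  have cont_c: "continuous_on UNIV c" unfolding c_def by (intro continuous_intros)
  have int1: "(LINT r:{0<..t}|lborel. 1) \<le> \<tau>" "0 \<le> (LINT r:{0<..t}|lborel. 1 :: real)" if "t \<in> {0..\<tau>}" for t
    using that by (simp_all add: set_lebesgue_integral_def)
  have "\<exists>v. mild x \<tau> v" if x: "norm x \<le> R" for x
  proof -
    define \<phi> where "\<phi> v t = S (c t) x + conv (\<lambda>s. F (apply_bcontfun v s)) (c t)" for v t
    \<comment> \<open>The functions with values in the closed ball of radius \<open>R + 1\<close>, a
      closed subset of the bounded continuous functions.\<close>
    let ?X = "PiC UNIV (\<lambda>_ :: real. cball 0 (R + 1) :: 'a set)"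
    have X: "v \<in> ?X \<longleftrightarrow> (\<forall>t. norm (apply_bcontfun v t) \<le> R + 1)" for v
      by (auto simp: mem_PiC_iff)
    have cont_v: "continuous_on A (\<lambda>s. F (apply_bcontfun v s))" for A v
      by (rule continuous_on_F) simp
    have cont: "continuous_on UNIV (\<phi> v)" for v
    proof -
      have "continuous_on UNIV (\<lambda>t. S (c t) x)"
        by (rule continuous_on_compose2[OF continuous_S cont_c]) (use c in auto)
      moreover have "continuous_on UNIV (\<lambda>t. conv (\<lambda>s. F (apply_bcontfun v s)) (c t))"
        by (rule continuous_on_compose2[OF continuous_on_conv[of \<tau>, OF cont_v] cont_c]) (use c in auto)
      ultimately show ?thesis unfolding \<phi>_def[abs_def] by (rule continuous_on_add)
    qed
    have bound: "norm (\<phi> v t) \<le> R + 1" if "v \<in> ?X" for v t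
    proof -
      have "norm (conv (\<lambda>s. F (apply_bcontfun v s)) (c t)) \<le> M * (LINT r:{0<..c t}|lborel. 1)"
        using that by (intro norm_conv cont_v F_le) (simp add: X)
      also have "\<dots> \<le> M * \<tau>" using int1[OF c] M by (intro mult_left_mono)
      also have "\<dots> \<le> 1" by (rule \<tau>)
      finally have "norm (conv (\<lambda>s. F (apply_bcontfun v s)) (c t)) \<le> 1" .
      moreover have "norm (S (c t) x) \<le> R" using norm_S[of "c t" x] c[of t] x by auto
      ultimately show ?thesis unfolding \<phi>_def by (meson add_mono norm_triangle_le)
    qed
    define \<Phi> where "\<Phi> v = Bcontfun (\<phi> v)" for v
    have \<Phi>: "apply_bcontfun (\<Phi> v) = \<phi> v" if "v \<in> ?X" for v
      unfolding \<Phi>_def by (rule Bcontfun_inverse, rule bcontfun_normI[OF cont bound[OF that]])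
    have "\<exists>!v\<in>?X. \<Phi> v = v"
    proof (rule Banach_fix)
      show "complete ?X" by (simp add: complete_eq_closed closed_PiC)
      have "apply_bcontfun (const_bcontfun x) t = x" for t :: real by (simp)
      then have "const_bcontfun x \<in> ?X" using x by (simp add: X)
      then show "?X \<noteq> {}" by auto
      show "\<Phi> ` ?X \<subseteq> ?X" using bound \<Phi> by (auto simp: X)
      fix u v assume u: "u \<in> ?X" and v: "v \<in> ?X"
      show "dist (\<Phi> u) (\<Phi> v) \<le> 1 / 2 * dist u v"
      proof (rule dist_bound)
        fix t
        have "\<phi> u t - \<phi> v t = conv (\<lambda>s. F (apply_bcontfun u s) - F (apply_bcontfun v s)) (c t)"
          by (simp add: \<phi>_def conv_diff[symmetric] cont_v)
        also have "norm \<dots> \<le> (L * dist u v) * (LINT r:{0<..c t}|lborel. 1)"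
        proof (rule norm_conv)
          fix s
          have "norm (F (apply_bcontfun u s) - F (apply_bcontfun v s)) \<le> L * norm (apply_bcontfun u s - apply_bcontfun v s)"
            using u v by (intro L) (auto simp: X)
          also have "\<dots> \<le> L * dist u v"
            using dist_bounded[of u s v] L(1) by (intro mult_left_mono) (auto simp: dist_norm)
          finally show "norm (F (apply_bcontfun u s) - F (apply_bcontfun v s)) \<le> L * dist u v" .
        qed (auto intro: continuous_intros cont_v)
        also have "\<dots> \<le> (L * dist u v) * \<tau>" using int1[OF c] L by (intro mult_left_mono) auto
        also have "\<dots> \<le> 1 / 2 * dist u v" using mult_right_mono[OF \<tau>(3), of "dist u v"] by (simp add: mult_ac)
        finally show "dist (apply_bcontfun (\<Phi> u) t) (apply_bcontfun (\<Phi> v) t) \<le> 1 / 2 * dist u v"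
          using u v by (simp add: \<Phi> dist_norm)
      qed
    qed auto
    then obtain v where v: "v \<in> ?X" "\<Phi> v = v" by blast
    have "apply_bcontfun v t = \<phi> v t" for t using \<Phi>[OF v(1)] v(2) by simp
    then have "apply_bcontfun v t = S t x + conv (\<lambda>s. F (apply_bcontfun v s)) t" if "t \<in> {0..\<tau>}" for t
      unfolding \<phi>_def using c_id[OF that] by metis
    then have "mild x \<tau> (apply_bcontfun v)" by (simp add: mild_def)
    then show ?thesis by blast
  qed
  then show ?thesis using \<tau>(1) by blast
qed

definition lifespan :: "'a \<Rightarrow> ereal" where
  "lifespan x = Sup {ereal T | T. 0 < T \<and> (\<exists>v. mild x T v)}"

lemma lifespan_ge: "mild x T v \<Longrightarrow> 0 < T \<Longrightarrow> ereal T \<le> lifespan x"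
  unfolding lifespan_def by (rule Sup_upper) auto

lemma lifespan_pos: "0 < lifespan x"
proof -
  obtain \<tau> v where "0 < \<tau>" "mild x \<tau> v" using local_existence[of "norm x"] by blast
  then show ?thesis using lifespan_ge[of x \<tau> v] by (meson ereal_less(2) less_le_trans)
qed

text \<open>Solutions with different horizons agree where both are defined. Hence one may choose for
  every \<open>t\<close> a solution \<open>w t\<close> that lives beyond \<open>t\<close> and take
  the diagonal \<open>w t t\<close>: up to any horizon it coincides with one of the chosen
  solutions.\<close>

lemma maximal_solution:
  obtains v where "\<And>T. ereal T < lifespan x \<Longrightarrow> mild x T v"
proof -
  have ex: "\<exists>T v. t < T \<and> mild x T v" if "ereal t < lifespan x" for t
    using that unfolding lifespan_def less_Sup_iff by auto
  define T where "T t = (SOME T. t < T \<and> (\<exists>v. mild x T v))" for t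
  define w where "w t = (SOME v. mild x (T t) v)" for t
  have Tw: "t < T t" "mild x (T t) (w t)" if "ereal t < lifespan x" for t
  proof -
    have "t < T t \<and> (\<exists>v. mild x (T t) v)" unfolding T_def by (rule someI_ex) (use ex[OF that] in blast)
    then show "t < T t" "mild x (T t) (w t)" unfolding w_def by (blast, metis someI_ex)
  qed
  have "mild x T0 (\<lambda>t. w t t)" if T0: "ereal T0 < lifespan x" for T0
  proof (rule mild_cong[OF mild_mono[OF Tw(2)[OF T0]]])
    show "T0 \<le> T T0" using Tw(1)[OF T0] by simp
    fix t assume t: "0 \<le> t" "t \<le> T0"
    have t': "ereal t < lifespan x" using T0 t by (meson ereal_less_eq(3) le_less_trans)
    show "w T0 t = w t t"
      by (rule mild_unique[of x t]) (use t Tw[OF T0] Tw[OF t'] in \<open>auto intro: mild_mono\<close>)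
  qed
  then show thesis by (rule that)
qed

text \<open>If the norm were below \<open>R\<close> at some \<open>t\<close> closer to the end than
  the existence time for data of norm at most \<open>R\<close>, a restart at \<open>t\<close> would
  produce a solution beyond the lifespan. Every such \<open>t\<close> is excluded, which gives a
  limit and not merely an unbounded sequence.\<close>

lemma blow_up:
  assumes v: "\<And>T. ereal T < lifespan x \<Longrightarrow> mild x T v" and fin: "lifespan x < \<infinity>"
  shows "filterlim (\<lambda>t. norm (v t)) at_top (at_left (real_of_ereal (lifespan x)))"
proof -
  obtain T where T: "lifespan x = ereal T" "0 < T"
    using fin lifespan_pos[of x] by (cases "lifespan x") auto
  show ?thesis
    unfolding filterlim_at_top_gt[of _ _ 0]
  proof (intro allI impI)
    fix R :: real
    obtain \<tau> where \<tau>: "0 < \<tau>" "\<And>y. norm y \<le> R \<Longrightarrow> \<exists>w. mild y \<tau> w"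
      using local_existence[of R] by blast
    have "\<forall>\<^sub>F t in at_left T. max 0 (T - \<tau>) < t \<and> t < T"
      using eventually_at_left_real[of "max 0 (T - \<tau>)" T] T \<tau> by auto
    then show "\<forall>\<^sub>F t in at_left (real_of_ereal (lifespan x)). R \<le> norm (v t)"
      unfolding T real_of_ereal.simps
    proof eventually_elim
      fix t assume t: "max 0 (T - \<tau>) < t \<and> t < T"
      show "R \<le> norm (v t)"
      proof (rule ccontr)
        assume "\<not> ?thesis"
        then obtain w where "mild (v t) \<tau> w" using \<tau>(2)[of "v t"] by auto
        moreover have "mild x t v" using t by (intro v) (simp add: T)
        ultimately have "mild x (t + \<tau>) (\<lambda>s. if s \<le> t then v s else w (s - t))"
          using t \<tau> by (intro mild_append) auto
        from lifespan_ge[OF this] show False using t \<tau> T by auto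
      qed
    qed
  qed
qed

end

text \<open>\<open>K\<close> stands for the semigroup followed by an unbounded gain of regularity,
  \<open>E\<close> for the bounded inverse of that gain. The relation between \<open>E\<close>,
  \<open>K\<close> and \<open>S\<close> is all that is required; the unbounded operator itself does
  not occur.\<close>

locale smoothing = semilinear S F + K: operator_kernel K g
  for S :: "real \<Rightarrow> 'a :: {banach, second_countable_topology} \<Rightarrow> 'a" and F and K :: "real \<Rightarrow> 'a \<Rightarrow> 'a" and g +
  fixes E :: "'a \<Rightarrow> 'a"
  assumes bounded_linear_E: "bounded_linear E" and E_K: "0 < t \<Longrightarrow> E (K t x) = S t x"
begin

text \<open>Duhamel's formula with \<open>K\<close> in place of \<open>S\<close>: the candidate for
  a preimage of \<open>v\<close> under \<open>E\<close>, which for the heat equation is (1 +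
  L)^{1/2} v.\<close>

definition smoothed :: "'a \<Rightarrow> (real \<Rightarrow> 'a) \<Rightarrow> real \<Rightarrow> 'a" where
  "smoothed x v t = K t x + K.conv (\<lambda>s. F (v s)) t"

lemma E_smoothed:
  assumes v: "mild x T v" and t: "0 < t" "t \<le> T"
  shows "E (smoothed x v t) = v t"
proof -
  have "continuous_on {0..t} v" by (rule continuous_on_subset[OF mild_continuous[OF v]]) (use t in auto)
  then have "E (K.conv (\<lambda>s. F (v s)) t) = conv (\<lambda>s. F (v s)) t"
    unfolding conv_def by (intro K.conv_commute[OF _ bounded_linear_E] continuous_on_F) (simp_all add: E_K)
  then show ?thesis
    using mild_eq[OF v, of t] t by (simp add: smoothed_def linear_add[OF bounded_linear.linear[OF bounded_linear_E]] E_K)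
qed

lemma continuous_on_smoothed:
  assumes v: "mild x T v"
  shows "continuous_on {0<..T} (smoothed x v)"
  unfolding smoothed_def[abs_def]
proof (rule continuous_on_add)
  show "continuous_on {0<..T} (\<lambda>t. K t x)" by (rule continuous_on_subset[OF K.continuous_K]) auto
  show "continuous_on {0<..T} (K.conv (\<lambda>s. F (v s)))"
    by (rule continuous_on_subset[OF K.continuous_on_conv[OF continuous_on_F[OF mild_continuous[OF v]]]]) auto
qed

lemma norm_smoothed:
  assumes v: "mild x T v" and t: "0 < t" "t \<le> T" and M: "\<And>s. s \<in> {0..t} \<Longrightarrow> norm (F (v s)) \<le> M"
  shows "norm (smoothed x v t) \<le> g t * norm x + M * (LINT r:{0<..t}|lborel. g r)"
  unfolding smoothed_def
proof (rule norm_triangle_le, rule add_mono)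
  show "norm (K t x) \<le> g t * norm x" by (rule K.norm_K[OF t(1)])
  have "continuous_on {0..t} v" by (rule continuous_on_subset[OF mild_continuous[OF v]]) (use t in auto)
  then show "norm (K.conv (\<lambda>s. F (v s)) t) \<le> M * (LINT r:{0<..t}|lborel. g r)"
    by (intro K.norm_conv continuous_on_F M)
qed

end

section \<open>Left multiplication in the noncommutative torus\<close>

lemma in_ell2_square_bound:
  assumes "\<And>x. cmod (f x) \<le> C * cmod (ell2_nth a x)" "0 \<le> C"
  shows "in_ell2 f" "norm (Abs_ell2 f) \<le> C * norm a"
proof -
  have "(\<Sum>x\<in>F. (cmod (f x))\<^sup>2) \<le> (C * norm a)\<^sup>2" if "finite F" for F
  proof -
    have "(\<Sum>x\<in>F. (cmod (f x))\<^sup>2) \<le> (\<Sum>x\<in>F. C\<^sup>2 * (cmod (ell2_nth a x))\<^sup>2)"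
      by (rule sum_mono) (use power_mono[OF assms(1) norm_ge_zero, of _ 2] in \<open>simp add: power_mult_distrib\<close>)
    also have "\<dots> \<le> C\<^sup>2 * (norm a)\<^sup>2"
      unfolding sum_distrib_left[symmetric] by (intro mult_left_mono ell2_sum_le_norm that) simp
    finally show ?thesis by (simp add: power_mult_distrib)
  qed
  then show "in_ell2 f" "norm (Abs_ell2 f) \<le> C * norm a"
    using ell2_sum_le_normI[of f "C * norm a"] assms(2) by auto
qed

lemma bounded_linear_ell2_nth: "bounded_linear (\<lambda>a. ell2_nth a m)"
  by (rule bounded_linear_intro[where K = 1]) (auto simp: ell2_nth_le_norm scaleR_conv_of_real)

lemma complex_linear_op_sum:
  assumes "complex_linear_op A"
  shows "blinfun_apply A (\<Sum>m\<in>F. ell2_scaleC (c m) (f m)) = (\<Sum>m\<in>F. ell2_scaleC (c m) (blinfun_apply A (f m)))"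
  using assms by (simp add: blinfun.sum_right complex_linear_op_def)

text \<open>Finite complex combinations of basis vectors are dense and the operators are bounded.
  Complex linearity has to be assumed because the operator type provides real linearity
  only.\<close>

lemma complex_linear_op_eqI:
  fixes A B :: "'a ell2 \<Rightarrow>\<^sub>L 'a ell2"
  assumes A: "complex_linear_op A" and B: "complex_linear_op B"
    and eq: "\<And>m. blinfun_apply A (ell2_basis m) = blinfun_apply B (ell2_basis m)"
  shows "A = B"
proof (rule blinfun_eqI)
  fix a
  have "norm (blinfun_apply A a - blinfun_apply B a) \<le> 0 + e" if "e > 0" for e
  proof -
    \<comment> \<open>The summand 1 keeps the divisor positive, as \<open>A = B\<close> is the
      expected outcome.\<close>
    have pos: "0 < norm (A - B) + 1" by (rule add_nonneg_pos) auto
    then have "0 < e / (norm (A - B) + 1)" using that by simp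
    then obtain F where F: "dist (\<Sum>m\<in>F. ell2_scaleC (ell2_nth a m) (ell2_basis m)) a < e / (norm (A - B) + 1)"
      using ell2_finite_support_approx by blast
    let ?s = "\<Sum>m\<in>F. ell2_scaleC (ell2_nth a m) (ell2_basis m)"
    have "blinfun_apply A ?s = blinfun_apply B ?s"
      by (simp only: complex_linear_op_sum[OF A] complex_linear_op_sum[OF B] eq)
    then have "blinfun_apply A a - blinfun_apply B a = blinfun_apply (A - B) (a - ?s)"
      by (simp add: blinfun.diff_left blinfun.diff_right)
    also have "norm \<dots> \<le> norm (A - B) * norm (a - ?s)" by (rule norm_blinfun)
    also have "\<dots> \<le> (norm (A - B) + 1) * (e / (norm (A - B) + 1))"
      using F by (intro mult_mono) (auto simp: dist_norm norm_minus_commute)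
    also have "\<dots> = e" using pos by simp
    finally show ?thesis by simp
  qed
  then have "norm (blinfun_apply A a - blinfun_apply B a) \<le> 0" by (rule field_le_epsilon)
  then show "blinfun_apply A a = blinfun_apply B a" by simp
qed

text \<open>The double commutant mentions the adjoints of the generators only through a predicate;
  uniqueness identifies them with \<open>nct_U_adj\<close>.\<close>

lemma is_adjoint_unique:
  assumes "is_adjoint A B" "is_adjoint A C"
  shows "B = C"
proof (intro blinfun_eqI ell2_eqI)
  fix b m
  have "ell2_cinner (ell2_basis m) (blinfun_apply B b) = ell2_cinner (ell2_basis m) (blinfun_apply C b)"
    using assms unfolding is_adjoint_def by metis
  then show "ell2_nth (blinfun_apply B b) m = ell2_nth (blinfun_apply C b) m" by simp
qed

lemma norm_weighted_shift_apply:
  assumes "\<And>m. cmod (\<phi> m) = 1"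
  shows "norm (blinfun_apply (weighted_shift \<phi> d) a) = norm a"
proof -
  have "(norm (blinfun_apply (weighted_shift \<phi> d) a))\<^sup>2 = (norm a)\<^sup>2"
    unfolding ell2_norm_square[of "blinfun_apply _ _"] weighted_shift_nth[of \<phi>, OF assms]
    by (rule weighted_shift_in_ell2(2)[OF assms])
  then show ?thesis by simp
qed

text \<open>The bicharacter of the standard representation: \<open>U\<^sub>k e\<^sub>m\<close> is \<open>e\<^bsub>m + \<epsilon>\<^sub>k\<^esub>\<close> times the
  exponential of \<open>2 \<pi> i B(\<epsilon>\<^sub>k, m)\<close>. Putting the shift into the first argument of \<open>B\<close> gives the
  left regular representation, putting it into the second one the commuting right regular
  representation.\<close>

definition nct_form :: "('n :: {finite, linorder}) real_matrix \<Rightarrow> 'n int_lattice \<Rightarrow> 'n int_lattice \<Rightarrow> real" where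
  "nct_form \<theta> x y = (\<Sum>k\<in>UNIV. \<Sum>l\<in>{l. l < k}. \<theta> $ k $ l * of_int (x $ k) * of_int (y $ l))"

definition nct_left_shift :: "('n :: {finite, linorder}) real_matrix \<Rightarrow> 'n int_lattice \<Rightarrow> 'n nct_op" where
  "nct_left_shift \<theta> p = weighted_shift (\<lambda>m. cis (2 * pi * nct_form \<theta> p m)) p"

definition nct_right_shift :: "('n :: {finite, linorder}) real_matrix \<Rightarrow> 'n int_lattice \<Rightarrow> 'n nct_op" where
  "nct_right_shift \<theta> p = weighted_shift (\<lambda>m. cis (2 * pi * nct_form \<theta> m p)) p"

lemma nct_form_add_left: "nct_form \<theta> (x + y) z = nct_form \<theta> x z + nct_form \<theta> y z"
  by (simp add: nct_form_def algebra_simps sum.distrib)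

lemma nct_form_add_right: "nct_form \<theta> x (y + z) = nct_form \<theta> x y + nct_form \<theta> x z"
  by (simp add: nct_form_def algebra_simps sum.distrib)

lemma nct_form_zero [simp]: "nct_form \<theta> 0 x = 0" "nct_form \<theta> x 0 = 0" "nct_form 0 x y = 0"
  by (simp_all add: nct_form_def)

lemma nct_form_axis: "nct_form \<theta> (axis k 1) m = (\<Sum>l\<in>{l. l < k}. \<theta> $ k $ l * of_int (m $ l))"
proof -
  have "nct_form \<theta> (axis k 1) m
      = (\<Sum>j\<in>UNIV. if j = k then \<Sum>l\<in>{l. l < k}. \<theta> $ k $ l * of_int (m $ l) else 0)"
    unfolding nct_form_def by (rule sum.cong) (auto simp: axis_def)
  then show ?thesis by simp
qed

lemma nct_left_shift_nth:
  "ell2_nth (blinfun_apply (nct_left_shift \<theta> p) a) m = cis (2 * pi * nct_form \<theta> p (m - p)) * ell2_nth a (m - p)"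
  unfolding nct_left_shift_def by (rule weighted_shift_nth) simp

lemma nct_right_shift_nth:
  "ell2_nth (blinfun_apply (nct_right_shift \<theta> p) a) m = cis (2 * pi * nct_form \<theta> (m - p) p) * ell2_nth a (m - p)"
  unfolding nct_right_shift_def by (rule weighted_shift_nth) simp

lemma nct_U_left_shift: "nct_U \<theta> k = nct_left_shift \<theta> (axis k 1)"
  unfolding nct_U_def nct_left_shift_def nct_form_axis nct_phase_def[abs_def] ..

lemma complex_linear_right_shift: "complex_linear_op (nct_right_shift \<theta> p)"
  unfolding nct_right_shift_def by (rule complex_linear_weighted_shift) simp

lemma norm_left_shift: "norm (blinfun_apply (nct_left_shift \<theta> p) a) = norm a"
  unfolding nct_left_shift_def by (rule norm_weighted_shift_apply) simp

lemma nct_right_shift_vacuum: "blinfun_apply (nct_right_shift \<theta> p) (ell2_basis 0) = ell2_basis p"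
  unfolding nct_right_shift_def by (subst weighted_shift_basis) simp_all

text \<open>With B the bicharacter, both compositions send e_q to e_{q + p + r} with the phase B(p,
  q) + B(q, r) + B(p, r), by bilinearity.\<close>

lemma left_right_shift_commute:
  "nct_right_shift \<theta> r o\<^sub>L nct_left_shift \<theta> p = nct_left_shift \<theta> p o\<^sub>L nct_right_shift \<theta> r"
proof (intro blinfun_eqI ell2_eqI)
  fix a :: "'a nct_L2" and m :: "'a int_lattice"
  define q where "q = m - p - r"
  have q: "m - r = q + p" "m - p = q + r" "q + p - p = q" "q + r - r = q" by (simp_all add: q_def)
  show "ell2_nth (blinfun_apply (nct_right_shift \<theta> r o\<^sub>L nct_left_shift \<theta> p) a) m
      = ell2_nth (blinfun_apply (nct_left_shift \<theta> p o\<^sub>L nct_right_shift \<theta> r) a) m"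
    by (simp only: blinfun_apply_blinfun_compose nct_left_shift_nth nct_right_shift_nth q nct_form_add_left
        nct_form_add_right mult.assoc[symmetric] cis_mult distrib_left)
      (simp add: add_ac)
qed

text \<open>The left shifts form a projective representation of the lattice with cocycle B. Up to
  phases they are therefore products of the generators and their inverses.\<close>

lemma left_shift_add:
  "blinfun_apply (nct_left_shift \<theta> p) (blinfun_apply (nct_left_shift \<theta> q) a)
    = ell2_scaleC (cis (2 * pi * nct_form \<theta> p q)) (blinfun_apply (nct_left_shift \<theta> (p + q)) a)"
proof (rule ell2_eqI)
  fix m
  define r where "r = m - p - q"
  have r: "m - p = r + q" "m - (p + q) = r" "r + q - q = r" by (simp_all add: r_def)
  show "ell2_nth (blinfun_apply (nct_left_shift \<theta> p) (blinfun_apply (nct_left_shift \<theta> q) a)) m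
      = ell2_nth (ell2_scaleC (cis (2 * pi * nct_form \<theta> p q)) (blinfun_apply (nct_left_shift \<theta> (p + q)) a)) m"
    by (simp only: nct_left_shift_nth ell2_nth_scaleC r nct_form_add_left nct_form_add_right
        mult.assoc[symmetric] cis_mult distrib_left)
      (simp add: add_ac)
qed

lemma ell2_scaleC_scaleC [simp]: "ell2_scaleC c (ell2_scaleC d a) = ell2_scaleC (c * d) a"
  by (rule ell2_eqI) simp

lemma left_shift_add':
  "blinfun_apply (nct_left_shift \<theta> (p + q)) a
    = ell2_scaleC (cis (- (2 * pi * nct_form \<theta> p q)))
        (blinfun_apply (nct_left_shift \<theta> p) (blinfun_apply (nct_left_shift \<theta> q) a))"
  by (simp add: left_shift_add cis_mult)

lemma left_shift_zero [simp]: "nct_left_shift \<theta> 0 = id_blinfun"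
  by (intro blinfun_eqI ell2_eqI) (simp add: nct_left_shift_nth)

text \<open>Commuting with the generators is the commutation of left and right shifts; commuting
  with their adjoints follows because these are inverses.\<close>

lemma right_shift_in_commutant:
  "nct_right_shift \<theta> r \<in> commutant (range (nct_U \<theta>) \<union> {B. \<exists>A\<in>range (nct_U \<theta>). is_adjoint A B})"
proof -
  let ?V = "nct_right_shift \<theta> r"
  have U: "?V o\<^sub>L nct_U \<theta> j = nct_U \<theta> j o\<^sub>L ?V" for j
    by (simp add: nct_U_left_shift left_right_shift_commute)
  have "?V o\<^sub>L nct_U_adj \<theta> j = nct_U_adj \<theta> j o\<^sub>L ?V" for j
  proof (rule blinfun_eqI)
    fix a
    have V: "blinfun_apply ?V (blinfun_apply (nct_U \<theta> j) x) = blinfun_apply (nct_U \<theta> j) (blinfun_apply ?V x)" for x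
      using arg_cong[OF U[of j], of "\<lambda>A. blinfun_apply A x"] by simp
    have inv: "blinfun_apply (nct_U \<theta> j) (blinfun_apply (nct_U_adj \<theta> j) x) = x"
      "blinfun_apply (nct_U_adj \<theta> j) (blinfun_apply (nct_U \<theta> j) x) = x" for x
      using arg_cong[OF nct_U_unitary(1)[of \<theta> j], of "\<lambda>A. blinfun_apply A x"]
        arg_cong[OF nct_U_unitary(2)[of \<theta> j], of "\<lambda>A. blinfun_apply A x"] by simp_all
    show "blinfun_apply (?V o\<^sub>L nct_U_adj \<theta> j) a = blinfun_apply (nct_U_adj \<theta> j o\<^sub>L ?V) a"
      using inv(2)[of "blinfun_apply ?V (blinfun_apply (nct_U_adj \<theta> j) a)"] by (simp add: inv flip: V)
  qed
  then show ?thesis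
    using U complex_linear_right_shift is_adjoint_unique[OF _ nct_U_adj]
    by (fastforce simp: commutant_def)
qed

text \<open>The unit vectors generate the lattice as a group. The three cases correspond to the
  generators, the projective law and inversion of left shifts.\<close>

lemma lattice_induct [case_names axis add minus]:
  fixes p :: "('n :: finite) int_lattice"
  assumes ax: "\<And>j. P (axis j 1)" and add: "\<And>p q. P p \<Longrightarrow> P q \<Longrightarrow> P (p + q)" and minus: "\<And>p. P p \<Longrightarrow> P (- p)"
  shows "P p"
proof -
  have zero: "P 0" using add[OF ax[of undefined] minus[OF ax[of undefined]]] by simp
  have nat: "P (axis j (int i))" for i j
  proof (induction i)
    case (Suc i)
    have "axis j (int (Suc i)) = axis j (int i) + axis j 1" by (simp add: vec_eq_iff axis_def)
    then show ?case using add[OF Suc ax] by metis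
  qed (use zero in \<open>simp add: axis_def zero_vec_def cong: if_cong\<close>)
  have int: "P (axis j z)" for j z
  proof (cases z rule: int_cases2)
    case (nonpos i)
    have "axis j z = - axis j (int i)" by (simp add: vec_eq_iff axis_def nonpos)
    then show ?thesis using minus[OF nat] by metis
  qed (simp add: nat)
  have "P (\<Sum>j\<in>A. axis j (p $ j))" for A
    by (induction A rule: infinite_finite_induct) (auto intro: zero add int)
  moreover have "(\<Sum>j\<in>UNIV. axis j (p $ j)) = p" by (simp add: vec_eq_iff axis_def sum_component)
  ultimately show ?thesis by metis
qed

lemma commutant_left_shift:
  assumes "T \<in> commutant (range (nct_U \<theta>) \<union> S)"
  shows "blinfun_apply T (blinfun_apply (nct_left_shift \<theta> p) a) = blinfun_apply (nct_left_shift \<theta> p) (blinfun_apply T a)"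
proof (induction p arbitrary: a rule: lattice_induct)
  case (axis j)
  have "T o\<^sub>L nct_U \<theta> j = nct_U \<theta> j o\<^sub>L T" using assms by (simp add: commutant_def)
  then have "blinfun_apply (T o\<^sub>L nct_U \<theta> j) a = blinfun_apply (nct_U \<theta> j o\<^sub>L T) a" by simp
  then show ?case by (simp add: nct_U_left_shift)
next
  case (add p q)
  have lin: "blinfun_apply T (ell2_scaleC c a) = ell2_scaleC c (blinfun_apply T a)" for c a
    using assms by (simp add: commutant_def complex_linear_op_def)
  show ?case by (simp add: left_shift_add' lin add)
next
  case (minus p)
  let ?W = "nct_left_shift \<theta>"
  have lin: "blinfun_apply T (ell2_scaleC c a) = ell2_scaleC c (blinfun_apply T a)" for c a
    using assms by (simp add: commutant_def complex_linear_op_def)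
  \<comment> \<open>The shift by \<open>p\<close> is isometric and can be cancelled; applying it to
    both sides reduces the claim for \<open>- p\<close> to the one for \<open>p\<close>.\<close>
  have inj: "x = y" if "blinfun_apply (?W p) x = blinfun_apply (?W p) y" for x y
    using norm_left_shift[of \<theta> p "x - y"] that by (simp add: blinfun.diff_right)
  show ?case
  proof (rule inj)
    have "blinfun_apply (?W p) (blinfun_apply T (blinfun_apply (?W (- p)) a))
        = blinfun_apply T (blinfun_apply (?W p) (blinfun_apply (?W (- p)) a))" by (simp add: minus)
    then show "blinfun_apply (?W p) (blinfun_apply T (blinfun_apply (?W (- p)) a))
        = blinfun_apply (?W p) (blinfun_apply (?W (- p)) (blinfun_apply T a))"
      by (simp add: left_shift_add lin)
  qed
qed

text \<open>An element C of the double commutant commutes with the right shifts R_m, and R_m e_0 =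
  e_m. Thus C e_m = R_m C e_0, so C is determined by its value at e_0.\<close>

lemma nct_Linf_separating:
  assumes "A \<in> nct_Linf \<theta>" "B \<in> nct_Linf \<theta>"
    and eq: "blinfun_apply A (ell2_basis 0) = blinfun_apply B (ell2_basis 0)"
  shows "A = B"
proof (rule complex_linear_op_eqI)
  show "complex_linear_op A" "complex_linear_op B"
    using assms by (simp_all add: nct_Linf_def von_neumann_algebra_def commutant_def)
  fix m
  have "blinfun_apply C (ell2_basis m) = blinfun_apply (nct_right_shift \<theta> m) (blinfun_apply C (ell2_basis 0))"
    if "C \<in> nct_Linf \<theta>" for C
  proof -
    have "C o\<^sub>L nct_right_shift \<theta> m = nct_right_shift \<theta> m o\<^sub>L C"
      using that right_shift_in_commutant[of \<theta> m]
      unfolding nct_Linf_def von_neumann_algebra_def commutant_def[of "commutant _"] by blast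
    then have "blinfun_apply (C o\<^sub>L nct_right_shift \<theta> m) (ell2_basis 0)
      = blinfun_apply (nct_right_shift \<theta> m o\<^sub>L C) (ell2_basis 0)" by simp
    then show ?thesis by (simp add: nct_right_shift_vacuum)
  qed
  from this[OF assms(1)] this[OF assms(2)]
  show "blinfun_apply A (ell2_basis m) = blinfun_apply B (ell2_basis m)" by (simp add: eq)
qed

definition nct_left_term :: "('n :: {finite, linorder}) real_matrix \<Rightarrow> 'n nct_L2 \<Rightarrow> 'n int_lattice \<Rightarrow> 'n nct_op" where
  "nct_left_term \<theta> a p = cmod (ell2_nth a p) *\<^sub>R
    weighted_shift (\<lambda>m. cis (Arg (ell2_nth a p)) * cis (2 * pi * nct_form \<theta> p m)) p"

text \<open>Left multiplication by \<open>a\<close>, which is the norm convergent series of the \<open>a\<^sub>p U\<^sup>p\<close>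
  if the Fourier coefficients of \<open>a\<close> are absolutely summable. Scalar multiplication of
  operators being real, the phase of \<open>a\<^sub>p\<close> is put into the weighted shift.\<close>

definition nct_left :: "('n :: {finite, linorder}) real_matrix \<Rightarrow> 'n nct_L2 \<Rightarrow> 'n nct_op" where
  "nct_left \<theta> a = (\<Sum>\<^sub>\<infinity>p. nct_left_term \<theta> a p)"

definition ell1 :: "'a ell2 \<Rightarrow> bool" where
  "ell1 a \<longleftrightarrow> (\<lambda>p. cmod (ell2_nth a p)) summable_on UNIV"

definition ell1_norm :: "'a ell2 \<Rightarrow> real" where
  "ell1_norm a = (\<Sum>\<^sub>\<infinity>p. cmod (ell2_nth a p))"

lemma nct_left_term_apply:
  "blinfun_apply (nct_left_term \<theta> a p) x = ell2_scaleC (ell2_nth a p) (blinfun_apply (nct_left_shift \<theta> p) x)"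
proof (rule ell2_eqI)
  fix m
  have "complex_of_real (cmod z) * cis (Arg z) = z" for z by (metis rcis_cmod_Arg rcis_def)
  then show "ell2_nth (blinfun_apply (nct_left_term \<theta> a p) x) m
      = ell2_nth (ell2_scaleC (ell2_nth a p) (blinfun_apply (nct_left_shift \<theta> p) x)) m"
    by (simp add: nct_left_term_def scaleR_blinfun.rep_eq weighted_shift_nth norm_mult nct_left_shift_nth
        flip: mult.assoc)
qed

lemma norm_nct_left_term: "norm (nct_left_term \<theta> a p) \<le> cmod (ell2_nth a p)"
  by (rule norm_blinfun_bound) (simp_all add: nct_left_term_apply norm_ell2_scaleC norm_left_shift)

context
  fixes \<theta> :: "('n :: {finite, linorder}) real_matrix" and a :: "'n nct_L2"
  assumes a: "ell1 a"
begin

lemma abs_summable_left_term: "nct_left_term \<theta> a abs_summable_on UNIV"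
  by (rule summable_on_comparison_test[OF a[unfolded ell1_def]]) (simp_all add: norm_nct_left_term)

lemma has_sum_nct_left: "(nct_left_term \<theta> a has_sum nct_left \<theta> a) UNIV"
  unfolding nct_left_def by (rule has_sum_infsum[OF abs_summable_summable[OF abs_summable_left_term]])

lemma has_sum_nct_left_apply:
  "((\<lambda>p. ell2_scaleC (ell2_nth a p) (blinfun_apply (nct_left_shift \<theta> p) x)) has_sum blinfun_apply (nct_left \<theta> a) x) UNIV"
  using has_sum_bounded_linear[OF blinfun.bounded_linear_left[of x] has_sum_nct_left]
  by (simp add: nct_left_term_apply o_def)

text \<open>The coefficients form a twisted convolution: the phases are unimodular, and for the zero
  matrix in place of \<open>\<theta>\<close> they disappear. The comparison of the two cases carries
  the product estimate.\<close>

lemma has_sum_nct_left_nth: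
  "((\<lambda>p. ell2_nth a p * (cis (2 * pi * nct_form \<theta> p (m - p)) * ell2_nth x (m - p)))
    has_sum ell2_nth (blinfun_apply (nct_left \<theta> a) x) m) UNIV"
  using has_sum_bounded_linear[OF bounded_linear_ell2_nth[of m] has_sum_nct_left_apply[of x]]
  by (simp add: nct_left_shift_nth o_def)

lemma norm_nct_left: "norm (nct_left \<theta> a) \<le> ell1_norm a"
proof -
  have "norm (nct_left \<theta> a) \<le> (\<Sum>\<^sub>\<infinity>p. norm (nct_left_term \<theta> a p))"
    unfolding nct_left_def by (rule norm_infsum_bound[OF abs_summable_left_term])
  also have "\<dots> \<le> ell1_norm a"
    unfolding ell1_norm_def
    by (rule infsum_mono) (use abs_summable_left_term a norm_nct_left_term in \<open>auto simp: ell1_def\<close>)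
  finally show ?thesis .
qed

lemma nct_left_vacuum: "blinfun_apply (nct_left \<theta> a) (ell2_basis 0) = a"
proof (rule ell2_eqI)
  fix m
  have "((\<lambda>p. ell2_nth a p * (cis (2 * pi * nct_form \<theta> p (m - p)) * ell2_nth (ell2_basis 0) (m - p)))
    has_sum ell2_nth a m) {m}"
    using has_sum_finite[of "{m}" "\<lambda>p. ell2_nth a p * (cis (2 * pi * nct_form \<theta> p (m - p)) * ell2_nth (ell2_basis 0) (m - p))"]
    by (simp add: ell2_nth_basis)
  then have "((\<lambda>p. ell2_nth a p * (cis (2 * pi * nct_form \<theta> p (m - p)) * ell2_nth (ell2_basis 0) (m - p)))
    has_sum ell2_nth a m) UNIV"
    by (rule has_sum_cong_neutral[THEN iffD1, rotated 3]) (auto simp: ell2_nth_basis)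
  then show "ell2_nth (blinfun_apply (nct_left \<theta> a) (ell2_basis 0)) m = ell2_nth a m"
    using has_sum_nct_left_nth has_sum_unique by blast
qed

lemma complex_linear_nct_left: "complex_linear_op (nct_left \<theta> a)"
  unfolding complex_linear_op_def
proof (intro allI ell2_eqI)
  fix c x m
  have "((\<lambda>p. c * (ell2_nth a p * (cis (2 * pi * nct_form \<theta> p (m - p)) * ell2_nth x (m - p))))
    has_sum (c * ell2_nth (blinfun_apply (nct_left \<theta> a) x) m)) UNIV"
    by (rule has_sum_cmult_right[OF has_sum_nct_left_nth])
  then show "ell2_nth (blinfun_apply (nct_left \<theta> a) (ell2_scaleC c x)) m
      = ell2_nth (ell2_scaleC c (blinfun_apply (nct_left \<theta> a) x)) m"
    using has_sum_nct_left_nth[of m "ell2_scaleC c x"] has_sum_unique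
    by (fastforce simp: mult_ac)
qed

text \<open>An operator that commutes with the generators commutes with all left shifts, and
  boundedness carries this through the convergent series. This is the existence half of the
  description in \<open>nct_elem\<close>.\<close>

lemma nct_left_in_Linf: "nct_left \<theta> a \<in> nct_Linf \<theta>"
proof -
  have "nct_left \<theta> a o\<^sub>L T = T o\<^sub>L nct_left \<theta> a"
    if T: "T \<in> commutant (range (nct_U \<theta>) \<union> {B. \<exists>A\<in>range (nct_U \<theta>). is_adjoint A B})" for T
  proof (rule blinfun_eqI)
    fix x
    have lin: "blinfun_apply T (ell2_scaleC c x) = ell2_scaleC c (blinfun_apply T x)" for c x
      using T by (simp add: commutant_def complex_linear_op_def)
    have "((\<lambda>p. ell2_scaleC (ell2_nth a p) (blinfun_apply (nct_left_shift \<theta> p) (blinfun_apply T x)))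
        has_sum blinfun_apply T (blinfun_apply (nct_left \<theta> a) x)) UNIV"
      using has_sum_bounded_linear[OF blinfun.bounded_linear_right[of T] has_sum_nct_left_apply[of x]]
      by (simp add: lin commutant_left_shift[OF T] o_def)
    then show "blinfun_apply (nct_left \<theta> a o\<^sub>L T) x = blinfun_apply (T o\<^sub>L nct_left \<theta> a) x"
      using has_sum_nct_left_apply[of "blinfun_apply T x"] has_sum_unique by fastforce
  qed
  then show ?thesis
    using complex_linear_nct_left
    by (simp add: nct_Linf_def von_neumann_algebra_def commutant_def[of "commutant _"])
qed

lemma nct_elem_eq: "nct_elem \<theta> a = nct_left \<theta> a"
  unfolding nct_elem_def
proof (rule the_equality)
  fix A assume "A \<in> nct_Linf \<theta> \<and> blinfun_apply A (ell2_basis 0) = a"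
  then show "A = nct_left \<theta> a"
    using nct_Linf_separating[OF _ nct_left_in_Linf] nct_left_vacuum by auto
qed (simp add: nct_left_in_Linf nct_left_vacuum)

end

lemma nct_mult_eq: "ell1 a \<Longrightarrow> ell1 b \<Longrightarrow> nct_mult \<theta> a b = blinfun_apply (nct_left \<theta> a) b"
  by (simp add: nct_mult_def nct_elem_eq nct_left_vacuum)

lemma nct_left_diff:
  assumes "ell1 a" "ell1 b" "ell1 (a - b)"
  shows "blinfun_apply (nct_left \<theta> (a - b)) x = blinfun_apply (nct_left \<theta> a) x - blinfun_apply (nct_left \<theta> b) x"
proof (rule ell2_eqI)
  fix m
  show "ell2_nth (blinfun_apply (nct_left \<theta> (a - b)) x) m
      = ell2_nth (blinfun_apply (nct_left \<theta> a) x - blinfun_apply (nct_left \<theta> b) x) m"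
    using has_sum_unique[OF has_sum_nct_left_nth[OF assms(3), of \<theta> m x]]
      has_sum_add[OF has_sum_nct_left_nth[OF assms(1), of \<theta> m x]
        has_sum_cmult_right[OF has_sum_nct_left_nth[OF assms(2), of \<theta> m x], of "- 1"]]
    by (simp add: left_diff_distrib)
qed

section \<open>Sobolev spaces as Banach algebras\<close>

definition sobolev_weight :: "real \<Rightarrow> ('n :: finite) int_lattice \<Rightarrow> real" where
  "sobolev_weight s m = (1 + laplace_symbol m) powr (s / 2)"

lemma sobolev_weight_pos [simp]: "0 < sobolev_weight s m"
  using add_pos_nonneg[OF zero_less_one laplace_symbol_nonneg[of m]] by (simp add: sobolev_weight_def)

lemma sobolev_weight_nonneg [simp]: "0 \<le> sobolev_weight s m"
  by (rule less_imp_le) simp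

text \<open>From (x + y)^2 at most 2 x^2 + 2 y^2 in each coordinate. The factor 4 becomes 4^{s/2} =
  2^s in the weight of order \<open>s\<close>.\<close>

lemma laplace_symbol_add: "1 + laplace_symbol (p + q) \<le> 4 * max (1 + laplace_symbol p) (1 + laplace_symbol q)"
proof -
  have "(real_of_int (p $ i + q $ i))\<^sup>2 \<le> 2 * (real_of_int (p $ i))\<^sup>2 + 2 * (real_of_int (q $ i))\<^sup>2" for i
    using zero_le_power2[of "real_of_int (p $ i) - real_of_int (q $ i)"]
    by (simp add: power2_eq_square algebra_simps)
  then have "(\<Sum>i\<in>UNIV. (real_of_int ((p + q) $ i))\<^sup>2)
      \<le> (\<Sum>i\<in>UNIV. 2 * (real_of_int (p $ i))\<^sup>2 + 2 * (real_of_int (q $ i))\<^sup>2)"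
    by (intro sum_mono) (simp only: vector_add_component)
  also have "\<dots> = 2 * (\<Sum>i\<in>UNIV. (real_of_int (p $ i))\<^sup>2) + 2 * (\<Sum>i\<in>UNIV. (real_of_int (q $ i))\<^sup>2)"
    by (simp add: sum.distrib sum_distrib_left)
  finally have "laplace_symbol (p + q) \<le> 4 * pi\<^sup>2 * (2 * (\<Sum>i\<in>UNIV. (real_of_int (p $ i))\<^sup>2) + 2 * (\<Sum>i\<in>UNIV. (real_of_int (q $ i))\<^sup>2))"
    unfolding laplace_symbol_def by (intro mult_left_mono) auto
  also have "\<dots> = 2 * laplace_symbol p + 2 * laplace_symbol q"
    by (simp add: laplace_symbol_def algebra_simps)
  finally have "laplace_symbol (p + q) \<le> 2 * laplace_symbol p + 2 * laplace_symbol q" .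
  then show ?thesis by (simp add: max_def)
qed

lemma sobolev_weight_add:
  assumes "0 \<le> s"
  shows "sobolev_weight s (p + q) \<le> 2 powr s * (sobolev_weight s p + sobolev_weight s q)"
proof -
  have "sobolev_weight s (p + q) \<le> (4 * max (1 + laplace_symbol p) (1 + laplace_symbol q)) powr (s / 2)"
    unfolding sobolev_weight_def using assms by (intro powr_mono2 laplace_symbol_add) auto
  also have "\<dots> = 4 powr (s / 2) * max (1 + laplace_symbol p) (1 + laplace_symbol q) powr (s / 2)"
    by (intro powr_mult)
  also have "4 powr (s / 2) = (2 powr 2) powr (s / 2)" by simp
  also have "\<dots> = 2 powr s" by (subst powr_powr) simp
  also have "max (1 + laplace_symbol p) (1 + laplace_symbol q) powr (s / 2) \<le> sobolev_weight s p + sobolev_weight s q"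
    by (simp add: max_def sobolev_weight_def)
  finally show ?thesis by simp
qed

lemma summable_on_int_powr:
  assumes "1 / 2 < \<sigma>"
  shows "(\<lambda>z :: int. (1 + (real_of_int z)\<^sup>2) powr (- \<sigma>)) summable_on UNIV"
proof -
  let ?f = "\<lambda>z :: int. (1 + (real_of_int z)\<^sup>2) powr (- \<sigma>)"
  have "summable (\<lambda>n :: nat. (1 + (real n)\<^sup>2) powr (- \<sigma>))"
  proof (rule summable_comparison_test)
    show "\<exists>N. \<forall>n\<ge>N. norm ((1 + (real n)\<^sup>2) powr (- \<sigma>)) \<le> real n powr (- (2 * \<sigma>))"
    proof (intro exI[of _ 1] allI impI)
      fix n :: nat assume n: "1 \<le> n"
      have "(1 + (real n)\<^sup>2) powr (- \<sigma>) \<le> ((real n)\<^sup>2) powr (- \<sigma>)"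
        using n assms by (intro powr_mono2') auto
      also have "\<dots> = (real n powr 2) powr (- \<sigma>)" using n by simp
      also have "\<dots> = real n powr (- (2 * \<sigma>))" unfolding powr_powr by simp
      finally show "norm ((1 + (real n)\<^sup>2) powr (- \<sigma>)) \<le> real n powr (- (2 * \<sigma>))" by simp
    qed
    show "summable (\<lambda>n. real n powr (- (2 * \<sigma>)))" using assms by (simp add: summable_real_powr_iff)
  qed
  then have nat: "(\<lambda>n :: nat. (1 + (real n)\<^sup>2) powr (- \<sigma>)) summable_on UNIV"
    by (simp add: summable_on_UNIV_nonneg_real_iff)
  have "?f summable_on (range int)"
    using nat by (subst summable_on_reindex) (auto simp: o_def inj_on_def)
  moreover have "?f summable_on (range (\<lambda>n. - int n))"
    using nat by (subst summable_on_reindex) (auto simp: o_def inj_on_def)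
  ultimately have "?f summable_on (range int \<union> (range (\<lambda>n. - int n) - range int))"
    by (intro summable_on_Un_disjoint) (auto intro: summable_on_subset_banach)
  moreover have "range int \<union> (range (\<lambda>n. - int n) - range int) = UNIV"
    by (auto simp: image_iff) (metis int_cases2)
  ultimately show ?thesis by simp
qed

text \<open>With n the number of coordinates and \<open>\<sigma>\<close> = s / n, the summand is a
  product of n equal factors, and in the i-th one 1 + 4 pi^2 |m|^2 may be replaced by the smaller 1
  + m_i^2. The sum is then dominated by the n-th power of a sum over the integers, which converges
  because s > n / 2 means 2 \<open>\<sigma>\<close> > 1.\<close>

lemma summable_on_sobolev_weight:
  assumes "real CARD('n :: finite) / 2 < s"
  shows "(\<lambda>m :: 'n int_lattice. (1 + laplace_symbol m) powr (- s)) summable_on UNIV"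
proof (rule nonneg_bdd_above_summable_on)
  define \<sigma> where "\<sigma> = s / real CARD('n)"
  have \<sigma>: "1 / 2 < \<sigma>" "0 < \<sigma>" using assms by (auto simp: \<sigma>_def field_simps)
  define f where "f z = (1 + (real_of_int z)\<^sup>2) powr (- \<sigma>)" for z
  have f: "f summable_on UNIV" "0 \<le> f z" for z unfolding f_def using summable_on_int_powr[OF \<sigma>(1)] by auto
  have le: "(1 + laplace_symbol m) powr (- s) \<le> (\<Prod>i\<in>UNIV. f (m $ i))" for m :: "'n int_lattice"
  proof -
    have "(1 + laplace_symbol m) powr (- \<sigma>) \<le> f (m $ i)" for i
    proof -
      have "1 * (real_of_int (m $ i))\<^sup>2 \<le> (4 * pi\<^sup>2) * (\<Sum>i\<in>UNIV. (real_of_int (m $ i))\<^sup>2)"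
      proof (rule mult_mono)
        have "1 \<le> pi\<^sup>2" using pi_ge_two by (intro one_le_power) linarith
        then show "1 \<le> 4 * pi\<^sup>2" by linarith
      qed (auto intro!: sum_nonneg member_le_sum)
      then have "(1 + (real_of_int (m $ i))\<^sup>2) \<le> 1 + laplace_symbol m" by (simp add: laplace_symbol_def)
      moreover have "0 < 1 + (real_of_int (m $ i))\<^sup>2" by (rule add_pos_nonneg) auto
      ultimately show ?thesis unfolding f_def using \<sigma> by (intro powr_mono2') auto
    qed
    then have "(\<Prod>i\<in>(UNIV :: 'n set). (1 + laplace_symbol m) powr (- \<sigma>)) \<le> (\<Prod>i\<in>UNIV. f (m $ i))"
      by (intro prod_mono) auto
    moreover have "(\<Prod>i\<in>(UNIV :: 'n set). (1 + laplace_symbol m) powr (- \<sigma>)) = (1 + laplace_symbol m) powr (- s)"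
      using add_pos_nonneg[OF zero_less_one laplace_symbol_nonneg[of m]] by (simp add: \<sigma>_def powr_power)
    ultimately show ?thesis by simp
  qed
  show "bdd_above (sum (\<lambda>m :: 'n int_lattice. (1 + laplace_symbol m) powr (- s)) ` {F. F \<subseteq> UNIV \<and> finite F})"
  proof (rule bdd_aboveI2)
    fix F :: "'n int_lattice set" assume F: "F \<in> {F. F \<subseteq> UNIV \<and> finite F}"
    \<comment> \<open>All coordinates occurring in \<open>F\<close>: the finite set lies in a cube
      over \<open>Z\<close>, and the sum over a cube factorizes.\<close>
    define Z where "Z = (\<Union>i. (\<lambda>m. m $ i) ` F)"
    have Z: "finite Z" using F by (simp add: Z_def)
    have "(\<Sum>m\<in>F. (1 + laplace_symbol m) powr (- s)) \<le> (\<Sum>m\<in>F. \<Prod>i\<in>UNIV. f (m $ i))"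
      by (rule sum_mono) (rule le)
    also have "\<dots> = (\<Sum>h\<in>($) ` F. \<Prod>i\<in>UNIV. f (h i))"
      by (subst sum.reindex) (auto simp: inj_on_def vec_eq_iff)
    also have "\<dots> \<le> (\<Sum>h\<in>PiE (UNIV :: 'n set) (\<lambda>_. Z). \<Prod>i\<in>UNIV. f (h i))"
      by (rule sum_mono2) (use Z f(2) in \<open>auto simp: Z_def intro!: finite_PiE prod_nonneg\<close>)
    also have "\<dots> = (\<Prod>i\<in>(UNIV :: 'n set). \<Sum>z\<in>Z. f z)"
      by (rule prod_sum_PiE[symmetric]) (use Z in auto)
    also have "\<dots> \<le> (\<Prod>i\<in>(UNIV :: 'n set). \<Sum>\<^sub>\<infinity>z. f z)"
      by (intro prod_mono) (use Z f in \<open>auto intro!: finite_sum_le_infsum sum_nonneg\<close>)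
    finally show "(\<Sum>m\<in>F. (1 + laplace_symbol m) powr (- s)) \<le> (\<Prod>i\<in>(UNIV :: 'n set). \<Sum>\<^sub>\<infinity>z. f z)" .
  qed
qed simp

section \<open>Weighted families and the embedding into absolutely summable coefficients\<close>

lemma sobolev_space_iff:
  "a \<in> sobolev_space s \<longleftrightarrow> in_ell2 (\<lambda>m. of_real (sobolev_weight s m) * ell2_nth a m)"
  unfolding in_ell2_def sobolev_weight_def bessel_weight_square sobolev_space_def by simp

lemma bessel_eq: "bessel s a = Abs_ell2 (\<lambda>m. of_real (sobolev_weight s m) * ell2_nth a m)"
  by (simp add: bessel_def sobolev_weight_def)

lemma bessel_nth_weight:
  "a \<in> sobolev_space s \<Longrightarrow> ell2_nth (bessel s a) m = of_real (sobolev_weight s m) * ell2_nth a m"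
  by (simp add: bessel_nth sobolev_weight_def)

lemma sobolev_space_zero [simp]: "0 \<in> sobolev_space s"
  by (simp add: sobolev_space_iff)

lemma sobolev_space_add: "a \<in> sobolev_space s \<Longrightarrow> b \<in> sobolev_space s \<Longrightarrow> a + b \<in> sobolev_space s"
  using in_ell2_add[of "\<lambda>m. of_real (sobolev_weight s m) * ell2_nth a m"] by (simp add: sobolev_space_iff distrib_left)

lemma sobolev_space_diff: "a \<in> sobolev_space s \<Longrightarrow> b \<in> sobolev_space s \<Longrightarrow> a - b \<in> sobolev_space s"
  using in_ell2_diff[of "\<lambda>m. of_real (sobolev_weight s m) * ell2_nth a m"] by (simp add: sobolev_space_iff right_diff_distrib)

lemma bessel_add: "a \<in> sobolev_space s \<Longrightarrow> b \<in> sobolev_space s \<Longrightarrow> bessel s (a + b) = bessel s a + bessel s b"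
  by (rule ell2_eqI) (simp add: bessel_nth_weight sobolev_space_add distrib_left)

lemma bessel_diff: "a \<in> sobolev_space s \<Longrightarrow> b \<in> sobolev_space s \<Longrightarrow> bessel s (a - b) = bessel s a - bessel s b"
  by (rule ell2_eqI) (simp add: bessel_nth_weight sobolev_space_diff right_diff_distrib)

lemma sobolev_norm_diff:
  "a \<in> sobolev_space s \<Longrightarrow> b \<in> sobolev_space s \<Longrightarrow> sobolev_norm s (a - b) = norm (bessel s a - bessel s b)"
  by (simp add: sobolev_space_diff bessel_diff flip: norm_bessel)

lemma sobolev_norm_zero [simp]: "sobolev_norm s 0 = 0"
  by (simp add: sobolev_norm_def)

lemma sobolev_norm_nonneg [simp]: "0 \<le> sobolev_norm s a"
  by (simp add: sobolev_norm_def infsum_nonneg)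

lemma sobolev_norm_triangle:
  "a \<in> sobolev_space s \<Longrightarrow> b \<in> sobolev_space s \<Longrightarrow> sobolev_norm s (a + b) \<le> sobolev_norm s a + sobolev_norm s b"
  by (simp add: sobolev_space_add bessel_add norm_triangle_ineq flip: norm_bessel)

text \<open>Weighted absolute values are kept as elements of L^2, so that their convolution is again
  an instance of \<open>nct_left\<close>. The value is meaningful if the weighted family is
  square-summable.\<close>

definition ell2_abs_weighted :: "('a \<Rightarrow> real) \<Rightarrow> 'a ell2 \<Rightarrow> 'a ell2" where
  "ell2_abs_weighted w a = Abs_ell2 (\<lambda>m. of_real (w m * cmod (ell2_nth a m)))"

lemma ell2_abs_weighted_sobolev:
  assumes "a \<in> sobolev_space s"
  shows "ell2_nth (ell2_abs_weighted (sobolev_weight s) a) m = of_real (sobolev_weight s m * cmod (ell2_nth a m))"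
    and "norm (ell2_abs_weighted (sobolev_weight s) a) \<le> sobolev_norm s a"
proof -
  have le: "cmod (of_real (sobolev_weight s m * cmod (ell2_nth a m))) \<le> 1 * cmod (ell2_nth (bessel s a) m)" for m
    by (simp add: bessel_nth_weight[OF assms] norm_mult)
  show "ell2_nth (ell2_abs_weighted (sobolev_weight s) a) m = of_real (sobolev_weight s m * cmod (ell2_nth a m))"
    unfolding ell2_abs_weighted_def using in_ell2_square_bound(1)[OF le] by (simp add: ell2_nth_Abs)
  show "norm (ell2_abs_weighted (sobolev_weight s) a) \<le> sobolev_norm s a"
    unfolding ell2_abs_weighted_def using in_ell2_square_bound(2)[OF le] norm_bessel[OF assms] by simp
qed

lemma ell2_abs_nth: "ell2_nth (ell2_abs_weighted (\<lambda>_. 1) a) m = of_real (cmod (ell2_nth a m))"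
proof -
  have "in_ell2 (\<lambda>m. complex_of_real (1 * cmod (ell2_nth a m)))"
    by (rule in_ell2_square_bound(1)[of _ 1 a]) simp_all
  then show ?thesis unfolding ell2_abs_weighted_def by (simp add: ell2_nth_Abs)
qed

lemma ell1_abs: "ell1 (ell2_abs_weighted (\<lambda>_. 1) a) \<longleftrightarrow> ell1 a"
  "ell1_norm (ell2_abs_weighted (\<lambda>_. 1) a) = ell1_norm a"
  by (simp_all add: ell1_def ell1_norm_def ell2_abs_nth)

lemma ell1_norm_nonneg: "0 \<le> ell1_norm a"
  unfolding ell1_norm_def by (rule infsum_nonneg) simp

text \<open>Cauchy-Schwarz for the weight of order \<open>- s\<close>, which is square-summable,
  against the weighted absolute values of the coefficients; the constant is the norm of the
  former.\<close>

lemma sobolev_embedding: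
  assumes "real CARD('n :: finite) / 2 < s"
  obtains C where "0 \<le> C"
    "\<And>a :: 'n nct_L2. a \<in> sobolev_space s \<Longrightarrow> ell1 a"
    "\<And>a :: 'n nct_L2. a \<in> sobolev_space s \<Longrightarrow> ell1_norm a \<le> C * sobolev_norm s a"
proof -
  define \<omega> :: "'n nct_L2" where "\<omega> = Abs_ell2 (\<lambda>m. of_real (sobolev_weight (- s) m))"
  have "in_ell2 (\<lambda>m :: 'n int_lattice. complex_of_real (sobolev_weight (- s) m))"
    using summable_on_sobolev_weight[OF assms]
    unfolding in_ell2_def sobolev_weight_def by (simp add: bessel_weight_square[of _ "- s" 1, simplified])
  then have \<omega>: "ell2_nth \<omega> m = of_real (sobolev_weight (- s) m)" for m by (simp add: \<omega>_def ell2_nth_Abs)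
  have inv: "sobolev_weight (- s) m * (sobolev_weight s m * r) = r" for m :: "'n int_lattice" and r
    using add_pos_nonneg[OF zero_less_one laplace_symbol_nonneg[of m]]
    by (simp add: sobolev_weight_def powr_minus)
  have inner: "Re (cnj (ell2_nth \<omega> m) * ell2_nth (ell2_abs_weighted (sobolev_weight s) a) m) = cmod (ell2_nth a m)"
    if "a \<in> sobolev_space s" for a m
    by (simp add: \<omega> ell2_abs_weighted_sobolev[OF that] inv)
  show thesis
  proof (rule that[of "norm \<omega>"])
    fix a :: "'n nct_L2" assume a: "a \<in> sobolev_space s"
    show "ell1 a"
      using ell2_inner_summable[of \<omega> "ell2_abs_weighted (sobolev_weight s) a"] by (simp only: inner[OF a] ell1_def)
    have "ell1_norm a = inner \<omega> (ell2_abs_weighted (sobolev_weight s) a)"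
      by (simp only: inner[OF a] ell1_norm_def ell2_inner_infsum)
    also have "\<dots> \<le> norm \<omega> * norm (ell2_abs_weighted (sobolev_weight s) a)" by (rule norm_cauchy_schwarz)
    also have "\<dots> \<le> norm \<omega> * sobolev_norm s a"
      by (intro mult_left_mono ell2_abs_weighted_sobolev a) simp
    finally show "ell1_norm a \<le> norm \<omega> * sobolev_norm s a" .
  qed simp
qed

text \<open>\<open>(1 + |m|)\<^sup>s \<lesssim> (1 + |p|)\<^sup>s + (1 + |m - p|)\<^sup>s\<close> reduces the product to two convolutions of an
  \<open>\<ell>\<^sup>1\<close> with an \<open>\<ell>\<^sup>2\<close> family, which are left multiplications for \<open>\<theta> = 0\<close>.\<close>

lemma nct_left_sobolev:
  assumes s: "0 \<le> s" and a: "a \<in> sobolev_space s" and b: "b \<in> sobolev_space s" and "ell1 a" "ell1 b"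
  shows "blinfun_apply (nct_left \<theta> a) b \<in> sobolev_space s"
    and "sobolev_norm s (blinfun_apply (nct_left \<theta> a) b)
      \<le> 2 powr s * (ell1_norm a * sobolev_norm s b + ell1_norm b * sobolev_norm s a)"
proof -
  let ?w = "sobolev_weight s" and ?ab = "blinfun_apply (nct_left \<theta> a) b"
  let ?l = "\<lambda>c. nct_left 0 (ell2_abs_weighted (\<lambda>_. 1) c)"
  define x where "x = blinfun_apply (?l a) (ell2_abs_weighted ?w b)"
  define y where "y = blinfun_apply (?l b) (ell2_abs_weighted ?w a)"
  have le: "cmod (of_real (?w m) * ell2_nth ?ab m) \<le> 2 powr s * cmod (ell2_nth (x + y) m)" for m
  proof -
    define tx where "tx p = cmod (ell2_nth a p) * (?w (m - p) * cmod (ell2_nth b (m - p)))" for p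
    define ty where "ty p = cmod (ell2_nth b (m - p)) * (?w p * cmod (ell2_nth a p))" for p
    have bij: "bij_betw (\<lambda>p. m - p) UNIV UNIV"
      by (rule bij_betw_byWitness[where f' = "\<lambda>p. m - p"]) auto
    have "((\<lambda>p. complex_of_real (tx p)) has_sum ell2_nth x m) UNIV"
      using has_sum_nct_left_nth[of "ell2_abs_weighted (\<lambda>_. 1) a" 0 m "ell2_abs_weighted ?w b"] \<open>ell1 a\<close>
      unfolding x_def ell1_abs ell2_abs_nth ell2_abs_weighted_sobolev[OF b] by (simp add: tx_def)
    moreover have "((\<lambda>p. complex_of_real (ty (m - p))) has_sum ell2_nth y m) UNIV"
      using has_sum_nct_left_nth[of "ell2_abs_weighted (\<lambda>_. 1) b" 0 m "ell2_abs_weighted ?w a"] \<open>ell1 b\<close>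
      unfolding y_def ell1_abs ell2_abs_nth ell2_abs_weighted_sobolev[OF a] by (simp add: ty_def)
    \<comment> \<open>In \<open>y\<close> the absolutely summable factor is \<open>b\<close>, so its
      summation index is \<open>m - p\<close>; reflecting it makes the two sums comparable term by
      term.\<close>
    then have "((\<lambda>p. complex_of_real (ty p)) has_sum ell2_nth y m) UNIV"
      using has_sum_reindex_bij_betw[OF bij, of "\<lambda>p. complex_of_real (ty p)" "ell2_nth y m"] by simp
    ultimately have "((\<lambda>p. complex_of_real (tx p) + complex_of_real (ty p)) has_sum ell2_nth (x + y) m) UNIV"
      unfolding ell2_nth_add by (rule has_sum_add)
    from has_sum_cmult_right[OF has_sum_bounded_linear[OF bounded_linear_Re this], of "2 powr s"]
    have "((\<lambda>p. 2 powr s * (tx p + ty p)) has_sum 2 powr s * Re (ell2_nth (x + y) m)) UNIV"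
      by (simp add: o_def)
    then have "cmod (of_real (?w m) * ell2_nth ?ab m) \<le> 2 powr s * Re (ell2_nth (x + y) m)"
    proof (rule norm_infsum_le[rotated])
      show "((\<lambda>p. of_real (?w m) * (ell2_nth a p * (cis (2 * pi * nct_form \<theta> p (m - p)) * ell2_nth b (m - p))))
          has_sum of_real (?w m) * ell2_nth ?ab m) UNIV"
        by (rule has_sum_cmult_right[OF has_sum_nct_left_nth[OF \<open>ell1 a\<close>]])
      fix p
      have "norm (of_real (?w m) * (ell2_nth a p * (cis (2 * pi * nct_form \<theta> p (m - p)) * ell2_nth b (m - p))))
          = ?w m * (cmod (ell2_nth a p) * cmod (ell2_nth b (m - p)))"
        by (simp add: norm_mult)
      also have "\<dots> \<le> (2 powr s * (?w p + ?w (m - p))) * (cmod (ell2_nth a p) * cmod (ell2_nth b (m - p)))"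
        using sobolev_weight_add[OF s, of p "m - p"] by (intro mult_right_mono) auto
      also have "\<dots> = 2 powr s * (tx p + ty p)" by (simp add: tx_def ty_def algebra_simps)
      finally show "norm (of_real (?w m) * (ell2_nth a p * (cis (2 * pi * nct_form \<theta> p (m - p)) * ell2_nth b (m - p))))
          \<le> 2 powr s * (tx p + ty p)" .
    qed
    also have "\<dots> \<le> 2 powr s * cmod (ell2_nth (x + y) m)"
      by (intro mult_left_mono complex_Re_le_cmod) simp
    finally show ?thesis .
  qed
  show ab: "?ab \<in> sobolev_space s"
    unfolding sobolev_space_iff by (rule in_ell2_square_bound(1)[OF le]) simp
  have norm_l: "norm (blinfun_apply (?l c) (ell2_abs_weighted ?w d)) \<le> ell1_norm c * sobolev_norm s d"
    if "ell1 c" "d \<in> sobolev_space s" for c d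
  proof -
    have "norm (blinfun_apply (?l c) (ell2_abs_weighted ?w d)) \<le> norm (?l c) * norm (ell2_abs_weighted ?w d)"
      by (rule norm_blinfun)
    also have "\<dots> \<le> ell1_norm c * sobolev_norm s d"
      using norm_nct_left[of "ell2_abs_weighted (\<lambda>_. 1) c" 0] that
      by (intro mult_mono ell2_abs_weighted_sobolev) (auto simp: ell1_abs ell1_norm_nonneg)
    finally show ?thesis .
  qed
  have "sobolev_norm s ?ab = norm (bessel s ?ab)" using ab by (simp add: norm_bessel)
  also have "\<dots> \<le> 2 powr s * norm (x + y)"
    unfolding bessel_eq by (rule in_ell2_square_bound(2)[OF le]) simp
  also have "\<dots> \<le> 2 powr s * (ell1_norm a * sobolev_norm s b + ell1_norm b * sobolev_norm s a)"
    using norm_l[OF \<open>ell1 a\<close> b] norm_l[OF \<open>ell1 b\<close> a] unfolding x_def y_def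
    by (intro mult_left_mono norm_triangle_le) auto
  finally show "sobolev_norm s ?ab \<le> 2 powr s * (ell1_norm a * sobolev_norm s b + ell1_norm b * sobolev_norm s a)" .
qed

lemma sobolev_algebra:
  assumes s: "real CARD('n :: {finite, linorder}) / 2 < s"
  obtains C where "0 \<le> C"
    "\<And>\<theta> (a :: 'n nct_L2) b. a \<in> sobolev_space s \<Longrightarrow> b \<in> sobolev_space s \<Longrightarrow> nct_mult \<theta> a b \<in> sobolev_space s"
    "\<And>\<theta> (a :: 'n nct_L2) b. a \<in> sobolev_space s \<Longrightarrow> b \<in> sobolev_space s \<Longrightarrow>
      sobolev_norm s (nct_mult \<theta> a b) \<le> C * (sobolev_norm s a * sobolev_norm s b)"
proof -
  obtain C where C: "0 \<le> C" "\<And>a :: 'n nct_L2. a \<in> sobolev_space s \<Longrightarrow> ell1 a"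
    "\<And>a :: 'n nct_L2. a \<in> sobolev_space s \<Longrightarrow> ell1_norm a \<le> C * sobolev_norm s a"
    using sobolev_embedding[OF s] by blast
  have "0 \<le> real CARD('n) / 2" by simp
  then have s0: "0 \<le> s" using s by linarith
  show thesis
  proof (rule that[of "2 powr s * (2 * C)"])
    fix \<theta> and a b :: "'n nct_L2" assume a: "a \<in> sobolev_space s" and b: "b \<in> sobolev_space s"
    note left = nct_left_sobolev[OF s0 a b C(2)[OF a] C(2)[OF b], of \<theta>]
    show "nct_mult \<theta> a b \<in> sobolev_space s" using left(1) by (simp add: nct_mult_eq C a b)
    have "sobolev_norm s (nct_mult \<theta> a b)
        \<le> 2 powr s * (ell1_norm a * sobolev_norm s b + ell1_norm b * sobolev_norm s a)"
      using left(2) by (simp add: nct_mult_eq C a b)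
    also have "\<dots> \<le> 2 powr s * (C * sobolev_norm s a * sobolev_norm s b + C * sobolev_norm s b * sobolev_norm s a)"
      by (intro mult_left_mono add_mono mult_right_mono C a b) auto
    finally show "sobolev_norm s (nct_mult \<theta> a b) \<le> 2 powr s * (2 * C) * (sobolev_norm s a * sobolev_norm s b)"
      by (simp add: algebra_simps)
  qed (use C in simp)
qed

lemma nct_mult_diff:
  assumes s: "real CARD('n :: {finite, linorder}) / 2 < s"
    and "a \<in> sobolev_space s" "a' \<in> sobolev_space s" "b \<in> sobolev_space s" "b' \<in> sobolev_space s"
  shows "nct_mult \<theta> a b - nct_mult \<theta> a' b' = nct_mult \<theta> (a - a') b + nct_mult \<theta> a' (b - b' :: 'n nct_L2)"
proof -
  have "ell1 c" if "c \<in> sobolev_space s" for c :: "'n nct_L2"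
    using sobolev_embedding[OF s] that by blast
  then show ?thesis
    using assms by (simp add: nct_mult_eq sobolev_space_diff nct_left_diff blinfun.diff_right)
qed

text \<open>Invariance of the space and boundedness on balls are included because only the
  combination of all three is stable under products. One \<open>L\<close> bounds both values and
  increments.\<close>

definition sobolev_locally_lipschitz :: "real \<Rightarrow> (('n :: finite) nct_L2 \<Rightarrow> 'n nct_L2) \<Rightarrow> bool" where
  "sobolev_locally_lipschitz s G \<longleftrightarrow> (\<forall>a\<in>sobolev_space s. G a \<in> sobolev_space s) \<and>
    (\<forall>R. \<exists>L\<ge>0. \<forall>a\<in>sobolev_space s. \<forall>b\<in>sobolev_space s. sobolev_norm s a \<le> R \<longrightarrow> sobolev_norm s b \<le> R \<longrightarrow>
      sobolev_norm s (G a) \<le> L \<and> sobolev_norm s (G a - G b) \<le> L * sobolev_norm s (a - b))"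

lemma sobolev_locally_lipschitzE:
  assumes "sobolev_locally_lipschitz s G"
  obtains L where "0 \<le> L"
    "\<And>a. a \<in> sobolev_space s \<Longrightarrow> sobolev_norm s a \<le> R \<Longrightarrow> sobolev_norm s (G a) \<le> L"
    "\<And>a b. a \<in> sobolev_space s \<Longrightarrow> b \<in> sobolev_space s \<Longrightarrow> sobolev_norm s a \<le> R \<Longrightarrow> sobolev_norm s b \<le> R \<Longrightarrow>
      sobolev_norm s (G a - G b) \<le> L * sobolev_norm s (a - b)"
proof -
  have "\<exists>L\<ge>0. \<forall>a\<in>sobolev_space s. \<forall>b\<in>sobolev_space s. sobolev_norm s a \<le> R \<longrightarrow> sobolev_norm s b \<le> R \<longrightarrow>
      sobolev_norm s (G a) \<le> L \<and> sobolev_norm s (G a - G b) \<le> L * sobolev_norm s (a - b)"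
    using assms by (simp add: sobolev_locally_lipschitz_def)
  then obtain L where "0 \<le> L" "\<forall>a\<in>sobolev_space s. \<forall>b\<in>sobolev_space s. sobolev_norm s a \<le> R \<longrightarrow> sobolev_norm s b \<le> R \<longrightarrow>
      sobolev_norm s (G a) \<le> L \<and> sobolev_norm s (G a - G b) \<le> L * sobolev_norm s (a - b)"
    by blast
  then show thesis by (intro that[of L]) auto
qed

lemma sobolev_locally_lipschitz_const: "c \<in> sobolev_space s \<Longrightarrow> sobolev_locally_lipschitz s (\<lambda>_. c)"
  unfolding sobolev_locally_lipschitz_def by (auto intro!: exI[of _ "sobolev_norm s c"])

lemma sobolev_locally_lipschitz_id: "sobolev_locally_lipschitz s (\<lambda>a. a)"
  unfolding sobolev_locally_lipschitz_def
proof (intro conjI allI ballI)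
  show "\<exists>L\<ge>0. \<forall>a\<in>sobolev_space s. \<forall>b\<in>sobolev_space s. sobolev_norm s a \<le> R \<longrightarrow> sobolev_norm s b \<le> R \<longrightarrow>
      sobolev_norm s a \<le> L \<and> sobolev_norm s (a - b) \<le> L * sobolev_norm s (a - b)" for R
    using mult_right_mono[of 1 "max R 1", OF _ sobolev_norm_nonneg] by (intro exI[of _ "max R 1"]) auto
qed

lemma sobolev_locally_lipschitz_add:
  fixes G H :: "('n :: finite) nct_L2 \<Rightarrow> 'n nct_L2"
  assumes G: "sobolev_locally_lipschitz s G" and H: "sobolev_locally_lipschitz s H"
  shows "sobolev_locally_lipschitz s (\<lambda>a. G a + H a)"
  unfolding sobolev_locally_lipschitz_def
proof (intro conjI allI ballI)
  have GS: "G a \<in> sobolev_space s" and HS: "H a \<in> sobolev_space s" if "a \<in> sobolev_space s" for a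
    using that G H by (auto simp: sobolev_locally_lipschitz_def)
  show "G a + H a \<in> sobolev_space s" if "a \<in> sobolev_space s" for a
    using that GS HS by (simp add: sobolev_space_add)
  fix R
  obtain L where L: "0 \<le> L"
    "\<And>a. a \<in> sobolev_space s \<Longrightarrow> sobolev_norm s a \<le> R \<Longrightarrow> sobolev_norm s (G a) \<le> L"
    "\<And>a b. a \<in> sobolev_space s \<Longrightarrow> b \<in> sobolev_space s \<Longrightarrow> sobolev_norm s a \<le> R \<Longrightarrow> sobolev_norm s b \<le> R \<Longrightarrow>
      sobolev_norm s (G a - G b) \<le> L * sobolev_norm s (a - b)"
    using sobolev_locally_lipschitzE[OF G, of R] by blast
  obtain M where M: "0 \<le> M"
    "\<And>a. a \<in> sobolev_space s \<Longrightarrow> sobolev_norm s a \<le> R \<Longrightarrow> sobolev_norm s (H a) \<le> M"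
    "\<And>a b. a \<in> sobolev_space s \<Longrightarrow> b \<in> sobolev_space s \<Longrightarrow> sobolev_norm s a \<le> R \<Longrightarrow> sobolev_norm s b \<le> R \<Longrightarrow>
      sobolev_norm s (H a - H b) \<le> M * sobolev_norm s (a - b)"
    using sobolev_locally_lipschitzE[OF H, of R] by blast
  show "\<exists>L\<ge>0. \<forall>a\<in>sobolev_space s. \<forall>b\<in>sobolev_space s. sobolev_norm s a \<le> R \<longrightarrow> sobolev_norm s b \<le> R \<longrightarrow>
      sobolev_norm s (G a + H a) \<le> L \<and> sobolev_norm s (G a + H a - (G b + H b)) \<le> L * sobolev_norm s (a - b)"
  proof (intro exI[of _ "L + M"] conjI ballI impI)
    fix a b :: "'n nct_L2"
    assume ab: "a \<in> sobolev_space s" "b \<in> sobolev_space s" "sobolev_norm s a \<le> R" "sobolev_norm s b \<le> R"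
    show "sobolev_norm s (G a + H a) \<le> L + M"
      by (rule order_trans[OF sobolev_norm_triangle add_mono]) (use ab L M GS HS in auto)
    have "sobolev_norm s (G a + H a - (G b + H b)) \<le> sobolev_norm s (G a - G b) + sobolev_norm s (H a - H b)"
      unfolding add_diff_add by (intro sobolev_norm_triangle sobolev_space_diff GS HS ab)
    also have "\<dots> \<le> L * sobolev_norm s (a - b) + M * sobolev_norm s (a - b)"
      by (intro add_mono L M ab)
    finally show "sobolev_norm s (G a + H a - (G b + H b)) \<le> (L + M) * sobolev_norm s (a - b)"
      by (simp add: distrib_right)
  qed (use L M in auto)
qed

lemma sobolev_locally_lipschitz_sum:
  "(\<And>i. i \<in> I \<Longrightarrow> sobolev_locally_lipschitz s (G i)) \<Longrightarrow> sobolev_locally_lipschitz s (\<lambda>a. \<Sum>i\<in>I. G i a)"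
  by (induction I rule: infinite_finite_induct)
    (auto intro: sobolev_locally_lipschitz_add sobolev_locally_lipschitz_const)

text \<open>The difference of two products is split as (G a - G b) H a + G b (H a - H b). With
  \<open>C\<close> the algebra constant, each term contributes C L M, which explains the constant 2
  C L M.\<close>

lemma sobolev_locally_lipschitz_mult:
  fixes G H :: "('n :: {finite, linorder}) nct_L2 \<Rightarrow> 'n nct_L2"
  assumes s: "real CARD('n) / 2 < s"
    and G: "sobolev_locally_lipschitz s G" and H: "sobolev_locally_lipschitz s H"
  shows "sobolev_locally_lipschitz s (\<lambda>a. nct_mult \<theta> (G a) (H a))"
  unfolding sobolev_locally_lipschitz_def
proof (intro conjI allI ballI)
  obtain C where C: "0 \<le> C"
    "\<And>\<theta> (a :: 'n nct_L2) b. a \<in> sobolev_space s \<Longrightarrow> b \<in> sobolev_space s \<Longrightarrow> nct_mult \<theta> a b \<in> sobolev_space s"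
    "\<And>\<theta> (a :: 'n nct_L2) b. a \<in> sobolev_space s \<Longrightarrow> b \<in> sobolev_space s \<Longrightarrow>
      sobolev_norm s (nct_mult \<theta> a b) \<le> C * (sobolev_norm s a * sobolev_norm s b)"
    by (rule sobolev_algebra[OF s], rule that)
  have GS: "G a \<in> sobolev_space s" and HS: "H a \<in> sobolev_space s" if "a \<in> sobolev_space s" for a
    using that G H by (auto simp: sobolev_locally_lipschitz_def)
  show "nct_mult \<theta> (G a) (H a) \<in> sobolev_space s" if "a \<in> sobolev_space s" for a
    using that GS HS by (simp add: C)
  fix R
  obtain L where L: "0 \<le> L"
    "\<And>a. a \<in> sobolev_space s \<Longrightarrow> sobolev_norm s a \<le> R \<Longrightarrow> sobolev_norm s (G a) \<le> L"
    "\<And>a b. a \<in> sobolev_space s \<Longrightarrow> b \<in> sobolev_space s \<Longrightarrow> sobolev_norm s a \<le> R \<Longrightarrow> sobolev_norm s b \<le> R \<Longrightarrow>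
      sobolev_norm s (G a - G b) \<le> L * sobolev_norm s (a - b)"
    using sobolev_locally_lipschitzE[OF G, of R] by blast
  obtain M where M: "0 \<le> M"
    "\<And>a. a \<in> sobolev_space s \<Longrightarrow> sobolev_norm s a \<le> R \<Longrightarrow> sobolev_norm s (H a) \<le> M"
    "\<And>a b. a \<in> sobolev_space s \<Longrightarrow> b \<in> sobolev_space s \<Longrightarrow> sobolev_norm s a \<le> R \<Longrightarrow> sobolev_norm s b \<le> R \<Longrightarrow>
      sobolev_norm s (H a - H b) \<le> M * sobolev_norm s (a - b)"
    using sobolev_locally_lipschitzE[OF H, of R] by blast
  show "\<exists>L\<ge>0. \<forall>a\<in>sobolev_space s. \<forall>b\<in>sobolev_space s. sobolev_norm s a \<le> R \<longrightarrow> sobolev_norm s b \<le> R \<longrightarrow>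
      sobolev_norm s (nct_mult \<theta> (G a) (H a)) \<le> L \<and>
      sobolev_norm s (nct_mult \<theta> (G a) (H a) - nct_mult \<theta> (G b) (H b)) \<le> L * sobolev_norm s (a - b)"
  proof (intro exI[of _ "2 * C * (L * M)"] conjI ballI impI)
    fix a b :: "'n nct_L2"
    assume ab: "a \<in> sobolev_space s" "b \<in> sobolev_space s" "sobolev_norm s a \<le> R" "sobolev_norm s b \<le> R"
    have "sobolev_norm s (nct_mult \<theta> (G a) (H a)) \<le> C * (sobolev_norm s (G a) * sobolev_norm s (H a))"
      by (intro C GS HS ab)
    also have "\<dots> \<le> C * (L * M)" by (intro mult_left_mono mult_mono L M C ab) simp_all
    also have "\<dots> \<le> 2 * C * (L * M)" using C(1) L(1) M(1) by simp
    finally show "sobolev_norm s (nct_mult \<theta> (G a) (H a)) \<le> 2 * C * (L * M)" .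
    let ?d = "sobolev_norm s (a - b)"
    have "sobolev_norm s (nct_mult \<theta> (G a) (H a) - nct_mult \<theta> (G b) (H b))
        \<le> sobolev_norm s (nct_mult \<theta> (G a - G b) (H a)) + sobolev_norm s (nct_mult \<theta> (G b) (H a - H b))"
      using ab by (subst nct_mult_diff[OF s]) (auto intro!: sobolev_norm_triangle C sobolev_space_diff GS HS)
    also have "\<dots> \<le> C * (sobolev_norm s (G a - G b) * sobolev_norm s (H a))
        + C * (sobolev_norm s (G b) * sobolev_norm s (H a - H b))"
      by (intro add_mono C sobolev_space_diff GS HS ab)
    also have "\<dots> \<le> C * ((L * ?d) * M) + C * (L * (M * ?d))"
      by (intro add_mono mult_left_mono mult_mono L M C ab) (simp_all add: L)
    finally show "sobolev_norm s (nct_mult \<theta> (G a) (H a) - nct_mult \<theta> (G b) (H b)) \<le> 2 * C * (L * M) * ?d"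
      by (simp add: algebra_simps)
  qed (use C L M in simp)
qed

lemma sobolev_locally_lipschitz_word:
  fixes b :: "nat \<Rightarrow> ('n :: {finite, linorder}) nct_L2"
  assumes s: "real CARD('n) / 2 < s" and "\<And>j. j \<le> \<nu> \<Longrightarrow> b j \<in> sobolev_space s"
  shows "sobolev_locally_lipschitz s (\<lambda>u. nct_word \<theta> b u \<nu>)"
  using assms(2)
  by (induction \<nu>)
    (auto intro!: sobolev_locally_lipschitz_mult[OF s] sobolev_locally_lipschitz_const sobolev_locally_lipschitz_id)

lemma sobolev_locally_lipschitz_poly:
  fixes b :: "nat \<Rightarrow> nat \<Rightarrow> nat \<Rightarrow> ('n :: {finite, linorder}) nct_L2"
  assumes s: "real CARD('n) / 2 < s"
    and b: "\<forall>\<nu>\<in>{0..q}. \<forall>\<mu>\<in>{1..N \<nu>}. \<forall>j\<in>{0..\<nu>}. b \<nu> \<mu> j \<in> sobolev_space s"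
  shows "sobolev_locally_lipschitz s (nct_poly \<theta> q N b)"
  unfolding nct_poly_def[abs_def] using b
  by (intro sobolev_locally_lipschitz_sum sobolev_locally_lipschitz_word[OF s]) auto

section \<open>Fourier multipliers and the heat semigroup\<close>

definition multiplier :: "('a \<Rightarrow> real) \<Rightarrow> 'a ell2 \<Rightarrow> 'a ell2" where
  "multiplier \<phi> a = Abs_ell2 (\<lambda>m. of_real (\<phi> m) * ell2_nth a m)"

context
  fixes \<phi> :: "'a \<Rightarrow> real" and C :: real
  assumes \<phi>: "\<And>m. \<bar>\<phi> m\<bar> \<le> C"
begin

lemma multiplier_le: "cmod (of_real (\<phi> m) * ell2_nth a m) \<le> C * cmod (ell2_nth a m)"
  using \<phi>[of m] by (auto simp: norm_mult intro: mult_right_mono)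

lemma multiplier_bound_nonneg: "0 \<le> C"
  using \<phi>[of undefined] by linarith

lemma multiplier_nth: "ell2_nth (multiplier \<phi> a) m = of_real (\<phi> m) * ell2_nth a m"
  unfolding multiplier_def
  using in_ell2_square_bound(1)[OF multiplier_le multiplier_bound_nonneg, of a] by (simp add: ell2_nth_Abs)

lemma norm_multiplier: "norm (multiplier \<phi> a) \<le> C * norm a"
  unfolding multiplier_def by (rule in_ell2_square_bound(2)[OF multiplier_le multiplier_bound_nonneg])

lemma linear_multiplier: "linear (multiplier \<phi>)"
  by (rule linearI; rule ell2_eqI) (simp_all add: multiplier_nth distrib_left)

lemma bounded_linear_multiplier: "bounded_linear (multiplier \<phi>)"
  using linear_multiplier norm_multiplier
  by (intro bounded_linear_intro[where K = C]) (simp_all add: linear_add linear_scale mult.commute)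

end

text \<open>For finitely supported families the claim is continuity of finitely many symbols. The
  common bound \<open>C\<close> makes the approximation of \<open>a\<close> by such families uniform
  in \<open>t\<close>.\<close>

lemma continuous_on_multiplier:
  fixes \<phi> :: "real \<Rightarrow> 'a \<Rightarrow> real"
  assumes \<phi>: "\<And>t m. t \<in> A \<Longrightarrow> \<bar>\<phi> t m\<bar> \<le> C" and cont: "\<And>m. continuous_on A (\<lambda>t. \<phi> t m)"
  shows "continuous_on A (\<lambda>t. multiplier (\<phi> t) a)"
proof -
  have "\<exists>F. finite F \<and> dist (\<Sum>m\<in>F. ell2_scaleC (ell2_nth a m) (ell2_basis m)) a < inverse (real (Suc n))" for n
    using ell2_finite_support_approx[of "inverse (real (Suc n))" a] by (metis inverse_positive_iff_positive of_nat_0_less_iff zero_less_Suc)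
  then obtain F where F: "\<And>n. dist (\<Sum>m\<in>F n. ell2_scaleC (ell2_nth a m) (ell2_basis m)) a < inverse (real (Suc n))"
    by metis
  define b where "b n = (\<Sum>m\<in>F n. ell2_scaleC (ell2_nth a m) (ell2_basis m))" for n
  show ?thesis
  proof (rule uniform_limit_theorem)
    have "continuous_on A (\<lambda>t. multiplier (\<phi> t) (b n))" for n
    proof (rule continuous_on_eq)
      show "continuous_on A (\<lambda>t. \<Sum>m\<in>F n. \<phi> t m *\<^sub>R ell2_scaleC (ell2_nth a m) (ell2_basis m))"
        by (intro continuous_intros cont)
      fix t assume t: "t \<in> A"
      show "(\<Sum>m\<in>F n. \<phi> t m *\<^sub>R ell2_scaleC (ell2_nth a m) (ell2_basis m)) = multiplier (\<phi> t) (b n)"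
        by (rule ell2_eqI) (auto simp: multiplier_nth[of "\<phi> t", OF \<phi>[OF t]] b_def sum_distrib_left ell2_nth_basis intro!: sum.cong)
    qed
    then show "\<forall>\<^sub>F n in sequentially. continuous_on A (\<lambda>t. multiplier (\<phi> t) (b n))" by simp
    show "uniform_limit A (\<lambda>n t. multiplier (\<phi> t) (b n)) (\<lambda>t. multiplier (\<phi> t) a) sequentially"
    proof (rule uniform_limitI)
      fix e :: real assume "0 < e"
      have "(\<lambda>n. \<bar>C\<bar> * inverse (real (Suc n))) \<longlonglongrightarrow> \<bar>C\<bar> * 0"
        by (intro tendsto_intros LIMSEQ_inverse_real_of_nat)
      then have "\<forall>\<^sub>F n in sequentially. \<bar>C\<bar> * inverse (real (Suc n)) < e"
        using \<open>0 < e\<close> by (auto dest: order_tendstoD(2))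
      then show "\<forall>\<^sub>F n in sequentially. \<forall>t\<in>A. dist (multiplier (\<phi> t) (b n)) (multiplier (\<phi> t) a) < e"
      proof eventually_elim
        fix n assume n: "\<bar>C\<bar> * inverse (real (Suc n)) < e"
        show "\<forall>t\<in>A. dist (multiplier (\<phi> t) (b n)) (multiplier (\<phi> t) a) < e"
        proof
          fix t assume t: "t \<in> A"
          have "dist (multiplier (\<phi> t) (b n)) (multiplier (\<phi> t) a) = norm (multiplier (\<phi> t) (b n - a))"
            by (simp add: dist_norm linear_diff[OF linear_multiplier[of "\<phi> t", OF \<phi>[OF t]]])
          also have "\<dots> \<le> C * norm (b n - a)" by (rule norm_multiplier[of "\<phi> t", OF \<phi>[OF t]])
          also have "\<dots> \<le> \<bar>C\<bar> * inverse (real (Suc n))"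
            using F[of n] by (intro mult_mono) (auto simp: b_def dist_norm)
          finally show "dist (multiplier (\<phi> t) (b n)) (multiplier (\<phi> t) a) < e" using n by simp
        qed
      qed
    qed
  qed simp
qed

lemma heat_multiplier: "heat t = multiplier (\<lambda>m. exp (- laplace_symbol m * t))"
  by (simp add: fun_eq_iff heat_def multiplier_def)

lemma heat_symbol_le: "0 \<le> t \<Longrightarrow> \<bar>exp (- laplace_symbol m * t)\<bar> \<le> 1"
  by simp

lemma heat_nth: "0 \<le> t \<Longrightarrow> ell2_nth (heat t a) m = of_real (exp (- laplace_symbol m * t)) * ell2_nth a m"
  unfolding heat_multiplier by (rule multiplier_nth[OF heat_symbol_le])

lemma kernel_heat: "operator_kernel (heat :: real \<Rightarrow> ('n :: finite) nct_L2 \<Rightarrow> 'n nct_L2) (\<lambda>_. 1)"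
proof (rule operator_kernel.intro)
  fix t :: real and a :: "'n nct_L2" assume t: "0 < t"
  show "linear (heat t :: 'n nct_L2 \<Rightarrow> _)"
    unfolding heat_multiplier by (rule linear_multiplier[OF heat_symbol_le]) (use t in simp)
  show "norm (heat t a) \<le> 1 * norm a"
    unfolding heat_multiplier by (rule norm_multiplier[OF heat_symbol_le]) (use t in simp)
next
  fix a :: "'n nct_L2"
  show "continuous_on {0<..} (\<lambda>t. heat t a)"
    unfolding heat_multiplier by (rule continuous_on_multiplier[where C = 1]) (auto intro!: continuous_intros)
next
  fix t :: real
  show "set_integrable lborel {0<..t} (\<lambda>_. 1 :: real)"
    by (rule set_integrable_subset[OF borel_integrable_atLeastAtMost'[of 0 t]]) (auto intro: continuous_intros)
qed (auto intro: continuous_intros)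

lemma semigroup_heat: "semigroup_kernel (heat :: real \<Rightarrow> ('n :: finite) nct_L2 \<Rightarrow> 'n nct_L2)"
proof (intro semigroup_kernel.intro kernel_heat, standard)
  fix a :: "'n nct_L2"
  show "heat 0 a = a" by (rule ell2_eqI) (simp add: heat_nth)
  show "continuous_on {0..} (\<lambda>t. heat t a)"
    unfolding heat_multiplier by (rule continuous_on_multiplier[where C = 1]) (auto intro!: continuous_intros)
  show "heat (s + t) a = heat s (heat t a)" if "0 \<le> s" "0 \<le> t" for s t
    by (rule ell2_eqI)
      (use that in \<open>simp only: heat_nth add_nonneg_nonneg distrib_left exp_add of_real_mult mult.assoc\<close>)
qed

text \<open>The operator (1 + L)^{1/2} P_t as one multiplier: for positive times the symbol is
  bounded, although its factor (1 + L)^{1/2} is not.\<close>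

definition heat_bessel :: "real \<Rightarrow> ('n :: finite) nct_L2 \<Rightarrow> 'n nct_L2" where
  "heat_bessel t = multiplier (\<lambda>m. sobolev_weight 1 m * exp (- laplace_symbol m * t))"

text \<open>The parabolic smoothing estimate, from \<open>sqrt (1 + \<lambda>) \<le> 1 + sqrt \<lambda>\<close> and
  \<open>sqrt x \<le> 1 + x \<le> exp x\<close> for \<open>x = \<lambda> t\<close>.\<close>

lemma heat_bessel_symbol_le:
  assumes t: "0 < t"
  shows "\<bar>sobolev_weight 1 m * exp (- laplace_symbol m * t)\<bar> \<le> 1 + t powr (- 1 / 2)"
proof -
  define l where "l = laplace_symbol m"
  have l: "0 \<le> l" by (simp add: l_def)
  have "sqrt (l * t) \<le> exp (l * t)"
  proof (rule real_le_lsqrt[THEN order_trans])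
    have "x \<le> (1 + x)\<^sup>2" if "0 \<le> x" for x :: real
      using zero_le_power2[of x] that by (simp add: power2_sum)
    then show "l * t \<le> (1 + l * t)\<^sup>2" using l t by simp
    show "1 + l * t \<le> exp (l * t)" by (rule exp_ge_add_one_self)
  qed (use l t in simp_all)
  then have "sqrt l * exp (- l * t) \<le> 1 / sqrt t"
    using t by (simp add: real_sqrt_mult exp_minus field_simps)
  also have "1 / sqrt t = t powr (- 1 / 2)"
    using t by (simp add: powr_half_sqrt[symmetric] powr_minus_divide)
  finally have *: "sqrt l * exp (- l * t) \<le> t powr (- 1 / 2)" .
  have "sobolev_weight 1 m = sqrt (1 + l)"
    using l by (simp add: sobolev_weight_def powr_half_sqrt l_def)
  also have "\<dots> \<le> 1 + sqrt l" using sqrt_add_le_add_sqrt[of 1 l] l by simp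
  finally have "sobolev_weight 1 m * exp (- l * t) \<le> (1 + sqrt l) * exp (- l * t)"
    by (rule mult_right_mono) simp
  also have "\<dots> = exp (- l * t) + sqrt l * exp (- l * t)" by (simp add: distrib_right)
  also have "\<dots> \<le> 1 + t powr (- 1 / 2)" using l t by (intro add_mono *) simp_all
  finally show ?thesis by (simp add: l_def)
qed

text \<open>The antiderivative r + 2 sqrt r is continuous at 0 while the integrand is singular
  there. The fundamental theorem is therefore used on the open interval with one-sided limits, and
  the endpoint \<open>t\<close> is added as a null set.\<close>

lemma integral_smoothing_bound:
  fixes t :: real
  shows "set_integrable lborel {0<..t} (\<lambda>r. 1 + r powr (- 1 / 2))"
    and "0 \<le> t \<Longrightarrow> (LINT r:{0<..t}|lborel. 1 + r powr (- 1 / 2)) = t + 2 * t powr (1 / 2)"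
proof -
  let ?f = "\<lambda>r :: real. 1 + r powr (- 1 / 2)"
  have *: "set_integrable lborel {0<..t} ?f \<and> (LINT r:{0<..t}|lborel. ?f r) = t + 2 * t powr (1 / 2)" if t: "0 < t"
  proof -
    let ?F = "\<lambda>r. r + 2 * sqrt r"
    have deriv: "DERIV ?F r :> ?f r" if "0 < r" for r
      using that by (auto intro!: derivative_eq_intros simp: powr_half_sqrt[symmetric] powr_minus_divide inverse_eq_divide)
    have cont: "(?F \<longlongrightarrow> ?F x) (at x within A)" for x A by (intro tendsto_intros)
    have lim: "((?F \<circ> real_of_ereal) \<longlongrightarrow> ?F 0) (at_right (ereal 0))" "((?F \<circ> real_of_ereal) \<longlongrightarrow> ?F t) (at_left (ereal t))"
      unfolding ereal_tendsto_simps by (rule cont)+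
    have isc: "isCont ?f r" if "0 < r" for r using that by (intro continuous_intros) auto
    note FTC = interval_integral_FTC_nonneg[of "ereal 0" "ereal t" ?F ?f, OF _ deriv isc _ lim]
    have 1: "set_integrable lborel (einterval (ereal 0) (ereal t)) ?f"
      by (rule FTC(1)) (use t in auto)
    have 2: "(LBINT r=ereal 0..ereal t. ?f r) = ?F t - ?F 0"
      by (rule FTC(2)) (use t in auto)
    have "set_integrable lborel {0<..t} ?f \<longleftrightarrow> set_integrable lborel {0<..<t} ?f"
      by (rule set_integrable_discrete_difference[where X = "{t}"]) auto
    moreover have "(LINT r:{0<..t}|lborel. ?f r) = (LINT r:{0<..<t}|lborel. ?f r)"
      by (rule set_integral_discrete_difference[where X = "{t}"]) auto
    moreover have "einterval (ereal 0) (ereal t) = {0<..<t}" by (auto simp: einterval_def)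
    moreover have "ereal 0 \<le> ereal t" using t by simp
    ultimately show ?thesis
      using 1 2 t unfolding interval_lebesgue_integral_def by (simp add: powr_half_sqrt)
  qed
  show "set_integrable lborel {0<..t} ?f" using * by (cases "0 < t") auto
  show "(LINT r:{0<..t}|lborel. ?f r) = t + 2 * t powr (1 / 2)" if "0 \<le> t"
    using * that by (cases "t = 0") (auto simp: set_lebesgue_integral_def)
qed

text \<open>The symbols are bounded uniformly only away from time 0. Continuity is obtained on each
  \<open>{d<..}\<close> and glued along this open cover of the positive half-line.\<close>

lemma kernel_heat_bessel:
  "operator_kernel (heat_bessel :: real \<Rightarrow> ('n :: finite) nct_L2 \<Rightarrow> 'n nct_L2) (\<lambda>t. 1 + t powr (- 1 / 2))"
proof (rule operator_kernel.intro)
  fix t :: real and a :: "'n nct_L2" assume t: "0 < t"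
  show "linear (heat_bessel t :: 'n nct_L2 \<Rightarrow> _)"
    unfolding heat_bessel_def by (rule linear_multiplier[OF heat_bessel_symbol_le[OF t]])
  show "norm (heat_bessel t a) \<le> (1 + t powr (- 1 / 2)) * norm a"
    unfolding heat_bessel_def by (rule norm_multiplier[OF heat_bessel_symbol_le[OF t]])
next
  fix a :: "'n nct_L2"
  have *: "continuous_on {d<..} (\<lambda>t. heat_bessel t a)" if "0 < d" for d
    unfolding heat_bessel_def
  proof (rule continuous_on_multiplier)
    fix t and m :: "'n int_lattice" assume t: "t \<in> {d<..}"
    have "t powr (- 1 / 2) \<le> d powr (- 1 / 2)" using t that by (intro powr_mono2') auto
    then show "\<bar>sobolev_weight 1 m * exp (- laplace_symbol m * t)\<bar> \<le> 1 + d powr (- 1 / 2)"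
      using heat_bessel_symbol_le[of t m] t that by simp
  qed (auto intro!: continuous_intros)
  have "(\<Union>d\<in>{0<..}. {d<..}) = {0 :: real<..}" by (auto simp: Bex_def intro: dense)
  then show "continuous_on {0<..} (\<lambda>t. heat_bessel t a)"
    using continuous_on_open_UN[of "{0 :: real<..}" "\<lambda>d. {d<..}" "\<lambda>t. heat_bessel t a"] * by simp
next
  show "set_integrable lborel {0<..t} (\<lambda>t. 1 + t powr (- 1 / 2))" for t :: real
    by (rule integral_smoothing_bound)
qed (auto intro!: continuous_intros)

section \<open>Bessel potentials of negative order as bounded inverses\<close>

lemma bessel_multiplier: "bessel s = multiplier (sobolev_weight s)"
  by (simp add: fun_eq_iff bessel_eq multiplier_def)

lemma sobolev_weight_add_index: "sobolev_weight (s + r) m = sobolev_weight s m * sobolev_weight r m"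
  by (simp add: sobolev_weight_def add_divide_distrib powr_add)

lemma sobolev_weight_zero [simp]: "sobolev_weight 0 m = 1"
  using add_pos_nonneg[OF zero_less_one laplace_symbol_nonneg[of m]] by (simp add: sobolev_weight_def)

lemma bessel_neg_symbol_le: "0 \<le> s \<Longrightarrow> \<bar>sobolev_weight (- s) m\<bar> \<le> 1"
  using powr_mono[of "- s / 2" 0 "1 + laplace_symbol m"] add_pos_nonneg[OF zero_less_one laplace_symbol_nonneg[of m]]
  by (simp add: sobolev_weight_def)

lemma bessel_neg_nth: "0 \<le> s \<Longrightarrow> ell2_nth (bessel (- s) a) m = of_real (sobolev_weight (- s) m) * ell2_nth a m"
  unfolding bessel_multiplier by (rule multiplier_nth[OF bessel_neg_symbol_le])

lemma bounded_linear_bessel_neg: "0 \<le> s \<Longrightarrow> bounded_linear (bessel (- s))"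
  unfolding bessel_multiplier by (rule bounded_linear_multiplier[OF bessel_neg_symbol_le])

lemma sobolev_weight_inverse: "sobolev_weight s m * (sobolev_weight (- s) m * r) = r"
  using sobolev_weight_add_index[of s "- s" m] by (simp flip: mult.assoc)

lemma of_real_sobolev_weight_inverse:
  "of_real (sobolev_weight s m) * (of_real (sobolev_weight (- s) m) * z) = (z :: complex)"
  "of_real (sobolev_weight (- s) m) * (of_real (sobolev_weight s m) * z) = (z :: complex)"
  using sobolev_weight_inverse[of s m 1] sobolev_weight_inverse[of "- s" m 1]
  by (simp_all flip: mult.assoc of_real_mult)

lemma bessel_neg_in_sobolev_space: "0 \<le> s \<Longrightarrow> bessel (- s) a \<in> sobolev_space s"
  by (simp add: sobolev_space_iff bessel_neg_nth of_real_sobolev_weight_inverse)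

lemma bessel_bessel_neg: "0 \<le> s \<Longrightarrow> bessel s (bessel (- s) a) = a"
  by (rule ell2_eqI)
    (simp add: bessel_nth_weight bessel_neg_in_sobolev_space bessel_neg_nth of_real_sobolev_weight_inverse)

lemma bessel_neg_bessel: "0 \<le> s \<Longrightarrow> a \<in> sobolev_space s \<Longrightarrow> bessel (- s) (bessel s a) = a"
  by (intro ell2_eqI) (simp only: bessel_nth_weight bessel_neg_nth of_real_sobolev_weight_inverse)

lemma bessel_neg_bessel_neg:
  fixes a :: "('n :: finite) nct_L2"
  assumes "0 \<le> s" "0 \<le> r"
  shows "bessel (- s) (bessel (- r) a) = bessel (- (s + r)) a"
proof (rule ell2_eqI)
  fix m :: "'n int_lattice"
  have "sobolev_weight (- (s + r)) m = sobolev_weight (- s) m * sobolev_weight (- r) m"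
    using sobolev_weight_add_index[of "- s" "- r" m] by simp
  then show "ell2_nth (bessel (- s) (bessel (- r) a)) m = ell2_nth (bessel (- (s + r)) a) m"
    by (simp only: bessel_neg_nth assms add_nonneg_nonneg of_real_mult mult.assoc)
qed

lemma bessel_neg_heat_bessel:
  fixes a :: "('n :: finite) nct_L2"
  assumes "0 < t"
  shows "bessel (- 1) (heat_bessel t a) = heat t a"
proof (rule ell2_eqI)
  fix m :: "'n int_lattice"
  have "ell2_nth (heat_bessel t a) m = of_real (sobolev_weight 1 m) * ell2_nth (heat t a) m"
    unfolding heat_bessel_def multiplier_nth[OF heat_bessel_symbol_le[OF assms]]
    using assms by (simp add: heat_nth)
  then show "ell2_nth (bessel (- 1) (heat_bessel t a)) m = ell2_nth (heat t a) m"
    by (simp only: bessel_neg_nth zero_le_one of_real_sobolev_weight_inverse)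
qed

lemma sobolev_norm_bessel_neg: "0 \<le> s \<Longrightarrow> sobolev_norm s (bessel (- s) a) = norm a"
  by (simp add: bessel_neg_in_sobolev_space bessel_bessel_neg flip: norm_bessel)

lemma heat_in_sobolev_space:
  assumes "0 \<le> t" "a \<in> sobolev_space s"
  shows "heat t a \<in> sobolev_space s"
proof -
  have "in_ell2 (\<lambda>m. of_real (exp (- laplace_symbol m * t)) * (of_real (sobolev_weight s m) * ell2_nth a m))"
    by (rule in_ell2_comparison[where C = 1, OF assms(2)[unfolded sobolev_space_iff]])
      (use assms(1) in \<open>simp add: norm_mult mult_left_le_one_le\<close>)
  then show ?thesis using assms(1) by (simp add: sobolev_space_iff heat_nth mult_ac)
qed

lemma bessel_heat: "0 \<le> t \<Longrightarrow> a \<in> sobolev_space s \<Longrightarrow> bessel s (heat t a) = heat t (bessel s a)"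
  by (rule ell2_eqI) (simp add: bessel_nth_weight heat_in_sobolev_space heat_nth mult_ac)

lemma sobolev_continuous_on_iff:
  "sobolev_continuous_on s I u \<longleftrightarrow> (\<forall>t\<in>I. u t \<in> sobolev_space s) \<and> continuous_on I (\<lambda>t. bessel s (u t))"
proof -
  have "((\<lambda>r. sobolev_norm s (u r - u t)) \<longlongrightarrow> 0) (at t within I)
      \<longleftrightarrow> ((\<lambda>r. bessel s (u r)) \<longlongrightarrow> bessel s (u t)) (at t within I)"
    if "\<forall>t\<in>I. u t \<in> sobolev_space s" "t \<in> I" for t
  proof -
    have "\<forall>\<^sub>F r in at t within I. sobolev_norm s (u r - u t) = norm (bessel s (u r) - bessel s (u t))"
      using that by (auto simp: eventually_at_filter sobolev_norm_diff)
    then have "((\<lambda>r. sobolev_norm s (u r - u t)) \<longlongrightarrow> 0) (at t within I)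
        \<longleftrightarrow> ((\<lambda>r. norm (bessel s (u r) - bessel s (u t))) \<longlongrightarrow> 0) (at t within I)"
      by (rule tendsto_cong)
    then show ?thesis by (simp add: tendsto_norm_zero_iff LIM_zero_iff)
  qed
  then show ?thesis by (auto simp: sobolev_continuous_on_def continuous_on_def)
qed

section \<open>The heat equation in Sobolev spaces\<close>

text \<open>Conjugation by \<open>bessel s\<close> turns the equation in \<open>H\<^sup>s\<close> into one in \<open>L\<^sup>2\<close>.\<close>

definition bessel_conjugate :: "real \<Rightarrow> (('n :: finite) nct_L2 \<Rightarrow> 'n nct_L2) \<Rightarrow> 'n nct_L2 \<Rightarrow> 'n nct_L2" where
  "bessel_conjugate s P v = bessel s (P (bessel (- s) v))"

lemma bessel_conjugate_bessel:
  "0 \<le> s \<Longrightarrow> a \<in> sobolev_space s \<Longrightarrow> bessel_conjugate s P (bessel s a) = bessel s (P a)"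
  by (simp add: bessel_conjugate_def bessel_neg_bessel)

locale sobolev_heat_equation =
  fixes s :: real and P :: "('n :: finite) nct_L2 \<Rightarrow> 'n nct_L2"
  assumes s_nonneg: "0 \<le> s" and lipschitz_P: "sobolev_locally_lipschitz s P"
begin

lemma P_in_sobolev_space: "a \<in> sobolev_space s \<Longrightarrow> P a \<in> sobolev_space s"
  using lipschitz_P by (simp add: sobolev_locally_lipschitz_def)

text \<open>The heat operators and \<open>heat_bessel\<close> are multipliers and commute with
  \<open>bessel s\<close>, so they enter unconjugated. Balls of H^s correspond to balls of L^2 of
  the same radius, which transports the Lipschitz bound.\<close>

sublocale smoothing heat "bessel_conjugate s P" heat_bessel "\<lambda>t. 1 + t powr (- 1 / 2)" "bessel (- 1)"
proof (intro smoothing.intro semilinear.intro semigroup_heat kernel_heat_bessel semilinear_axioms.intro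
    smoothing_axioms.intro)
  show "bounded_linear (bessel (- 1) :: 'n nct_L2 \<Rightarrow> _)" by (rule bounded_linear_bessel_neg) simp
  show "bessel (- 1) (heat_bessel t x) = heat t x" if "0 < t" for t and x :: "'n nct_L2"
    using that by (rule bessel_neg_heat_bessel)
  fix R
  obtain L where L: "0 \<le> L"
    "\<And>a b. a \<in> sobolev_space s \<Longrightarrow> b \<in> sobolev_space s \<Longrightarrow> sobolev_norm s a \<le> R \<Longrightarrow> sobolev_norm s b \<le> R \<Longrightarrow>
      sobolev_norm s (P a - P b) \<le> L * sobolev_norm s (a - b)"
    by (rule sobolev_locally_lipschitzE[OF lipschitz_P, of R], rule that)
  show "\<exists>L. \<forall>x y. norm x \<le> R \<longrightarrow> norm y \<le> R \<longrightarrow>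
      norm (bessel_conjugate s P x - bessel_conjugate s P y) \<le> L * norm (x - y)"
  proof (intro exI[of _ L] allI impI)
    fix x y :: "'n nct_L2" assume "norm x \<le> R" "norm y \<le> R"
    then have "sobolev_norm s (P (bessel (- s) x) - P (bessel (- s) y)) \<le> L * sobolev_norm s (bessel (- s) x - bessel (- s) y)"
      using s_nonneg by (intro L) (simp_all add: bessel_neg_in_sobolev_space sobolev_norm_bessel_neg)
    then show "norm (bessel_conjugate s P x - bessel_conjugate s P y) \<le> L * norm (x - y)"
      using s_nonneg by (simp add: sobolev_norm_diff bessel_neg_in_sobolev_space P_in_sobolev_space bessel_conjugate_def bessel_bessel_neg)
  qed
qed

lemma mild_solution_iff:
  assumes x: "x \<in> sobolev_space s"
  shows "mild_solution s P x T u \<longleftrightarrow> (\<forall>t\<in>{0..T}. u t \<in> sobolev_space s) \<and> mild (bessel s x) T (\<lambda>t. bessel s (u t))"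
\<comment> \<open>Either side of the equivalence implies the case condition. If it fails, both sides
  are false; if it holds, only the integral identities have to be compared.\<close>
proof (cases "(\<forall>t\<in>{0..T}. u t \<in> sobolev_space s) \<and> continuous_on {0..T} (\<lambda>t. bessel s (u t))")
  case True
  then have u: "u t \<in> sobolev_space s" if "0 \<le> t" "t \<le> T" for t using that by auto
  let ?F = "\<lambda>r. bessel_conjugate s P (bessel s (u r))"
  have "has_sobolev_integral s t (\<lambda>r. heat (t - r) (P (u r))) (u t - heat t x)
      \<longleftrightarrow> bessel s (u t) = heat t (bessel s x) + conv ?F t" if t: "t \<in> {0..T}" for t
  proof -
    have cont: "continuous_on {0..t} ?F"
      using True t by (intro continuous_on_F) (auto intro: continuous_on_subset)
    have "(\<lambda>r. indicator {0..t} r *\<^sub>R bessel s (heat (t - r) (P (u r)))) = (\<lambda>r. indicator {0..t} r *\<^sub>R heat (t - r) (?F r))"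
      using t by (auto simp: fun_eq_iff indicator_def bessel_heat P_in_sobolev_space u bessel_conjugate_bessel s_nonneg)
    moreover have "bessel s (u t - heat t x) = bessel s (u t) - heat t (bessel s x)"
      using t x u by (simp add: bessel_diff heat_in_sobolev_space bessel_heat)
    \<comment> \<open>Since the convolution exists as a Bochner integral, uniqueness of the integral
      turns the relation into an equation.\<close>
    moreover have "has_bochner_integral lborel (\<lambda>r. indicator {0..t} r *\<^sub>R heat (t - r) (?F r)) c \<longleftrightarrow> c = conv ?F t" for c
      using has_bochner_integral_conv[OF cont, of heat] has_bochner_integral_eq by fastforce
    ultimately show ?thesis
      using t x u by (auto simp: has_sobolev_integral_def heat_in_sobolev_space P_in_sobolev_space sobolev_space_diff algebra_simps)
  qed
  then show ?thesis using True by (auto simp: mild_solution_def mild_def sobolev_continuous_on_iff)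
next
  case False
  then show ?thesis by (auto simp: mild_solution_def mild_def sobolev_continuous_on_iff)
qed

lemma mild_solution_bessel_neg:
  "x \<in> sobolev_space s \<Longrightarrow> mild_solution s P x T (\<lambda>t. bessel (- s) (v t)) \<longleftrightarrow> mild (bessel s x) T v"
  by (simp add: mild_solution_iff bessel_neg_in_sobolev_space bessel_bessel_neg s_nonneg)

lemma max_time_eq:
  assumes x: "x \<in> sobolev_space s"
  shows "max_time s P x = lifespan (bessel s x)"
proof -
  have "(\<exists>u. mild_solution s P x T u) \<longleftrightarrow> (\<exists>v. mild (bessel s x) T v)" for T
    using mild_solution_iff[OF x] mild_solution_bessel_neg[OF x] by blast
  then show ?thesis by (simp add: max_time_def lifespan_def)
qed

lemma mild_solution_exists:
  assumes x: "x \<in> sobolev_space s"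
  shows "\<exists>T>0. \<exists>u. mild_solution s P x T u"
proof -
  obtain T v where "0 < T" "mild (bessel s x) T v" using local_existence[of "norm (bessel s x)"] by blast
  then show ?thesis using mild_solution_bessel_neg[OF x] by blast
qed

lemma mild_solution_unique:
  assumes x: "x \<in> sobolev_space s" and u: "mild_solution s P x T u" and v: "mild_solution s P x T v"
    and t: "t \<in> {0..T}"
  shows "u t = v t"
proof -
  have "bessel s (u t) = bessel s (v t)"
    using mild_unique[of "bessel s x" T "\<lambda>t. bessel s (u t)" "\<lambda>t. bessel s (v t)" t] u v t
    by (simp add: mild_solution_iff[OF x])
  then show ?thesis
    using u v t bessel_neg_bessel[OF s_nonneg] by (metis mild_solution_iff[OF x])
qed

lemma mild_solution_smoothing:
  assumes x: "x \<in> sobolev_space s" and u: "mild_solution s P x T u" and "0 < T"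
  shows "sobolev_continuous_on (s + 1) {0<..T} u"
    and "t \<in> {0<..T} \<Longrightarrow> sobolev_norm (s + 1) (u t) \<le> 2 * (1 + t powr (- 1 / 2)) * sobolev_norm s x
      + 2 * (SUP r\<in>{0..T}. sobolev_norm s (P (u r))) * (t + t powr (1 / 2))"
proof -
  let ?v = "\<lambda>t. bessel s (u t)"
  define w where "w = smoothed (bessel s x) ?v"
  have v: "mild (bessel s x) T ?v" and us: "\<And>t. t \<in> {0..T} \<Longrightarrow> u t \<in> sobolev_space s"
    using u by (simp_all add: mild_solution_iff[OF x])
  \<comment> \<open>This representation yields everything at once: \<open>u t\<close> lies in the
    space of order \<open>s + 1\<close>, its norm there is the norm of \<open>w t\<close>, and
    continuity is that of \<open>w\<close>.\<close>
  have uw: "u t = bessel (- (s + 1)) (w t)" if "t \<in> {0<..T}" for t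
  proof -
    have "u t = bessel (- s) (?v t)" using us that by (simp add: bessel_neg_bessel s_nonneg)
    also have "?v t = bessel (- 1) (w t)" using E_smoothed[OF v] that by (simp add: w_def)
    finally show ?thesis by (simp add: bessel_neg_bessel_neg s_nonneg)
  qed
  have s1: "0 \<le> s + 1" using s_nonneg by simp
  have "continuous_on {0<..T} (\<lambda>t. bessel (s + 1) (u t))"
    using continuous_on_smoothed[OF v]
    by (rule continuous_on_eq) (simp add: uw bessel_bessel_neg[OF s1] w_def del: minus_add_distrib)
  then show "sobolev_continuous_on (s + 1) {0<..T} u"
    by (simp add: sobolev_continuous_on_iff uw bessel_neg_in_sobolev_space[OF s1] del: minus_add_distrib)
  define M where "M = (SUP r\<in>{0..T}. sobolev_norm s (P (u r)))"
  have norm_F: "norm (bessel_conjugate s P (?v r)) = sobolev_norm s (P (u r))" if "r \<in> {0..T}" for r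
    using us[OF that] by (simp add: bessel_conjugate_bessel s_nonneg norm_bessel P_in_sobolev_space)
  obtain B where B: "norm (bessel_conjugate s P (?v r)) \<le> B" if "r \<in> {0..T}" for r
    using bounded_continuous_interval[OF continuous_on_F[OF mild_continuous[OF v]]] by blast
  have "sobolev_norm s (P (u r)) \<le> B" if "r \<in> {0..T}" for r
    using B[OF that] by (simp only: norm_F[OF that])
  \<comment> \<open>The supremum of a set of reals dominates its members only once the set is known
    to be bounded.\<close>
  then have "bdd_above ((\<lambda>r. sobolev_norm s (P (u r))) ` {0..T})" by (rule bdd_aboveI2)
  then have M: "sobolev_norm s (P (u r)) \<le> M" if "r \<in> {0..T}" for r
    unfolding M_def using that by (intro cSUP_upper)
  have "0 \<le> M" using M[of 0] \<open>0 < T\<close> sobolev_norm_nonneg[of s "P (u 0)"] by (auto simp del: sobolev_norm_nonneg)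
  assume t: "t \<in> {0<..T}"
  have "sobolev_norm (s + 1) (u t) = norm (w t)"
    using uw[OF t] sobolev_norm_bessel_neg[OF s1] by simp
  also have "\<dots> \<le> (1 + t powr (- 1 / 2)) * norm (bessel s x) + M * (LINT r:{0<..t}|lborel. 1 + r powr (- 1 / 2))"
    unfolding w_def by (rule norm_smoothed[OF v]) (use t norm_F M in auto)
  also have "\<dots> = (1 + t powr (- 1 / 2)) * sobolev_norm s x + M * (t + 2 * t powr (1 / 2))"
    using t by (simp only: norm_bessel[OF x] integral_smoothing_bound(2) greaterThanAtMost_iff less_imp_le)
  also have "\<dots> \<le> 2 * (1 + t powr (- 1 / 2)) * sobolev_norm s x + 2 * M * (t + t powr (1 / 2))"
  proof (rule add_mono)
    show "(1 + t powr (- 1 / 2)) * sobolev_norm s x \<le> 2 * (1 + t powr (- 1 / 2)) * sobolev_norm s x"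
      by (intro mult_right_mono) (use powr_ge_zero[of t "- 1 / 2"] in \<open>simp, simp\<close>)
    have "M * (t + 2 * t powr (1 / 2)) \<le> M * (2 * (t + t powr (1 / 2)))"
      using t \<open>0 \<le> M\<close> by (intro mult_left_mono) auto
    then show "M * (t + 2 * t powr (1 / 2)) \<le> 2 * M * (t + t powr (1 / 2))" by (simp add: mult_ac)
  qed
  finally show "sobolev_norm (s + 1) (u t) \<le> 2 * (1 + t powr (- 1 / 2)) * sobolev_norm s x
      + 2 * (SUP r\<in>{0..T}. sobolev_norm s (P (u r))) * (t + t powr (1 / 2))"
    by (simp add: M_def)
qed

lemma maximal_mild_solution_exists:
  assumes x: "x \<in> sobolev_space s"
  obtains u where "maximal_mild_solution s P x u"
    "max_time s P x < \<infinity> \<Longrightarrow>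
      filterlim (\<lambda>t. sobolev_norm s (u t)) at_top (at_left (real_of_ereal (max_time s P x)))"
proof -
  obtain v where v: "\<And>T. ereal T < lifespan (bessel s x) \<Longrightarrow> mild (bessel s x) T v"
    using maximal_solution by blast
  show thesis
  proof (rule that[of "\<lambda>t. bessel (- s) (v t)"])
    show "maximal_mild_solution s P x (\<lambda>t. bessel (- s) (v t))"
      using v by (simp add: maximal_mild_solution_def max_time_eq[OF x] mild_solution_bessel_neg[OF x])
    show "filterlim (\<lambda>t. sobolev_norm s (bessel (- s) (v t))) at_top (at_left (real_of_ereal (max_time s P x)))"
      if "max_time s P x < \<infinity>"
      using blow_up[OF v] that by (simp add: max_time_eq[OF x] sobolev_norm_bessel_neg s_nonneg)
  qed
qed

text \<open>A ball with an arbitrary centre \<open>c\<close> lies in the ball around 0 of radius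
  \<open>R + sobolev_norm s c\<close>, to which the abstract estimate applies.\<close>

lemma mild_solution_dependence:
  assumes "0 < T" and c: "c \<in> sobolev_space s"
  shows "\<exists>C. \<forall>u v. mild_solution s P (u 0) T u \<longrightarrow> mild_solution s P (v 0) T v \<longrightarrow>
    (\<forall>t\<in>{0..T}. sobolev_norm s (u t - c) \<le> R \<and> sobolev_norm s (v t - c) \<le> R) \<longrightarrow>
    (\<forall>t\<in>{0..T}. sobolev_norm s (u t - v t) \<le> C * sobolev_norm s (u 0 - v 0))"
proof -
  obtain C where C: "\<And>x y u v. mild x T u \<Longrightarrow> mild y T v \<Longrightarrow>
      (\<forall>t\<in>{0..T}. norm (u t) \<le> R + sobolev_norm s c \<and> norm (v t) \<le> R + sobolev_norm s c) \<Longrightarrow>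
      (\<forall>t\<in>{0..T}. norm (u t - v t) \<le> C * norm (x - y))"
    using lipschitz_dependence[of T "R + sobolev_norm s c"] by blast
  have bound: "norm (bessel s a) \<le> R + sobolev_norm s c" if "a \<in> sobolev_space s" "sobolev_norm s (a - c) \<le> R" for a
    using sobolev_norm_triangle[of "a - c" s c] that c by (simp add: sobolev_space_diff norm_bessel)
  show ?thesis
  proof (intro exI[of _ C] allI impI ballI)
    fix u v t
    assume u: "mild_solution s P (u 0) T u" and v: "mild_solution s P (v 0) T v" and t: "t \<in> {0..T}"
      and R: "\<forall>t\<in>{0..T}. sobolev_norm s (u t - c) \<le> R \<and> sobolev_norm s (v t - c) \<le> R"
    have us: "u r \<in> sobolev_space s" "v r \<in> sobolev_space s" if "r \<in> {0..T}" for r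
      using u v that by (auto simp: mild_solution_def sobolev_continuous_on_def)
    have 0: "0 \<in> {0..T}" using \<open>0 < T\<close> by simp
    have "norm (bessel s (u t) - bessel s (v t)) \<le> C * norm (bessel s (u 0) - bessel s (v 0))"
      using C[of "bessel s (u 0)" "\<lambda>t. bessel s (u t)" "bessel s (v 0)" "\<lambda>t. bessel s (v t)"]
        u v us 0 t R bound by (simp add: mild_solution_iff)
    then show "sobolev_norm s (u t - v t) \<le> C * sobolev_norm s (u 0 - v 0)"
      using us[OF t] us[OF 0] by (simp add: sobolev_norm_diff)
  qed
qed

end

theorem corollary5p2:
  fixes k :: nat
  assumes "1 \<le> k" and "real k > real CARD('n :: {finite, linorder}) / 2"
  shows "\<exists>C :: real. \<forall>(\<theta> :: 'n real_matrix) q N b.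
    transpose \<theta> = - \<theta> \<longrightarrow> 1 \<le> q \<longrightarrow>
    (\<forall>\<nu>\<in>{0..q}. \<forall>\<mu>\<in>{1..N \<nu>}. \<forall>j\<in>{0..\<nu>}. b \<nu> \<mu> j \<in> sobolev_space k) \<longrightarrow>
    (let P = nct_poly \<theta> q N b in
      (\<forall>u0\<in>sobolev_space k.
        (\<exists>T>0. \<exists>u. mild_solution k P u0 T u) \<and>
        (\<forall>T>0. \<forall>u v. mild_solution k P u0 T u \<longrightarrow> mild_solution k P u0 T v \<longrightarrow>
          (\<forall>t\<in>{0..T}. u t = v t)) \<and>
        0 < max_time k P u0 \<and>
        (\<exists>u. maximal_mild_solution k P u0 u \<and>
          (max_time k P u0 < \<infinity> \<longrightarrow>
            filterlim (\<lambda>t. sobolev_norm k (u t)) at_top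
              (at_left (real_of_ereal (max_time k P u0)))) \<and>
          (\<forall>T. 0 < T \<and> ereal T < max_time k P u0 \<longrightarrow>
            sobolev_continuous_on (k + 1) {0<..T} u \<and>
            (\<forall>t\<in>{0<..T}.
              sobolev_norm (k + 1) (u t)
                \<le> C * (1 + t powr (- 1 / 2)) * sobolev_norm k u0
                  + C * (SUP s\<in>{0..T}. sobolev_norm k (P (u s))) * (t + t powr (1 / 2)))))) \<and>
      (\<forall>T>0. \<forall>c\<in>sobolev_space k. \<forall>R. \<exists>C\<^sub>T. \<forall>u v.
        mild_solution k P (u 0) T u \<longrightarrow> mild_solution k P (v 0) T v \<longrightarrow>
        (\<forall>t\<in>{0..T}. sobolev_norm k (u t - c) \<le> R \<and> sobolev_norm k (v t - c) \<le> R) \<longrightarrow>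
        (\<forall>t\<in>{0..T}. sobolev_norm k (u t - v t) \<le> C\<^sub>T * sobolev_norm k (u 0 - v 0))))"
\<comment> \<open>The value 2 works for all orders and dimensions, and it is fixed before the matrix
  and the polynomial.\<close>
proof (rule exI[of _ 2], unfold Let_def, intro allI impI conjI ballI)
  fix \<theta> :: "'n real_matrix" and q :: nat and N :: "nat \<Rightarrow> nat"
    and b :: "nat \<Rightarrow> nat \<Rightarrow> nat \<Rightarrow> 'n nct_L2"
  assume b: "\<forall>\<nu>\<in>{0..q}. \<forall>\<mu>\<in>{1..N \<nu>}. \<forall>j\<in>{0..\<nu>}. b \<nu> \<mu> j \<in> sobolev_space k"
  let ?P = "nct_poly \<theta> q N b"
  interpret sobolev_heat_equation "real k" ?P
    by unfold_locales (use sobolev_locally_lipschitz_poly[OF _ b] assms(2) in auto)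
  {
    fix u0 :: "'n nct_L2" assume u0: "u0 \<in> sobolev_space k"
    show "\<exists>T>0. \<exists>u. mild_solution k ?P u0 T u" by (rule mild_solution_exists[OF u0])
    show "0 < max_time k ?P u0" by (simp add: max_time_eq[OF u0] lifespan_pos)
    show "u t = v t" if "mild_solution k ?P u0 T u" "mild_solution k ?P u0 T v" "t \<in> {0..T}" for T u v t
      using that by (rule mild_solution_unique[OF u0])
    obtain u where u: "maximal_mild_solution k ?P u0 u"
      "max_time k ?P u0 < \<infinity> \<Longrightarrow>
        filterlim (\<lambda>t. sobolev_norm k (u t)) at_top (at_left (real_of_ereal (max_time k ?P u0)))"
      using maximal_mild_solution_exists[OF u0] by blast
    have mild: "mild_solution k ?P u0 T u" if "0 < T" "ereal T < max_time k ?P u0" for T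
      using u(1) that by (simp add: maximal_mild_solution_def)
    have k1: "real (k + 1) = real k + 1" by simp
    show "\<exists>u. maximal_mild_solution k ?P u0 u \<and>
        (max_time k ?P u0 < \<infinity> \<longrightarrow>
          filterlim (\<lambda>t. sobolev_norm k (u t)) at_top
            (at_left (real_of_ereal (max_time k ?P u0)))) \<and>
        (\<forall>T. 0 < T \<and> ereal T < max_time k ?P u0 \<longrightarrow>
          sobolev_continuous_on (k + 1) {0<..T} u \<and>
          (\<forall>t\<in>{0<..T}.
            sobolev_norm (k + 1) (u t)
              \<le> 2 * (1 + t powr (- 1 / 2)) * sobolev_norm k u0
                + 2 * (SUP s\<in>{0..T}. sobolev_norm k (?P (u s))) * (t + t powr (1 / 2))))"
      using u mild mild_solution_smoothing[OF u0] unfolding k1 by blast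
  }
  fix T R :: real and c :: "'n nct_L2" assume "0 < T" "c \<in> sobolev_space k"
  then show "\<exists>C\<^sub>T. \<forall>u v.
      mild_solution k ?P (u 0) T u \<longrightarrow> mild_solution k ?P (v 0) T v \<longrightarrow>
      (\<forall>t\<in>{0..T}. sobolev_norm k (u t - c) \<le> R \<and> sobolev_norm k (v t - c) \<le> R) \<longrightarrow>
      (\<forall>t\<in>{0..T}. sobolev_norm k (u t - v t) \<le> C\<^sub>T * sobolev_norm k (u 0 - v 0))"
    by (rule mild_solution_dependence)
qed

end
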